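(* Let $D\in\mathbb{N}$, $1<p\le 2$, and let $\{v^{(d)}_n\}_{n\in\mathbb{Z}_+}$, $d=1,\dots,D$, be bounded Vilenkin systems (possibly different for different $d$). Then there exists a constant $C$ such that the following holds. Let $I_k=I_k^1\times\dots\times I_k^D\subseteq\mathbb{Z}_+^D$ be a family of pairwise disjoint sets such that each $I_k^d$, $d\in\{1,\dots,D\}$, is an interval in $\mathbb{Z}_+$, and let $f_k:[0,1)^D\to\mathbb{R}$ be functions with Vilenkin–Fourier spectrum in $I_k$, i.e. $$f_k(x)=\sum_{(n_1,\dots,n_D)\in I_k}\langle f_k, v^{(1)}_{n_1}\otimes\dots\otimes v^{(D)}_{n_D}\rangle\, v^{(1)}_{n_1}(x_1)\cdots v^{(D)}_{n_D}(x_D).$$ Then $$\Big\|\sum_k f_k\Big\|_{L^p([0,1)^D)}\le C\,\Big\|\Big(\sum_k|f_k|^2\Big)^{1/2}\Big\|_{L^p([0,1)^D)}.$$ The constant $C$ does not depend on the choice of the rectangles $\{I_k\}$ or of the functions $\{f_k\}$.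
   Context: $\mathbb{N}=\{1,2,\dots\}$, $\mathbb{Z}_+=\mathbb{N}\cup\{0\}$. An interval in $\mathbb{Z}_+$ is a set $[a,b)=\{x\in\mathbb{Z}_+: a\le x<b\}$ with $a,b\in\mathbb{Z}_+$. The family $\{I_k\}$ is countable (finite or infinite); if it is infinite and the right-hand side is finite, $\sum_k f_k$ is understood as a series converging in $L^p$. Vilenkin system: let $\mathbf{p}=\{p_n\}_{n\in\mathbb{N}}$ be a sequence of integers $p_n\ge 2$, and put $P_0=1$, $P_n=p_1\cdots p_n$. Every $x\in[0,1)$ is written $x=\sum_{k\ge1}x_k/P_k$ with integers $0\le x_k<p_k$ (if there are two such representations, the one with $x_k\to0$ is chosen), and every $n\in\mathbb{Z}_+$ is written uniquely $n=\sum_{k\ge1}n_kP_{k-1}$ with integers $0\le n_k<p_k$. The generalized Rademacher functions are $r_k(x)=\exp(2\pi i x_k/p_k)$, and the Vilenkin functions are $v_n(x)=\prod_{k\ge1}r_k(x)^{n_k}$, $n\in\mathbb{Z}_+$. They form an orthonormal basis of $L^2[0,1)$, the Vilenkin system corresponding to $\mathbf{p}$. The system is bounded if $\sup_n p_n<\infty$. Here $\{v^{(d)}_n\}$ is the Vilenkin system of a bounded sequence $\mathbf{p}_d$. $\langle\cdot,\cdot\rangle$ is the inner product of $L^2[0,1)^D$. *)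

theory Defs
  imports "HOL-Analysis.Analysis"
begin

section \<open>Vilenkin systems\<close>

text \<open>
  A base sequence is a function \<open>b :: nat \<Rightarrow> nat\<close> of which only the values \<open>b 1, b 2, \<dots>\<close> matter.
  Digit sequences are likewise indexed from 1; they are normalised to be 0 at the unused index 0,
  so that uniqueness of an expansion is literally uniqueness of the function.
\<close>

definition bounded_base :: "(nat \<Rightarrow> nat) \<Rightarrow> bool" where
  "bounded_base b \<longleftrightarrow> (\<forall>k\<ge>1. 2 \<le> b k) \<and> (\<exists>B. \<forall>k\<ge>1. b k \<le> B)"

definition base_prod :: "(nat \<Rightarrow> nat) \<Rightarrow> nat \<Rightarrow> nat" where
  "base_prod b n = (\<Prod>k=1..n. b k)"

definition real_digit_expansion :: "(nat \<Rightarrow> nat) \<Rightarrow> real \<Rightarrow> (nat \<Rightarrow> nat) \<Rightarrow> bool" where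
  "real_digit_expansion b x c \<longleftrightarrow> c 0 = 0 \<and> (\<forall>k\<ge>1. c k < b k) \<and>
     (\<lambda>k. real (c (Suc k)) / real (base_prod b (Suc k))) sums x"

definition real_digits :: "(nat \<Rightarrow> nat) \<Rightarrow> real \<Rightarrow> nat \<Rightarrow> nat" where
  "real_digits b x = (THE c. real_digit_expansion b x c \<and>
     ((\<exists>c'. real_digit_expansion b x c' \<and> c' \<noteq> c) \<longrightarrow> (\<lambda>k. real (c k)) \<longlonglongrightarrow> 0))"

definition nat_digits :: "(nat \<Rightarrow> nat) \<Rightarrow> nat \<Rightarrow> nat \<Rightarrow> nat" where
  "nat_digits b n = (THE c. c 0 = 0 \<and> (\<forall>k\<ge>1. c k < b k) \<and> finite {k. c k \<noteq> 0} \<and>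
     n = (\<Sum>k | c k \<noteq> 0. c k * base_prod b (k - 1)))"

definition rademacher :: "(nat \<Rightarrow> nat) \<Rightarrow> nat \<Rightarrow> real \<Rightarrow> complex" where
  "rademacher b k x = exp (2 * of_real pi * \<i> * of_nat (real_digits b x k) / of_nat (b k))"

definition vilenkin :: "(nat \<Rightarrow> nat) \<Rightarrow> nat \<Rightarrow> real \<Rightarrow> complex" where
  "vilenkin b n x = (\<Prod>k | nat_digits b n k \<noteq> 0. rademacher b k x ^ nat_digits b n k)"


section \<open>The cube, tensor products and spectra\<close>

text \<open>
  Points of the \<open>D\<close>-dimensional cube and multi-indices are extensional functions on \<open>{1..D}\<close>.
\<close>

definition cube :: "nat \<Rightarrow> (nat \<Rightarrow> real) measure" where
  "cube D = Pi\<^sub>M {1..D} (\<lambda>_. restrict_space lborel {0..<1})"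

definition vilenkin_tensor ::
    "nat \<Rightarrow> (nat \<Rightarrow> nat \<Rightarrow> nat) \<Rightarrow> (nat \<Rightarrow> nat) \<Rightarrow> (nat \<Rightarrow> real) \<Rightarrow> complex" where
  "vilenkin_tensor D b n x = (\<Prod>d=1..D. vilenkin (b d) (n d) (x d))"

definition cube_inner ::
    "nat \<Rightarrow> ((nat \<Rightarrow> real) \<Rightarrow> complex) \<Rightarrow> ((nat \<Rightarrow> real) \<Rightarrow> complex) \<Rightarrow> complex" where
  "cube_inner D f g = (LINT x|cube D. f x * cnj (g x))"

definition is_rectangle :: "nat \<Rightarrow> (nat \<Rightarrow> nat) set \<Rightarrow> bool" where
  "is_rectangle D R \<longleftrightarrow> (\<exists>l u. R = (\<Pi>\<^sub>E d\<in>{1..D}. {l d..<u d}))"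

text \<open>
  The expansion is required almost everywhere only. Its right-hand side is a finite sum of bounded
  functions when \<open>R\<close> is a rectangle, so membership of \<open>f\<close> in \<open>L\<^sup>2\<close> need not be assumed separately.
\<close>

definition has_spectrum_in ::
    "nat \<Rightarrow> (nat \<Rightarrow> nat \<Rightarrow> nat) \<Rightarrow> ((nat \<Rightarrow> real) \<Rightarrow> real) \<Rightarrow> (nat \<Rightarrow> nat) set \<Rightarrow> bool" where
  "has_spectrum_in D b f R \<longleftrightarrow> f \<in> borel_measurable (cube D) \<and>
     (AE x in cube D. complex_of_real (f x) =
        (\<Sum>n\<in>R. cube_inner D (\<lambda>y. complex_of_real (f y)) (vilenkin_tensor D b n)
                 * vilenkin_tensor D b n x))"


section \<open>\<open>L\<^sup>p\<close> norms\<close>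

text \<open>Only used for exponents \<open>a > 0\<close>.\<close>

definition ennpowr :: "ennreal \<Rightarrow> real \<Rightarrow> ennreal" where
  "ennpowr t a = (if t = \<infinity> then \<infinity> else ennreal (enn2real t powr a))"

text \<open>
  The norm is a function of the modulus, which may take the value \<open>\<infinity>\<close>
  (as infinite square functions can).
\<close>

definition Lp_norm :: "'a measure \<Rightarrow> real \<Rightarrow> ('a \<Rightarrow> ennreal) \<Rightarrow> ennreal" where
  "Lp_norm M p h = ennpowr (\<integral>\<^sup>+x. ennpowr (h x) p \<partial>M) (1 / p)"

definition square_function :: "(nat \<Rightarrow> 'a \<Rightarrow> real) \<Rightarrow> nat set \<Rightarrow> 'a \<Rightarrow> ennreal" where
  "square_function f K x = ennpowr (\<Sum>\<^sub>\<infinity>k\<in>K. ennreal (\<bar>f k x\<bar>\<^sup>2)) (1 / 2)"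

text \<open>
  The sum of a countable family in \<open>L\<^sup>p\<close> is the unordered sum, as in \<open>has_sum\<close>.
  For finite \<open>K\<close> it says that \<open>g\<close> is almost everywhere equal to the pointwise sum.
\<close>

definition has_Lp_sum ::
    "'a measure \<Rightarrow> real \<Rightarrow> (nat \<Rightarrow> 'a \<Rightarrow> real) \<Rightarrow> nat set \<Rightarrow> ('a \<Rightarrow> real) \<Rightarrow> bool" where
  "has_Lp_sum M p f K g \<longleftrightarrow> g \<in> borel_measurable M \<and>
     ((\<lambda>F. Lp_norm M p (\<lambda>x. ennreal \<bar>(\<Sum>k\<in>F. f k x) - g x\<bar>)) \<longlongrightarrow> 0) (finite_subsets_at_top K)"


section \<open>The descriptions defining the digits are proper\<close>

lemma base_prod_Suc: "base_prod b (Suc n) = base_prod b n * b (Suc n)"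
  by (simp add: base_prod_def)

lemma base_prod_ge: assumes "\<forall>k\<ge>1. 2 \<le> b k" shows "2 ^ n \<le> base_prod b n"
proof (induction n)
  case (Suc n)
  then show ?case using mult_le_mono[OF Suc, of 2 "b (Suc n)"] assms by (simp add: base_prod_Suc mult.commute)
qed (simp add: base_prod_def)

lemma tail_sums:
  assumes b: "\<forall>k\<ge>1. 2 \<le> b k"
  shows "(\<lambda>k. (real (b (Suc (k+m))) - 1) / real (base_prod b (Suc (k+m)))) sums (1 / real (base_prod b m))"
proof -
  have pos: "base_prod b n > 0" for n using base_prod_ge[OF b, of n] by (metis gr0I not_one_le_zero one_le_power one_le_numeral le_trans le_zero_eq)
  have lim: "(\<lambda>n. 1 / real (base_prod b n)) \<longlonglongrightarrow> 0"
  proof (rule tendsto_sandwich[where f="\<lambda>_. 0" and h="\<lambda>n. (1/2::real)^n"])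
    show "\<forall>\<^sub>F n in sequentially. 1 / real (base_prod b n) \<le> (1/2)^n"
    proof (intro always_eventually allI)
      fix n have "(2::real)^n \<le> real (base_prod b n)" using base_prod_ge[OF b, of n]
        by (metis of_nat_le_iff of_nat_numeral of_nat_power)
      then show "1 / real (base_prod b n) \<le> (1/2)^n" by (simp add: power_one_over frac_le)
    qed
  qed (auto intro: LIMSEQ_realpow_zero)
  have lim': "(\<lambda>n. 1 / real (base_prod b (n+m))) \<longlonglongrightarrow> 0" using LIMSEQ_ignore_initial_segment[OF lim] .
  have "(\<lambda>k. 1 / real (base_prod b (k+m)) - 1 / real (base_prod b (Suc k+m))) sums (1 / real (base_prod b (0+m)) - 0)"
    by (rule telescope_sums'[OF lim'])
  moreover have "1 / real (base_prod b (k+m)) - 1 / real (base_prod b (Suc k+m)) = (real (b (Suc (k+m))) - 1) / real (base_prod b (Suc (k+m)))" for k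
  proof -
    have "b (Suc (k+m)) > 0" using b by (metis One_nat_def le_add1 not_gr0 not_numeral_le_zero plus_1_eq_Suc)
    then show ?thesis using pos[of "k+m"] by (simp add: base_prod_Suc field_simps)
  qed
  ultimately show ?thesis by simp
qed

lemma two_expansions:
  assumes b: "\<forall>k\<ge>1. 2 \<le> b k" and c: "real_digit_expansion b x c" and c': "real_digit_expansion b x c'"
    and lt: "\<forall>k<m. c k = c' k" "c m < c' m" and k: "k > m"
  shows "c k = b k - 1 \<and> c' k = 0"
proof -
  have m: "m \<ge> 1" using lt c c' unfolding real_digit_expansion_def by (metis less_one not_less not_less0)
  then obtain m' where m': "m = Suc m'" by (cases m) auto
  have pos: "real (base_prod b n) > 0" for n using base_prod_ge[OF b, of n] by (metis gr0I not_one_le_zero one_le_power one_le_numeral le_trans le_zero_eq of_nat_0_less_iff)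
  define u where "u k = (real (c (Suc k)) - real (c' (Suc k))) / real (base_prod b (Suc k))" for k
  have "u sums (x - x)" unfolding u_def diff_divide_distrib using c c' unfolding real_digit_expansion_def
    by (intro sums_diff) auto
  then have u0: "u sums 0" by simp
  have s: "sum u {..<m} = u m'" unfolding m' using lt(1) by (simp add: u_def m')
  have ut: "(\<lambda>k. u (k+m)) sums (- u m')" using sums_split_initial_segment[OF u0, of m] s by simp
  define t where "t k = (real (b (Suc (k+m))) - 1) / real (base_prod b (Suc (k+m)))" for k
  have ts: "t sums (1 / real (base_prod b m))" unfolding t_def by (rule tail_sums[OF b])
  have d: "(\<lambda>k. t k - u (k+m)) sums (1 / real (base_prod b m) + u m')" using sums_diff[OF ts ut] by simp
  have um: "u m' \<le> - 1 / real (base_prod b m)" unfolding u_def m'[symmetric]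
    using lt(2) pos[of m] by (intro divide_right_mono) auto
  have nn: "t k - u (k+m) \<ge> 0 " for k
  proof -
    have "c (Suc (k+m)) < b (Suc (k+m))" using c unfolding real_digit_expansion_def by auto
    then have "real (c (Suc (k+m))) - real (c' (Suc (k+m))) \<le> real (b (Suc (k+m))) - 1" by linarith
    then show ?thesis unfolding t_def u_def using pos[of "Suc (k+m)"] by (simp add: divide_right_mono)
  qed
  have "suminf (\<lambda>k. t k - u (k+m)) \<ge> 0" using d nn by (intro suminf_nonneg) (auto simp: sums_iff)
  then have "suminf (\<lambda>k. t k - u (k+m)) = 0" using um d by (auto simp: sums_iff)
  then have z: "t k - u (k+m) = 0" for k using suminf_eq_zero_iff[OF sums_summable[OF d] nn] by simp
  obtain j where j: "k = Suc (j+m)" using k by (metis add.commute less_imp_Suc_add)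
  have "real (b k) - 1 = real (c k) - real (c' k)"
    using z[of j] pos[of k] unfolding t_def u_def j[symmetric] by simp
  moreover have "c k < b k" using c j unfolding real_digit_expansion_def by auto
  ultimately show ?thesis by linarith
qed

lemma expansion_exists:
  assumes b: "\<forall>k\<ge>1. 2 \<le> b k" and x: "0 \<le> x" "x < 1"
  shows "\<exists>c. real_digit_expansion b x c"
proof -
  define N where "N n = nat \<lfloor>x * real (base_prod b n)\<rfloor>" for n
  define c where "c k = (if k = 0 then 0 else N k mod b k)" for k
  have pos: "real (base_prod b n) > 0" for n using base_prod_ge[OF b, of n] by (metis gr0I not_one_le_zero one_le_power one_le_numeral le_trans le_zero_eq of_nat_0_less_iff)
  have bpos: "b (Suc n) > 0" for n using b by (metis One_nat_def le_add1 not_gr0 not_numeral_le_zero plus_1_eq_Suc)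
  have Nd: "N (Suc n) div b (Suc n) = N n" for n
  proof -
    have "\<lfloor>x * real (base_prod b n)\<rfloor> = \<lfloor>(x * real (base_prod b (Suc n))) / real_of_int (int (b (Suc n)))\<rfloor>"
      using bpos[of n] by (simp add: base_prod_Suc)
    also have "\<dots> = \<lfloor>x * real (base_prod b (Suc n))\<rfloor> div int (b (Suc n))"
      by (rule floor_divide_real_eq_div) simp
    finally show ?thesis unfolding N_def by (simp add: nat_div_distrib x)
  qed
  have s: "(\<Sum>k<n. real (c (Suc k)) / real (base_prod b (Suc k))) = real (N n) / real (base_prod b n)" for n
  proof (induction n)
    case 0 then show ?case using x by (simp add: N_def base_prod_def floor_eq_iff)
  next
    case (Suc n)
    have "N (Suc n) = N n * b (Suc n) + c (Suc n)" using Nd[of n] div_mult_mod_eq[of "N (Suc n)" "b (Suc n)"] by (simp add: c_def)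
    then have "real (N (Suc n)) = real (N n) * real (b (Suc n)) + real (c (Suc n))" by simp
    then show ?case using Suc pos[of n] bpos[of n] by (simp add: base_prod_Suc field_simps)
  qed
  have lim: "(\<lambda>n. x - (1/2::real)^n) \<longlonglongrightarrow> x"
    using tendsto_diff[OF tendsto_const LIMSEQ_realpow_zero[of "1/2::real"]] by simp
  have "(\<lambda>n. real (N n) / real (base_prod b n)) \<longlonglongrightarrow> x"
  proof (rule tendsto_sandwich[OF _ _ lim tendsto_const])
    have N: "real (N n) = of_int \<lfloor>x * real (base_prod b n)\<rfloor>" for n
      unfolding N_def using x by simp
    show "\<forall>\<^sub>F n in sequentially. real (N n) / real (base_prod b n) \<le> x"
      using pos N by (simp add: pos_divide_le_eq)
    show "\<forall>\<^sub>F n in sequentially. x - (1/2)^n \<le> real (N n) / real (base_prod b n)"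
    proof (intro always_eventually allI)
      fix n
      have "(2::real)^n \<le> real (base_prod b n)" using base_prod_ge[OF b, of n]
        by (metis of_nat_le_iff of_nat_numeral of_nat_power)
      then have 1: "1 / real (base_prod b n) \<le> (1/2)^n" by (simp add: power_one_over frac_le)
      have "x * real (base_prod b n) - 1 \<le> real (N n)" unfolding N by linarith
      then have "x - 1 / real (base_prod b n) \<le> real (N n) / real (base_prod b n)"
        using pos[of n] divide_right_mono[of "x * real (base_prod b n) - 1" "real (N n)" "real (base_prod b n)"]
        by (simp add: diff_divide_distrib)
      with 1 show "x - (1/2)^n \<le> real (N n) / real (base_prod b n)" by linarith
    qed
  qed
  then have "(\<lambda>k. real (c (Suc k)) / real (base_prod b (Suc k))) sums x" unfolding sums_def s .
  moreover have "\<forall>k\<ge>1. c k < b k" using b by (auto simp: c_def)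
  moreover have "c 0 = 0" by (simp add: c_def)
  ultimately show ?thesis unfolding real_digit_expansion_def by blast
qed

lemma ex1_real_digits:
  assumes b: "\<forall>k\<ge>1. 2 \<le> b k" and x: "0 \<le> x" "x < 1"
  shows "\<exists>!c. real_digit_expansion b x c \<and>
     ((\<exists>c'. real_digit_expansion b x c' \<and> c' \<noteq> c) \<longrightarrow> (\<lambda>k. real (c k)) \<longlonglongrightarrow> 0)"
proof -
  have pair: "((\<lambda>k. real (c k)) \<longlonglongrightarrow> 0 \<and> \<not> (\<lambda>k. real (c' k)) \<longlonglongrightarrow> 0) \<or> ((\<lambda>k. real (c' k)) \<longlonglongrightarrow> 0 \<and> \<not> (\<lambda>k. real (c k)) \<longlonglongrightarrow> 0)"
    if "real_digit_expansion b x c" "real_digit_expansion b x c'" "c \<noteq> c'" for c c'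
  proof -
    have *: "(\<lambda>k. real (c' k)) \<longlonglongrightarrow> 0 \<and> \<not> (\<lambda>k. real (c k)) \<longlonglongrightarrow> 0"
      if h: "\<forall>k>m. c k = b k - 1 \<and> c' k = 0" for c c' m
    proof
      show "(\<lambda>k. real (c' k)) \<longlonglongrightarrow> 0" using h
        by (intro tendsto_eventually) (auto simp: eventually_sequentially intro!: exI[of _ "Suc m"])
      show "\<not> (\<lambda>k. real (c k)) \<longlonglongrightarrow> 0"
      proof
        assume "(\<lambda>k. real (c k)) \<longlonglongrightarrow> 0"
        then have "\<forall>\<^sub>F k in sequentially. real (c k) < 1" by (rule order_tendstoD) simp
        then obtain n where n: "\<And>k. k \<ge> n \<Longrightarrow> real (c k) < 1" by (auto simp: eventually_sequentially)
        have "b (max n (Suc m)) \<ge> 2" using b by auto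
        then show False using h[rule_format, of "max n (Suc m)"] n[of "max n (Suc m)"] by auto
      qed
    qed
    define m where "m = (LEAST k. c k \<noteq> c' k)"
    have ne: "c m \<noteq> c' m" unfolding m_def by (rule LeastI_ex[of "\<lambda>k. c k \<noteq> c' k"]) (rule ccontr, use that(3) in \<open>simp add: fun_eq_iff\<close>)
    have eq: "\<forall>k<m. c k = c' k" unfolding m_def using not_less_Least by blast
    show ?thesis
    proof (cases "c m < c' m")
      case True
      show ?thesis using *[of m c c'] two_expansions[OF b that(1,2) eq True] by metis
    next
      case False
      then have lt: "c' m < c m" using ne by simp
      have eq': "\<forall>k<m. c' k = c k" using eq by simp
      show ?thesis using *[of m c' c] two_expansions[OF b that(2,1) eq' lt] by metis
    qed
  qed
  obtain c where "real_digit_expansion b x c" using expansion_exists[OF assms] by blast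
  note c = this
  show ?thesis
  proof (rule ex_ex1I)
    show "\<exists>c. real_digit_expansion b x c \<and>
       ((\<exists>c'. real_digit_expansion b x c' \<and> c' \<noteq> c) \<longrightarrow> (\<lambda>k. real (c k)) \<longlonglongrightarrow> 0)"
    proof (cases "\<exists>c'. real_digit_expansion b x c' \<and> c' \<noteq> c")
      case True
      then obtain c' where "real_digit_expansion b x c'" "c \<noteq> c'" by blast
      then show ?thesis using pair[OF c] c by blast
    qed (use c in blast)
  qed (use pair in blast)
qed

lemma nat_expansion_sum:
  assumes "finite {k. c k \<noteq> (0::nat)}" "c 0 = 0"  "\<forall>k>n. c k = 0"
  shows "(\<Sum>k | c k \<noteq> 0. c k * base_prod b (k - 1)) = (\<Sum>k=1..n. c k * base_prod b (k - 1))"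
  using assms by (intro sum.mono_neutral_left) (auto simp: Suc_le_eq not_less[symmetric] intro!: gr0I)

lemma nat_partial_less:
  assumes "\<forall>k\<ge>1. c k < b k"
  shows "(\<Sum>k=1..n. c k * base_prod b (k - 1)) < base_prod b n"
proof (induction n)
  case (Suc n)
  have "Suc (c (Suc n)) * base_prod b n \<le> b (Suc n) * base_prod b n" using assms by (intro mult_le_mono1) (simp add: Suc_le_eq)
  then show ?case using Suc by (simp add: base_prod_Suc mult.commute)
qed (simp add: base_prod_def)

lemma nat_partial_inj:
  assumes "\<forall>k\<ge>1. c k < b k" "\<forall>k\<ge>1. c' k < b k"
   "(\<Sum>k=1..n. c k * base_prod b (k - 1)) = (\<Sum>k=1..n. c' k * base_prod b (k - 1))" "k \<in> {1..n}"
  shows "c k = c' k"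
  using assms(3,4)
proof (induction n)
  case (Suc n)
  let ?s = "\<lambda>c. (\<Sum>k=1..n. c k * base_prod b (k - 1))"
  have e: "c (Suc n) * base_prod b n + ?s c = c' (Suc n) * base_prod b n + ?s c'" using Suc.prems(1) by simp
  have l: "?s c < base_prod b n" "?s c' < base_prod b n" using nat_partial_less assms(1,2) by blast+
  have "c (Suc n) = c' (Suc n)"
    using arg_cong[OF e, of "\<lambda>z. z div base_prod b n"] l by simp
  then show ?case using Suc e by (cases "k = Suc n") auto
qed simp

lemma nat_partial_ex:
  assumes "\<forall>k\<ge>1. 2 \<le> b k" "N < base_prod b n"
  shows "\<exists>c. c 0 = 0 \<and> (\<forall>k\<ge>1. c k < b k) \<and> (\<forall>k>n. c k = 0) \<and> N = (\<Sum>k=1..n. c k * base_prod b (k - 1))"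
  using assms(2)
proof (induction n arbitrary: N)
  case 0
  have "\<forall>k\<ge>1. 0 < b k" using assms(1) by fastforce
  then show ?case using 0 by (intro exI[of _ "\<lambda>_. 0"]) (simp add: base_prod_def)
next
  case (Suc n)
  have p: "base_prod b n > 0" using Suc.prems by (auto simp: base_prod_Suc intro!: gr0I)
  obtain c where c: "c 0 = 0" "\<forall>k\<ge>1. c k < b k" "\<forall>k>n. c k = 0" "N mod base_prod b n = (\<Sum>k=1..n. c k * base_prod b (k - 1))"
    using Suc.IH[of "N mod base_prod b n"] p by auto
  have "N div base_prod b n < b (Suc n)" using Suc.prems p by (simp add: base_prod_Suc less_mult_imp_div_less mult.commute)
  moreover have "N = N mod base_prod b n + N div base_prod b n * base_prod b n"
    using div_mult_mod_eq[of N "base_prod b n"] by linarith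
  moreover have "(\<Sum>k=1..n. (c(Suc n := N div base_prod b n)) k * base_prod b (k - 1)) = (\<Sum>k=1..n. c k * base_prod b (k - 1))"
    by (intro sum.cong) auto
  ultimately have "N = (\<Sum>k=1..Suc n. (c(Suc n := N div base_prod b n)) k * base_prod b (k - 1))"
    using c(4) by simp
  with c(1-3) \<open>N div base_prod b n < b (Suc n)\<close> show ?case
    by (intro exI[of _ "c(Suc n := N div base_prod b n)"] conjI) auto
qed

lemma ex1_nat_digits:
  assumes b: "\<forall>k\<ge>1. 2 \<le> b k"
  shows "\<exists>!c. c 0 = 0 \<and> (\<forall>k\<ge>1. c k < b k) \<and> finite {k. c k \<noteq> 0} \<and>
     n = (\<Sum>k | c k \<noteq> 0. c k * base_prod b (k - 1))"
proof (rule ex_ex1I)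
  have "n < 2 ^ n" by simp
  then have "n < base_prod b n" using base_prod_ge[OF b, of n] by linarith
  then obtain c where c: "c 0 = 0" "\<forall>k\<ge>1. c k < b k" "\<forall>k>n. c k = 0" "n = (\<Sum>k=1..n. c k * base_prod b (k - 1))"
    using nat_partial_ex[OF b, of n n] by auto
  have fin: "finite {k. c k \<noteq> 0}" by (rule finite_subset[of _ "{..n}"]) (use c(3) in \<open>auto intro: leI\<close>)
  have "n = (\<Sum>k | c k \<noteq> 0. c k * base_prod b (k - 1))"
    by (rule trans[OF c(4) nat_expansion_sum[OF fin c(1,3), symmetric]])
  with c(1,2) fin show "\<exists>c. c 0 = 0 \<and> (\<forall>k\<ge>1. c k < b k) \<and> finite {k. c k \<noteq> 0} \<and>
     n = (\<Sum>k | c k \<noteq> 0. c k * base_prod b (k - 1))" by blast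
next
  fix c c' assume c: "c 0 = 0 \<and> (\<forall>k\<ge>1. c k < b k) \<and> finite {k. c k \<noteq> 0} \<and>
     n = (\<Sum>k | c k \<noteq> 0. c k * base_prod b (k - 1))"
   and c': "c' 0 = 0 \<and> (\<forall>k\<ge>1. c' k < b k) \<and> finite {k. c' k \<noteq> 0} \<and>
     n = (\<Sum>k | c' k \<noteq> 0. c' k * base_prod b (k - 1))"
  define N where "N = Max (insert 0 ({k. c k \<noteq> 0} \<union> {k. c' k \<noteq> 0}))"
  have fin: "finite (insert 0 ({k. c k \<noteq> 0} \<union> {k. c' k \<noteq> 0}))" using c c' by simp
  have z: "c k = 0 \<and> c' k = 0" if "k > N" for k
    using that Max_ge[OF fin, of k] unfolding N_def[symmetric] by (cases "c k = 0"; cases "c' k = 0") auto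
  have e: "(\<Sum>k=1..N. c k * base_prod b (k - 1)) = (\<Sum>k=1..N. c' k * base_prod b (k - 1))"
    using nat_expansion_sum[of c N b] nat_expansion_sum[of c' N b] c c' z by metis
  show "c = c'"
  proof
    fix k show "c k = c' k" using nat_partial_inj[OF _ _ e, of k] c c' z[of k] by (cases "k = 0"; cases "k > N") auto
  qed
qed

end

theory Submission
  imports Defs
begin

text \<open>
  It suffices to prove the inequality for finite families: the square functions of the tails of an
  infinite family tend to 0 by dominated convergence, so the partial sums are Cauchy in \<open>L\<^sup>p\<close>. For a
  finite family only finitely many digits matter. The cube is then replaced by a finite product \<open>X\<close>
  of digit sets with counting measure, where conditional expectations are averages \<open>avg\<close> over some of the coordinates
  and Vilenkin functions are the characters \<open>chi\<close>.

  \<^emph>\<open>Blocks.\<close> Suppose that every side of every rectangle is a block, that is, the set of all numbers with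
  prescribed digits beyond some place. A function \<open>f\<^sub>R\<close> with spectrum in such a rectangle \<open>R\<close> has a modulus
  that is constant on the cells of the grid of the dual shape, and multiplication by a function
  that is constant on these cells preserves its spectrum. Let \<open>F\<close> be the square function and
  \<open>\<Omega> = {F > l}\<close>. Discard from each \<open>f\<^sub>R\<close> the cells that are covered by \<open>\<Omega>\<close> for more than one half.
  The discarded cells lie in a set of size \<open>O(card \<Omega>)\<close> by the maximal inequality for rectangles. The
  rest is orthogonal, and since \<open>norm f\<^sub>R\<close> is constant on a cell that lies at least one half outside
  \<open>\<Omega>\<close>, its energy is at most twice the sum of \<open>F\<^sup>2\<close> over the complement of \<open>\<Omega>\<close>. Hence, up to
  constants, the size of \<open>{norm (\<Sum>f\<^sub>R) > l}\<close> is bounded by \<open>card {F > l}\<close> and the part of \<open>F\<^sup>2 / l\<^sup>2\<close> below the level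
  \<open>l\<close> (\<open>blocks_weak\<close>), and integration over \<open>l\<close> gives the power \<open>p < 2\<close> (\<open>sum_powr_le_of_weak\<close>).

  \<^emph>\<open>Reduction to blocks.\<close> One direction at a time, an interval \<open>{l..<u}\<close> is cut into its maximal blocks
  (\<open>refine_step\<close>). The parent of such a block contains \<open>l - 1\<close> or \<open>u\<close>; call it \<open>w\<close>. After division by the
  character of \<open>w\<close>, the block is a part of one martingale increment in this direction
  (\<open>sibling_le_increment\<close>). So the square function after the cut is dominated by conditional square
  functions of vector-valued martingales, which satisfy a bound of the same weak type as above:
  stop when the averages of the vector norm exceed the level (\<open>stopped_energy\<close>,
  \<open>weak_cond_square\<close>). Here \<open>p > 1\<close> enters, through Doob's maximal inequality, and boundedness of the
  bases enters through the comparison of consecutive averages.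

  The exponent \<open>p = 2\<close> is orthogonality of the characters.
\<close>

section \<open>Averaging over the coordinates of a finite product\<close>

locale finite_product =
  fixes S :: "'s set" and b :: "'s \<Rightarrow> nat"
  assumes fin_S: "finite S" and b_pos: "\<And>s. s \<in> S \<Longrightarrow> 0 < b s"
begin

definition X :: "('s \<Rightarrow> nat) set" where
  "X = (\<Pi>\<^sub>E s\<in>S. {..<b s})"

text \<open>\<open>avg A\<close> is the conditional expectation given the coordinates in \<open>A\<close>, and \<open>dep A\<close> is measurability
  with respect to them.\<close>

definition mix :: "'s set \<Rightarrow> ('s \<Rightarrow> nat) \<Rightarrow> ('s \<Rightarrow> nat) \<Rightarrow> 's \<Rightarrow> nat" where
  "mix A x y = (\<lambda>s. if s \<in> A then x s else y s)"

definition avg :: "'s set \<Rightarrow> (('s \<Rightarrow> nat) \<Rightarrow> 'v::real_normed_vector) \<Rightarrow> ('s \<Rightarrow> nat) \<Rightarrow> 'v" where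
  "avg A g x = (1 / real (card X)) *\<^sub>R (\<Sum>y\<in>X. g (mix A x y))"

definition dep :: "'s set \<Rightarrow> (('s \<Rightarrow> nat) \<Rightarrow> 'v) \<Rightarrow> bool" where
  "dep A h \<longleftrightarrow> (\<forall>x\<in>X. \<forall>y\<in>X. h (mix A x y) = h x)"

lemma finite_X [simp, intro]: "finite X"
  unfolding X_def using fin_S by (intro finite_PiE) auto

lemma X_ne [simp]: "X \<noteq> {}"
  unfolding X_def using b_pos by (auto simp: PiE_eq_empty_iff)

lemma card_X_pos [simp]: "0 < card X"
  using X_ne by (simp add: card_gt_0_iff)

lemma mix_in [simp, intro]: "x \<in> X \<Longrightarrow> y \<in> X \<Longrightarrow> mix A x y \<in> X"
  unfolding X_def mix_def PiE_def extensional_def by auto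

lemma upd_in: "x \<in> X \<Longrightarrow> s \<in> S \<Longrightarrow> c < b s \<Longrightarrow> x(s := c) \<in> X"
  unfolding X_def PiE_def extensional_def by auto

lemma in_X_less: "x \<in> X \<Longrightarrow> s \<in> S \<Longrightarrow> x s < b s"
  unfolding X_def by auto

lemma mix_all: "S \<subseteq> A \<Longrightarrow> x \<in> X \<Longrightarrow> y \<in> X \<Longrightarrow> mix A x y = x"
  unfolding X_def mix_def PiE_def extensional_def by (auto simp: fun_eq_iff) (metis subsetD)

lemma mix_mix: "mix B (mix A x y) z = mix (A \<inter> B) x (mix B y z)"
  by (auto simp: mix_def)

text \<open>Exchanging coordinates between two points is an involution of \<open>X \<times> X\<close>, and the first component
  of the result is \<open>mix A x y\<close>.\<close>

lemma sum_mix: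
  fixes g :: "('s \<Rightarrow> nat) \<Rightarrow> 'v::real_normed_vector"
  shows "(\<Sum>x\<in>X. \<Sum>y\<in>X. g (mix A x y)) = real (card X) *\<^sub>R (\<Sum>x\<in>X. g x)"
proof -
  have "(\<Sum>x\<in>X. \<Sum>y\<in>X. g (mix A x y)) = (\<Sum>(x,y)\<in>X\<times>X. g (mix A x y))"
    by (simp add: sum.cartesian_product)
  also have "\<dots> = (\<Sum>(x,y)\<in>X\<times>X. g x)"
    by (rule sum.reindex_bij_witness[where i = "\<lambda>(x,y). (mix A x y, mix A y x)"
          and j = "\<lambda>(x,y). (mix A x y, mix A y x)"])
       (auto simp: mix_def fun_eq_iff split: if_splits intro: mix_in[unfolded mix_def])
  also have "\<dots> = (\<Sum>x\<in>X. \<Sum>y\<in>X. g x)"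
    by (simp add: sum.cartesian_product)
  also have "\<dots> = real (card X) *\<^sub>R (\<Sum>x\<in>X. g x)"
    by (simp add: sum_constant_scaleR scaleR_sum_right)
  finally show ?thesis .
qed

lemma sum_avg: "(\<Sum>x\<in>X. avg A g x) = (\<Sum>x\<in>X. g x)"
  by (simp add: avg_def scaleR_sum_right[symmetric] sum_mix)

lemma avg_avg: "avg A (avg B g) x = avg (A \<inter> B) g x"
proof -
  have "avg A (avg B g) x = (1 / real (card X)) *\<^sub>R (1 / real (card X)) *\<^sub>R
      (\<Sum>y\<in>X. \<Sum>z\<in>X. g (mix (A \<inter> B) x (mix B y z)))"
    unfolding avg_def mix_mix by (simp add: scaleR_sum_right)
  also have "\<dots> = avg (A \<inter> B) g x"
    unfolding sum_mix[of "\<lambda>w. g (mix (A \<inter> B) x w)"] avg_def by simp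
  finally show ?thesis .
qed

lemma avg_cong: "x \<in> X \<Longrightarrow> (\<And>y. y \<in> X \<Longrightarrow> g y = h y) \<Longrightarrow> avg A g x = avg A h x"
  unfolding avg_def by (intro arg_cong[where f = "scaleR _"] sum.cong) auto

lemma avg_const: "avg A (\<lambda>_. c) x = c"
  by (simp add: avg_def sum_constant_scaleR del: sum_constant)

lemma avg_add: "avg A (\<lambda>y. g y + h y) x = avg A g x + avg A h x"
  by (simp add: avg_def sum.distrib scaleR_add_right)

lemma avg_diff: "avg A (\<lambda>y. g y - h y) x = avg A g x - avg A h x"
  by (simp add: avg_def sum_subtractf scaleR_diff_right)

lemma avg_sum: "avg A (\<lambda>y. \<Sum>i\<in>I. g i y) x = (\<Sum>i\<in>I. avg A (g i) x)"
  unfolding avg_def scaleR_sum_right by (rule sum.swap)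

lemma avg_cmult: "avg A (\<lambda>y. c * g y) x = (c :: 'v::real_normed_algebra) * avg A g x"
  by (simp add: avg_def sum_distrib_left[symmetric])

lemma avg_mono:
  "x \<in> X \<Longrightarrow> (\<And>y. y \<in> X \<Longrightarrow> g y \<le> h y) \<Longrightarrow> avg A g x \<le> (avg A h x :: real)"
  unfolding avg_def by (auto intro!: mult_left_mono sum_mono divide_right_mono)

lemma avg_nonneg:
  "x \<in> X \<Longrightarrow> (\<And>y. y \<in> X \<Longrightarrow> 0 \<le> g y) \<Longrightarrow> 0 \<le> (avg A g x :: real)"
  using avg_mono[of x "\<lambda>_. 0" g A] by (simp add: avg_const)

lemma norm_avg: "norm (avg A g x) \<le> avg A (\<lambda>y. norm (g y)) x"
  unfolding avg_def by (auto intro!: divide_right_mono norm_sum)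

lemma avg_all: "S \<subseteq> A \<Longrightarrow> x \<in> X \<Longrightarrow> avg A g x = g x"
  unfolding avg_def by (simp add: mix_all sum_constant_scaleR del: sum_constant)

lemma avg_square: "(avg A g x)\<^sup>2 \<le> avg A (\<lambda>y. (g y :: real)\<^sup>2) x"
proof -
  have "(\<Sum>y\<in>X. g (mix A x y))\<^sup>2 \<le> (\<Sum>y\<in>X. (g (mix A x y))\<^sup>2) * real (card X)"
    by (rule sum_squared_le_sum_of_squares)
  then have "(\<Sum>y\<in>X. g (mix A x y))\<^sup>2 / (real (card X))\<^sup>2
      \<le> (\<Sum>y\<in>X. (g (mix A x y))\<^sup>2) * real (card X) / (real (card X))\<^sup>2"
    by (rule divide_right_mono) simp
  then show ?thesis by (simp add: avg_def power_divide power2_eq_square)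
qed

text \<open>Minkowski's inequality: the norm of an average of vectors is at most the average of the norms.\<close>

lemma L2_set_avg:
  assumes "finite I"
  shows "L2_set (\<lambda>i. norm (avg A (h i) x)) I \<le> avg A (\<lambda>y. L2_set (\<lambda>i. norm (h i y)) I) x"
proof -
  have tri: "L2_set (\<lambda>i. norm (\<Sum>y\<in>Y. h i (mix A x y))) I \<le> (\<Sum>y\<in>Y. L2_set (\<lambda>i. norm (h i (mix A x y))) I)"
    if "finite Y" for Y
    using that
  proof induction
    case (insert y Y)
    have "L2_set (\<lambda>i. norm (\<Sum>y\<in>insert y Y. h i (mix A x y))) I
        \<le> L2_set (\<lambda>i. norm (h i (mix A x y)) + norm (\<Sum>y\<in>Y. h i (mix A x y))) I"
      using insert.hyps by (intro L2_set_mono) (auto intro: norm_triangle_ineq)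
    also have "\<dots> \<le> L2_set (\<lambda>i. norm (h i (mix A x y))) I + L2_set (\<lambda>i. norm (\<Sum>y\<in>Y. h i (mix A x y))) I"
      by (rule L2_set_triangle_ineq)
    finally show ?case using insert by simp
  qed (simp add: L2_set_def)
  have "L2_set (\<lambda>i. norm (avg A (h i) x)) I = (1 / card X) * L2_set (\<lambda>i. norm (\<Sum>y\<in>X. h i (mix A x y))) I"
    unfolding avg_def by (simp add: L2_set_right_distrib divide_inverse mult.commute)
  also have "\<dots> \<le> avg A (\<lambda>y. L2_set (\<lambda>i. norm (h i y)) I) x"
    unfolding avg_def using tri[of X] by (auto intro: divide_right_mono)
  finally show ?thesis .
qed

lemma depD: "dep A h \<Longrightarrow> x \<in> X \<Longrightarrow> y \<in> X \<Longrightarrow> h (mix A x y) = h x"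
  by (simp add: dep_def)

lemma dep_avg: "dep A (avg A g)"
  unfolding dep_def avg_def by (auto simp: mix_mix) (simp add: mix_def cong: if_cong)

lemma dep_mono: "dep A h \<Longrightarrow> A \<subseteq> B \<Longrightarrow> dep B h"
  unfolding dep_def
proof (intro ballI)
  fix x y assume *: "\<forall>x\<in>X. \<forall>y\<in>X. h (mix A x y) = h x" "A \<subseteq> B" "x \<in> X" "y \<in> X"
  have "mix A (mix B x y) x = x" using *(2) by (auto simp: mix_def fun_eq_iff)
  then show "h (mix B x y) = h x" using * by (metis mix_in)
qed

lemma avg_dep_mult:
  fixes h :: "_ \<Rightarrow> 'v::real_normed_algebra"
  assumes "dep A h" "x \<in> X"
  shows "avg A (\<lambda>y. h y * g y) x = h x * avg A g x"
proof -
  have "(\<Sum>y\<in>X. h (mix A x y) * g (mix A x y)) = (\<Sum>y\<in>X. h x * g (mix A x y))"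
    using assms by (intro sum.cong) (auto simp: depD)
  then show ?thesis by (simp add: avg_def sum_distrib_left[symmetric])
qed

lemma avg_dep:
  assumes "dep A h" "x \<in> X"
  shows "avg A h x = h x"
proof -
  have "(\<Sum>y\<in>X. h (mix A x y)) = (\<Sum>y\<in>X. h x)"
    using assms by (intro sum.cong) (auto simp: depD)
  then show ?thesis by (simp add: avg_def sum_constant_scaleR del: sum_constant)
qed

lemma sum_dep_avg:
  fixes h :: "_ \<Rightarrow> 'v::real_normed_algebra"
  assumes "dep A h"
  shows "(\<Sum>x\<in>X. h x * avg A g x) = (\<Sum>x\<in>X. h x * g x)"
proof -
  have "(\<Sum>x\<in>X. h x * avg A g x) = (\<Sum>x\<in>X. avg A (\<lambda>y. h y * g y) x)"
    using avg_dep_mult[OF assms] by (intro sum.cong) auto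
  then show ?thesis by (simp add: sum_avg)
qed

text \<open>Releasing one coordinate with \<open>b s\<close> values can shrink an average of a nonnegative function by
  at most the factor \<open>b s\<close>.\<close>

lemma avg_insert_le:
  assumes s: "s \<in> S" and x: "x \<in> X" and g: "\<And>y. y \<in> X \<Longrightarrow> 0 \<le> g y"
  shows "avg (insert s A) g x \<le> real (b s) * avg A g x"
proof -
  let ?\<phi> = "\<lambda>y. y(s := x s)"
  have \<phi>X: "?\<phi> y \<in> X" if "y \<in> X" for y using upd_in[OF that s] in_X_less[OF x s] by simp
  have eq: "mix (insert s A) x y = mix A x (?\<phi> y)" for y by (auto simp: mix_def)
  have fib: "card {y\<in>X. ?\<phi> y = z} \<le> b s" for z
  proof -
    have "inj_on (\<lambda>y. y s) {y\<in>X. ?\<phi> y = z}"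
      by (rule inj_onI) (auto simp: fun_eq_iff split: if_splits, metis)
    moreover have "(\<lambda>y. y s) ` {y\<in>X. ?\<phi> y = z} \<subseteq> {..<b s}" using in_X_less s by auto
    ultimately show ?thesis using card_inj_on_le[of _ _ "{..<b s}"] by simp
  qed
  have "(\<Sum>y\<in>X. g (mix (insert s A) x y)) = (\<Sum>z\<in>?\<phi> ` X. \<Sum>y | y \<in> X \<and> ?\<phi> y = z. g (mix A x (?\<phi> y)))"
    unfolding eq by (rule sum.image_gen) simp
  also have "\<dots> = (\<Sum>z\<in>?\<phi> ` X. real (card {y\<in>X. ?\<phi> y = z}) * g (mix A x z))"
    by (intro sum.cong) auto
  also have "\<dots> \<le> (\<Sum>z\<in>?\<phi> ` X. real (b s) * g (mix A x z))"
    using fib \<phi>X x by (intro sum_mono mult_right_mono g) auto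
  also have "\<dots> \<le> (\<Sum>z\<in>X. real (b s) * g (mix A x z))"
    using \<phi>X x g by (intro sum_mono2) auto
  also have "\<dots> = real (b s) * (\<Sum>z\<in>X. g (mix A x z))" by (simp add: sum_distrib_left)
  finally show ?thesis
    unfolding avg_def by (simp add: divide_right_mono)
qed

end

section \<open>Martingale inequalities for coordinate filtrations\<close>

locale coordinate_filtration = finite_product S b for S :: "'s set" and b :: "'s \<Rightarrow> nat" +
  fixes A :: "nat \<Rightarrow> 's set" and N B :: nat
  assumes mono_A: "\<And>i j. i \<le> j \<Longrightarrow> A i \<subseteq> A j"
    and top_A: "S \<subseteq> A N"
    and step_A: "\<And>m. m < N \<Longrightarrow> \<exists>s\<in>S. A (Suc m) = insert s (A m) \<and> b s \<le> B"
begin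

text \<open>The indicator of not having been stopped before time \<open>m\<close>, for the stopping rule that \<open>avg (A j) g\<close>
  exceeds \<open>l\<close>.\<close>

definition below :: "(('s \<Rightarrow> nat) \<Rightarrow> real) \<Rightarrow> real \<Rightarrow> nat \<Rightarrow> ('s \<Rightarrow> nat) \<Rightarrow> real" where
  "below g l m x = of_bool (\<forall>j<m. avg (A j) g x \<le> l)"

lemma below_01: "0 \<le> below g l m x" "below g l m x \<le> 1"
  by (auto simp: below_def)

lemma below_antimono: "m \<le> n \<Longrightarrow> below g l n x \<le> below g l m x"
  by (auto simp: below_def)

lemma dep_below: "m \<le> Suc n \<Longrightarrow> dep (A n) (below g l m)"
  unfolding dep_def below_def
proof (intro ballI arg_cong[where f = of_bool] all_cong)
  fix x y j assume *: "m \<le> Suc n" "x \<in> X" "y \<in> X" "j < m"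
  have "dep (A n) (avg (A j) g)" using mono_A[of j n] * by (intro dep_mono[OF dep_avg]) auto
  then show "(avg (A j) g (mix (A n) x y) \<le> l) = (avg (A j) g x \<le> l)" using * by (simp add: depD)
qed

lemma sum_not_below:
  "(\<Sum>x\<in>X. 1 - below g l (Suc N) x) = real (card {x\<in>X. \<exists>m\<le>N. l < avg (A m) g x})"
proof -
  have "(\<Sum>x\<in>X. 1 - below g l (Suc N) x) = (\<Sum>x\<in>X. of_bool (\<exists>m\<le>N. l < avg (A m) g x))"
  proof (intro sum.cong refl)
    fix x
    have "(\<forall>j<Suc N. avg (A j) g x \<le> l) \<longleftrightarrow> \<not> (\<exists>m\<le>N. l < avg (A m) g x)"
      by (auto simp: less_Suc_eq_le not_le[symmetric])
    then show "1 - below g l (Suc N) x = of_bool (\<exists>m\<le>N. l < avg (A m) g x)"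
      unfolding below_def by simp
  qed
  also have "\<dots> = (\<Sum>x\<in>{x\<in>X. \<exists>m\<le>N. l < avg (A m) g x}. 1)"
    by (intro sum.mono_neutral_cong_right) auto
  finally show ?thesis by simp
qed

text \<open>The decrements of \<open>below\<close> are the indicators of stopping at time \<open>m\<close>; they depend on \<open>A m\<close> only, so
  there \<open>avg (A m) g\<close> may be replaced by \<open>g\<close>, and they telescope.\<close>

lemma weak_maximal:
  assumes g: "\<And>x. x \<in> X \<Longrightarrow> 0 \<le> g x"
  shows "l * real (card {x\<in>X. \<exists>m\<le>N. l < avg (A m) g x}) \<le> (\<Sum>x\<in>X. g x)"
proof -
  define e where "e m x = below g l m x - below g l (Suc m) x" for m x
  have e0: "0 \<le> e m x" for m x using below_antimono[of m "Suc m"] by (simp add: e_def)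
  have dep_e: "dep (A m) (e m)" for m
    using dep_below[of m m g l] dep_below[of "Suc m" m g l] by (simp add: dep_def e_def)
  have tel: "(\<Sum>m\<le>N. e m x) = 1 - below g l (Suc N) x" for x
    unfolding e_def lessThan_Suc_atMost[symmetric] sum_lessThan_telescope'[of "\<lambda>m. below g l m x"]
    by (simp add: below_def)
  have "l * real (card {x\<in>X. \<exists>m\<le>N. l < avg (A m) g x}) = (\<Sum>m\<le>N. \<Sum>x\<in>X. l * e m x)"
    unfolding sum_not_below[symmetric] tel[symmetric] by (simp add: sum_distrib_left sum.swap[of _ X])
  also have "\<dots> \<le> (\<Sum>m\<le>N. \<Sum>x\<in>X. e m x * avg (A m) g x)"
    by (intro sum_mono) (auto simp: e_def below_def less_Suc_eq)
  also have "\<dots> = (\<Sum>m\<le>N. \<Sum>x\<in>X. e m x * g x)"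
    using dep_e by (simp add: sum_dep_avg)
  also have "\<dots> = (\<Sum>x\<in>X. (1 - below g l (Suc N) x) * g x)"
    unfolding tel[symmetric] by (simp add: sum_distrib_right sum.swap[of _ X])
  also have "\<dots> \<le> (\<Sum>x\<in>X. g x)"
    using g below_01 by (intro sum_mono mult_left_le_one_le) auto
  finally show ?thesis .
qed

text \<open>Only the part of \<open>g\<close> above half the level matters, because the rest cannot lift an average
  beyond that half.\<close>

lemma weak_maximal_truncated:
  assumes g: "\<And>x. x \<in> X \<Longrightarrow> 0 \<le> g x" and l: "0 < l"
  shows "real (card {x\<in>X. \<exists>m\<le>N. l < avg (A m) g x}) \<le> 2 * (\<Sum>x\<in>X. g x / l * of_bool (l / 2 < g x))"
proof -
  let ?h = "\<lambda>x. g x * of_bool (l / 2 < g x)"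
  have *: "avg (A m) g x \<le> avg (A m) ?h x + l / 2" if "x \<in> X" for x m
  proof -
    have "avg (A m) g x \<le> avg (A m) (\<lambda>x. ?h x + l / 2) x"
      using that l g by (intro avg_mono) auto
    then show ?thesis by (simp add: avg_add avg_const)
  qed
  have "card {x\<in>X. \<exists>m\<le>N. l < avg (A m) g x} \<le> card {x\<in>X. \<exists>m\<le>N. l / 2 < avg (A m) ?h x}"
  proof (rule card_mono)
    show "{x\<in>X. \<exists>m\<le>N. l < avg (A m) g x} \<subseteq> {x\<in>X. \<exists>m\<le>N. l / 2 < avg (A m) ?h x}"
    proof safe
      fix x m assume x: "x \<in> X" "m \<le> N" "l < avg (A m) g x"
      with *[of x m] show "\<exists>m\<le>N. l / 2 < avg (A m) ?h x" by (intro exI[of _ m]) auto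
    qed
  qed simp
  then have "l / 2 * real (card {x\<in>X. \<exists>m\<le>N. l < avg (A m) g x})
      \<le> l / 2 * real (card {x\<in>X. \<exists>m\<le>N. l / 2 < avg (A m) ?h x})"
    using l by (intro mult_left_mono) auto
  also have "\<dots> \<le> (\<Sum>x\<in>X. ?h x)"
    using g by (intro weak_maximal) auto
  finally have "real (card {x\<in>X. \<exists>m\<le>N. l < avg (A m) g x}) \<le> 2 / l * (\<Sum>x\<in>X. ?h x)"
    using l by (simp add: field_simps del: sum_mult_of_bool_eq)
  also have "\<dots> = 2 * (\<Sum>x\<in>X. g x / l * of_bool (l / 2 < g x))"
    unfolding sum_distrib_left by (intro sum.cong) auto
  finally show ?thesis .
qed

lemma sum_dep_variance:
  fixes k :: "_ \<Rightarrow> complex"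
  assumes u: "dep A' (u :: _ \<Rightarrow> real)"
  shows "(\<Sum>x\<in>X. u x * (norm (k x - avg A' k x))\<^sup>2)
    = (\<Sum>x\<in>X. u x * ((norm (k x))\<^sup>2 - (norm (avg A' k x))\<^sup>2))"
proof -
  let ?a = "avg A' k"
  let ?v = "\<lambda>x. complex_of_real (u x) * cnj (?a x)"
  have "dep A' ?v" using u dep_avg[of A' k] by (simp add: dep_def)
  then have "(\<Sum>x\<in>X. ?v x * ?a x) = (\<Sum>x\<in>X. ?v x * k x)" by (rule sum_dep_avg)
  then have "Re (\<Sum>x\<in>X. ?v x * ?a x) = Re (\<Sum>x\<in>X. ?v x * k x)" by simp
  then have eq: "(\<Sum>x\<in>X. u x * Re (cnj (?a x) * ?a x)) = (\<Sum>x\<in>X. u x * Re (cnj (?a x) * k x))"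
    by (simp add: mult.assoc)
  have "u x * (norm (k x - ?a x))\<^sup>2 = u x * ((norm (k x))\<^sup>2 - (norm (?a x))\<^sup>2)
      + 2 * (u x * Re (cnj (?a x) * ?a x)) - 2 * (u x * Re (cnj (?a x) * k x))" for x
    by (simp add: cmod_power2) (simp add: power2_eq_square algebra_simps)
  then show ?thesis using eq
    by (simp add: sum.distrib sum_subtractf sum_distrib_left[symmetric])
qed

definition cond_square :: "('i \<Rightarrow> ('s \<Rightarrow> nat) \<Rightarrow> complex) \<Rightarrow> 'i set \<Rightarrow> ('s \<Rightarrow> nat) \<Rightarrow> real" where
  "cond_square h I x = (\<Sum>i\<in>I. \<Sum>m<N.
     avg (A m) (\<lambda>y. (norm (avg (A (Suc m)) (h i) y - avg (A m) (h i) y))\<^sup>2) x)"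

text \<open>The square function is stopped when the averages of the vector norm \<open>g\<close> first exceed \<open>l\<close>.
  Up to then its energy telescopes, and one further step enlarges the averages by at most the factor \<open>B\<close>.\<close>

lemma stopped_energy:
  fixes h :: "'i \<Rightarrow> ('s \<Rightarrow> nat) \<Rightarrow> complex"
  assumes I: "finite I" and l: "0 \<le> l"
  defines "g \<equiv> \<lambda>x. L2_set (\<lambda>i. norm (h i x)) I"
  shows "(\<Sum>x\<in>X. \<Sum>i\<in>I. \<Sum>m<N. below g l (Suc m) x
       * avg (A m) (\<lambda>y. (norm (avg (A (Suc m)) (h i) y - avg (A m) (h i) y))\<^sup>2) x)
    \<le> (\<Sum>x\<in>X. (g x)\<^sup>2 * of_bool (g x \<le> l) + (real B * l)\<^sup>2 * (1 - below g l (Suc N) x))"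
proof -
  define V where "V m x = (\<Sum>i\<in>I. (norm (avg (A m) (h i) x))\<^sup>2)" for m x
  let ?G = "\<lambda>m. below g l (Suc m)"
  have g0: "0 \<le> g x" for x by (simp add: g_def L2_set_nonneg)
  have V: "V m x \<le> (avg (A m) g x)\<^sup>2" for m x
  proof -
    have "V m x = (L2_set (\<lambda>i. norm (avg (A m) (h i) x)) I)\<^sup>2"
      by (simp add: V_def L2_set_def sum_nonneg)
    then show ?thesis using L2_set_avg[OF I, of "A m" h x]
      by (auto intro!: power_mono simp: g_def L2_set_nonneg)
  qed
  have orth: "(\<Sum>x\<in>X. ?G m x * avg (A m) (\<lambda>y. (norm (avg (A (Suc m)) (h i) y - avg (A m) (h i) y))\<^sup>2) x)
      = (\<Sum>x\<in>X. ?G m x * ((norm (avg (A (Suc m)) (h i) x))\<^sup>2 - (norm (avg (A m) (h i) x))\<^sup>2))" for i m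
  proof -
    have dG: "dep (A m) (?G m)" by (rule dep_below) simp
    have "avg (A m) (avg (A (Suc m)) (h i)) y = avg (A m) (h i) y" for y
      using mono_A[of m "Suc m"] by (simp add: avg_avg Int_absorb2)
    then show ?thesis
      using sum_dep_variance[OF dG, of "avg (A (Suc m)) (h i)"] by (simp add: sum_dep_avg[OF dG])
  qed
  have pt: "(\<Sum>m<N. ?G m x * (V (Suc m) x - V m x))
      \<le> (g x)\<^sup>2 * of_bool (g x \<le> l) + (real B * l)\<^sup>2 * (1 - ?G N x)" if x: "x \<in> X" for x
  proof -
    have top: "?G N x * V N x \<le> (g x)\<^sup>2 * of_bool (g x \<le> l)"
      using V[of N x] avg_all[OF top_A x, of g] by (auto simp: below_def less_Suc_eq)
    have jump: "(?G m x - ?G (Suc m) x) * V (Suc m) x \<le> (?G m x - ?G (Suc m) x) * (real B * l)\<^sup>2"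
      if m: "m < N" for m
    proof (cases "?G m x = 0")
      case True
      then show ?thesis using below_antimono[of "Suc m" "Suc (Suc m)" g l x] below_01[of g l "Suc (Suc m)" x] by simp
    next
      case False
      then have le: "avg (A m) g x \<le> l" by (auto simp: below_def split: if_splits)
      obtain s where s: "s \<in> S" "A (Suc m) = insert s (A m)" "b s \<le> B" using step_A[OF m] by blast
      have a0: "0 \<le> avg (A m) g x" using x g0 by (intro avg_nonneg) auto
      have "avg (A (Suc m)) g x \<le> real (b s) * avg (A m) g x"
        unfolding s(2) using s(1) x g0 by (intro avg_insert_le) auto
      also have "\<dots> \<le> real B * l" using s(3) le a0 by (intro mult_mono) auto
      finally have "(avg (A (Suc m)) g x)\<^sup>2 \<le> (real B * l)\<^sup>2"
        using x g0 by (intro power_mono avg_nonneg) auto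
      then have "V (Suc m) x \<le> (real B * l)\<^sup>2" using V[of "Suc m" x] by linarith
      then show ?thesis using below_antimono[of "Suc m" "Suc (Suc m)" g l x] by (intro mult_left_mono) auto
    qed
    have "(\<Sum>m<N. ?G m x * (V (Suc m) x - V m x))
        = (\<Sum>m<N. (?G (Suc m) x * V (Suc m) x - ?G m x * V m x) + (?G m x - ?G (Suc m) x) * V (Suc m) x)"
      by (intro sum.cong) (auto simp: algebra_simps)
    also have "\<dots> = ?G N x * V N x - ?G 0 x * V 0 x + (\<Sum>m<N. (?G m x - ?G (Suc m) x) * V (Suc m) x)"
      unfolding sum.distrib sum_lessThan_telescope[of "\<lambda>m. ?G m x * V m x"] ..
    also have "\<dots> \<le> ?G N x * V N x - ?G 0 x * V 0 x + (\<Sum>m<N. (?G m x - ?G (Suc m) x) * (real B * l)\<^sup>2)"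
      using jump by (intro add_left_mono sum_mono) auto
    also have "\<dots> = ?G N x * V N x - ?G 0 x * V 0 x + (?G 0 x - ?G N x) * (real B * l)\<^sup>2"
      unfolding sum_distrib_right[symmetric] sum_lessThan_telescope'[of "\<lambda>m. ?G m x"] ..
    also have "\<dots> \<le> (g x)\<^sup>2 * of_bool (g x \<le> l) + (1 - ?G N x) * (real B * l)\<^sup>2"
    proof (intro add_mono mult_right_mono)
      have "0 \<le> ?G 0 x * V 0 x" using below_01 by (intro mult_nonneg_nonneg) (auto simp: V_def sum_nonneg)
      then show "?G N x * V N x - ?G 0 x * V 0 x \<le> (g x)\<^sup>2 * of_bool (g x \<le> l)" using top by linarith
    qed (use below_01 in auto)
    finally show ?thesis by (simp add: mult.commute)
  qed
  have "(\<Sum>x\<in>X. \<Sum>i\<in>I. \<Sum>m<N. ?G m x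
       * avg (A m) (\<lambda>y. (norm (avg (A (Suc m)) (h i) y - avg (A m) (h i) y))\<^sup>2) x)
    = (\<Sum>i\<in>I. \<Sum>m<N. \<Sum>x\<in>X. ?G m x
       * avg (A m) (\<lambda>y. (norm (avg (A (Suc m)) (h i) y - avg (A m) (h i) y))\<^sup>2) x)"
    unfolding sum.swap[of _ _ X] ..
  also have "\<dots> = (\<Sum>i\<in>I. \<Sum>m<N. \<Sum>x\<in>X. ?G m x *
       ((norm (avg (A (Suc m)) (h i) x))\<^sup>2 - (norm (avg (A m) (h i) x))\<^sup>2))"
    unfolding orth ..
  also have "\<dots> = (\<Sum>x\<in>X. \<Sum>m<N. \<Sum>i\<in>I. ?G m x *
       ((norm (avg (A (Suc m)) (h i) x))\<^sup>2 - (norm (avg (A m) (h i) x))\<^sup>2))"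
    by (subst sum.swap[of _ "{..<N}" I]) (simp only: sum.swap[of _ X])
  also have "\<dots> = (\<Sum>x\<in>X. \<Sum>m<N. ?G m x * (V (Suc m) x - V m x))"
    by (simp add: V_def sum_subtractf sum_distrib_left right_diff_distrib)
  also have "\<dots> \<le> (\<Sum>x\<in>X. (g x)\<^sup>2 * of_bool (g x \<le> l) + (real B * l)\<^sup>2 * (1 - ?G N x))"
    using pt by (intro sum_mono) auto
  finally show ?thesis .
qed

end

text \<open>The common right-hand side of the weak-type estimates: \<open>g\<close> is measured in \<open>L\<^sup>1\<close>
  where it is large and in \<open>L\<^sup>2\<close> where it is small.\<close>

definition weak_bound :: "real \<Rightarrow> real \<Rightarrow> real" where
  "weak_bound l g = g / l * of_bool (l / 2 < g) + (g / l)\<^sup>2 * of_bool (g \<le> l)"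

context coordinate_filtration
begin

text \<open>Where the martingale is never stopped, the square function is the stopped one, whose energy is
  controlled by \<open>stopped_energy\<close>. The remaining set is small by the maximal inequality.\<close>

lemma weak_cond_square:
  fixes h :: "'i \<Rightarrow> ('s \<Rightarrow> nat) \<Rightarrow> complex"
  assumes I: "finite I" and l: "0 < l"
  shows "real (card {x\<in>X. l < sqrt (cond_square h I x)})
    \<le> 2 * (1 + (real B)\<^sup>2) * (\<Sum>x\<in>X. weak_bound l (L2_set (\<lambda>i. norm (h i x)) I))"
proof -
  define g where "g = (\<lambda>x. L2_set (\<lambda>i. norm (h i x)) I)"
  let ?G = "\<lambda>m. below g l (Suc m)"
  let ?a = "\<lambda>i m. avg (A m) (\<lambda>y. (norm (avg (A (Suc m)) (h i) y - avg (A m) (h i) y))\<^sup>2)"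
  have a0: "0 \<le> ?a i m x" if "x \<in> X" for i m x using that by (intro avg_nonneg) auto
  have g0: "0 \<le> g x" for x by (simp add: g_def L2_set_nonneg)
  have pt: "l\<^sup>2 * of_bool (l < sqrt (cond_square h I x))
      \<le> l\<^sup>2 * (1 - ?G N x) + (\<Sum>i\<in>I. \<Sum>m<N. ?G m x * ?a i m x)" if x: "x \<in> X" for x
  proof (cases "?G N x = 1")
    case True
    then have "?G m x = 1" if "m < N" for m
      using below_antimono[of "Suc m" "Suc N" g l x] below_01[of g l "Suc m" x] that by auto
    then have eq: "(\<Sum>i\<in>I. \<Sum>m<N. ?G m x * ?a i m x) = cond_square h I x"
      unfolding cond_square_def by (intro sum.cong) auto
    have "l\<^sup>2 \<le> cond_square h I x" if "l < sqrt (cond_square h I x)"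
      using that l by (metis less_eq_real_def real_less_rsqrt real_sqrt_less_iff real_sqrt_unique not_le)
    then show ?thesis using True eq sum_nonneg[of I] a0[OF x]
      by (auto simp: cond_square_def intro!: sum_nonneg)
  next
    case False
    then have "?G N x = 0" by (auto simp: below_def split: if_splits)
    moreover have "0 \<le> (\<Sum>i\<in>I. \<Sum>m<N. ?G m x * ?a i m x)"
      using a0[OF x] below_01 by (intro sum_nonneg mult_nonneg_nonneg) auto
    ultimately show ?thesis by simp
  qed
  have "l\<^sup>2 * real (card {x\<in>X. l < sqrt (cond_square h I x)})
      = (\<Sum>x\<in>X. l\<^sup>2 * of_bool (l < sqrt (cond_square h I x)))"
    by (simp add: sum_distrib_left[symmetric] Int_def)
  also have "\<dots> \<le> (\<Sum>x\<in>X. l\<^sup>2 * (1 - ?G N x) + (\<Sum>i\<in>I. \<Sum>m<N. ?G m x * ?a i m x))"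
    using pt by (intro sum_mono) auto
  also have "\<dots> = l\<^sup>2 * (\<Sum>x\<in>X. 1 - ?G N x) + (\<Sum>x\<in>X. \<Sum>i\<in>I. \<Sum>m<N. ?G m x * ?a i m x)"
    by (simp add: sum.distrib sum_distrib_left)
  also have "\<dots> \<le> l\<^sup>2 * (\<Sum>x\<in>X. 1 - ?G N x)
      + (\<Sum>x\<in>X. (g x)\<^sup>2 * of_bool (g x \<le> l) + (real B * l)\<^sup>2 * (1 - ?G N x))"
    using stopped_energy[OF I, of l h] l unfolding g_def by (intro add_left_mono) auto
  also have "\<dots> = l\<^sup>2 * ((1 + (real B)\<^sup>2) * (\<Sum>x\<in>X. 1 - ?G N x) + (\<Sum>x\<in>X. (g x / l)\<^sup>2 * of_bool (g x \<le> l)))"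
  proof -
    have "(\<Sum>x\<in>X. (g x)\<^sup>2 * of_bool (g x \<le> l)) = l\<^sup>2 * (\<Sum>x\<in>X. (g x / l)\<^sup>2 * of_bool (g x \<le> l))"
      unfolding sum_distrib_left using l by (intro sum.cong) (auto simp: power_divide)
    then show ?thesis
      unfolding sum.distrib sum_distrib_left[symmetric] by (simp only: power_mult_distrib distrib_left distrib_right mult_1 ac_simps)
  qed
  finally have "real (card {x\<in>X. l < sqrt (cond_square h I x)})
      \<le> (1 + (real B)\<^sup>2) * (\<Sum>x\<in>X. 1 - ?G N x) + (\<Sum>x\<in>X. (g x / l)\<^sup>2 * of_bool (g x \<le> l))"
    using l by (simp add: mult_le_cancel_left_pos)
  also have "\<dots> \<le> (1 + (real B)\<^sup>2) * (2 * (\<Sum>x\<in>X. g x / l * of_bool (l / 2 < g x)))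
      + 2 * (1 + (real B)\<^sup>2) * (\<Sum>x\<in>X. (g x / l)\<^sup>2 * of_bool (g x \<le> l))"
  proof (intro add_mono mult_left_mono)
    show "(\<Sum>x\<in>X. 1 - ?G N x) \<le> 2 * (\<Sum>x\<in>X. g x / l * of_bool (l / 2 < g x))"
      unfolding sum_not_below using g0 l by (intro weak_maximal_truncated) auto
    have "1 * (\<Sum>x\<in>X. (g x / l)\<^sup>2 * of_bool (g x \<le> l)) \<le> 2 * (1 + (real B)\<^sup>2) * (\<Sum>x\<in>X. (g x / l)\<^sup>2 * of_bool (g x \<le> l))"
      by (intro mult_right_mono sum_nonneg) auto
    then show "(\<Sum>x\<in>X. (g x / l)\<^sup>2 * of_bool (g x \<le> l)) \<le> 2 * (1 + (real B)\<^sup>2) * (\<Sum>x\<in>X. (g x / l)\<^sup>2 * of_bool (g x \<le> l))"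
      by simp
  qed simp
  also have "\<dots> = 2 * (1 + (real B)\<^sup>2) * (\<Sum>x\<in>X. weak_bound l (g x))"
    by (simp add: weak_bound_def sum.distrib algebra_simps)
  finally show ?thesis by (simp add: g_def)
qed

end

section \<open>From level sets to powers\<close>

text \<open>This is the integral of \<open>p * l powr (p - 1) * weak_bound l 1\<close> over \<open>l > 0\<close>.\<close>

definition layer_const :: "real \<Rightarrow> real" where
  "layer_const p = p * 2 powr (p - 1) / (p - 1) + p / (2 - p)"

lemma layer_const_pos: "1 < p \<Longrightarrow> p < 2 \<Longrightarrow> 0 < layer_const p"
  unfolding layer_const_def by (intro add_pos_pos divide_pos_pos mult_pos_pos) auto

lemma nn_integral_layer:
  assumes "0 \<le> s" "0 < p"
  shows "(\<integral>\<^sup>+l. ennreal (p * l powr (p - 1) * of_bool (0 < l \<and> l < s)) \<partial>lborel) = ennreal (s powr p)"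
proof -
  have "((\<lambda>l. p * l powr (p - 1)) has_integral p * (s powr p / p)) {0..s}"
    using has_integral_powr_from_0[of "p - 1" s] assms by (intro has_integral_mult_right) auto
  then have I: "((\<lambda>l. p * l powr (p - 1)) has_integral s powr p) {0..s}" using assms by simp
  have "(\<integral>\<^sup>+l. ennreal (p * l powr (p - 1) * of_bool (0 < l \<and> l < s)) \<partial>lborel)
      = (\<integral>\<^sup>+l. ennreal (indicator {0..s} l * (p * l powr (p - 1))) \<partial>lborel)"
    using AE_lborel_singleton[of 0] AE_lborel_singleton[of s] assms
    by (intro nn_integral_cong_AE) (auto elim!: eventually_elim2 simp: indicator_def)
  also have "\<dots> = ennreal (s powr p)"
    using assms by (intro nn_integral_has_integral_lebesgue[OF _ I]) auto
  finally show ?thesis .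
qed

text \<open>The term that is large at small levels is integrable near 0 because \<open>p > 1\<close>, and the other one is
  integrable at infinity because \<open>p < 2\<close>.\<close>

lemma nn_integral_weak_bound:
  assumes g: "0 \<le> g" and p: "1 < p" "p < 2"
  shows "(\<integral>\<^sup>+l. ennreal (p * l powr (p - 1) * weak_bound l g * of_bool (0 < l)) \<partial>lborel)
    = ennreal (layer_const p * g powr p)"
proof (cases "g = 0")
  case True
  then show ?thesis by (simp add: weak_bound_def)
next
  case False
  with g have g: "0 < g" by simp
  have e1: "p * l powr (p - 1) * (g / l) = p * g * l powr (p - 2)" if "0 < l" for l
    using that by (simp add: powr_diff power2_eq_square field_simps)
  have e2: "p * l powr (p - 1) * (g / l)\<^sup>2 = p * g\<^sup>2 * l powr (p - 3)" if "0 < l" for l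
    using that by (simp add: powr_diff power2_eq_square power3_eq_cube field_simps)
  have J1: "((\<lambda>l. p * g * l powr (p - 2)) has_integral (p * g) * ((2 * g) powr (p - 1) / (p - 1))) {0..2 * g}"
    using has_integral_mult_right[OF has_integral_powr_from_0[of "p - 2" "2 * g"], of "p * g"] p g
    by (simp add: add.commute)
  have "g * g powr (p - 1) = g powr p" using powr_mult_base[of g "p - 1"] g by simp
  then have "(p * g) * ((2 * g) powr (p - 1) / (p - 1)) = p * 2 powr (p - 1) / (p - 1) * g powr p"
    using g by (simp add: powr_mult mult_ac)
  with J1 have I1: "((\<lambda>l. p * g * l powr (p - 2)) has_integral (p * 2 powr (p - 1) / (p - 1) * g powr p)) {0..2 * g}"
    by (simp only:)
  have "((\<lambda>l. p * g\<^sup>2 * l powr (p - 3)) has_integral (p * g\<^sup>2) * (- (g powr (p - 3 + 1)) / (p - 3 + 1))) {g..}"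
    using has_integral_powr_to_inf[of "p - 3" g] p g by (intro has_integral_mult_right) auto
  moreover have "(p * g\<^sup>2) * (- (g powr (p - 3 + 1)) / (p - 3 + 1)) = p / (2 - p) * g powr p"
    using p g by (simp add: powr_diff divide_simps) (simp add: algebra_simps)
  ultimately have I2: "((\<lambda>l. p * g\<^sup>2 * l powr (p - 3)) has_integral p / (2 - p) * g powr p) {g..}" by simp
  have "(\<integral>\<^sup>+l. ennreal (p * l powr (p - 1) * weak_bound l g * of_bool (0 < l)) \<partial>lborel)
      = (\<integral>\<^sup>+l. ennreal (indicator {0..2*g} l * (p * g * l powr (p - 2)))
          + ennreal (indicator {g..} l * (p * g\<^sup>2 * l powr (p - 3))) \<partial>lborel)"
  proof (rule nn_integral_cong_AE)
    have "AE l in lborel. l \<noteq> (0::real)" "AE l in lborel. l \<noteq> 2 * g" by (rule AE_lborel_singleton)+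
    then show "AE l in lborel. ennreal (p * l powr (p - 1) * weak_bound l g * of_bool (0 < l))
        = ennreal (indicator {0..2*g} l * (p * g * l powr (p - 2)))
          + ennreal (indicator {g..} l * (p * g\<^sup>2 * l powr (p - 3)))"
    proof eventually_elim
      case (elim l)
      have "p * l powr (p - 1) * weak_bound l g * of_bool (0 < l)
          = indicator {0..2*g} l * (p * g * l powr (p - 2)) + indicator {g..} l * (p * g\<^sup>2 * l powr (p - 3))"
      proof (cases "0 < l")
        case True
        then show ?thesis using elim e1[OF True] e2[OF True]
          by (auto simp: weak_bound_def algebra_simps indicator_def split: if_splits)
      next
        case False
        then show ?thesis using elim g by (auto simp: indicator_def)
      qed
      then show ?case using p g by (simp add: ennreal_plus[symmetric] del: ennreal_plus)
    qed
  qed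
  also have "\<dots> = (\<integral>\<^sup>+l. ennreal (indicator {0..2*g} l * (p * g * l powr (p - 2))) \<partial>lborel)
          + (\<integral>\<^sup>+l. ennreal (indicator {g..} l * (p * g\<^sup>2 * l powr (p - 3))) \<partial>lborel)"
    by (intro nn_integral_add) auto
  also have "(\<integral>\<^sup>+l. ennreal (indicator {0..2*g} l * (p * g * l powr (p - 2))) \<partial>lborel)
      = ennreal (p * 2 powr (p - 1) / (p - 1) * g powr p)"
    using p g by (intro nn_integral_has_integral_lebesgue[OF _ I1]) auto
  also have "(\<integral>\<^sup>+l. ennreal (indicator {g..} l * (p * g\<^sup>2 * l powr (p - 3))) \<partial>lborel)
      = ennreal (p / (2 - p) * g powr p)"
    using p g by (intro nn_integral_has_integral_lebesgue[OF _ I2]) auto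
  finally show ?thesis using p g
    by (simp add: layer_const_def ennreal_plus[symmetric] distrib_right del: ennreal_plus)
qed

text \<open>This is Marcinkiewicz interpolation between the weak type inequalities for \<open>L\<^sup>1\<close> and \<open>L\<^sup>2\<close>.\<close>

lemma sum_powr_le_of_weak:
  fixes s g :: "'a \<Rightarrow> real"
  assumes X: "finite X" and s: "\<And>x. x \<in> X \<Longrightarrow> 0 \<le> s x" and g: "\<And>x. x \<in> X \<Longrightarrow> 0 \<le> g x"
    and p: "1 < p" "p < 2" and K: "0 \<le> K"
    and weak: "\<And>l. 0 < l \<Longrightarrow> real (card {x\<in>X. l < s x}) \<le> K * (\<Sum>x\<in>X. weak_bound l (g x))"
  shows "(\<Sum>x\<in>X. s x powr p) \<le> K * layer_const p * (\<Sum>x\<in>X. g x powr p)"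
proof -
  have meas: "(\<lambda>l. weak_bound l c) \<in> borel_measurable borel" for c
    unfolding weak_bound_def of_bool_def by measurable
  have wb0: "0 \<le> weak_bound l c" if "0 < l" "0 \<le> c" for l c using that by (auto simp: weak_bound_def)
  have "ennreal (\<Sum>x\<in>X. s x powr p) = (\<Sum>x\<in>X. ennreal (s x powr p))"
    by simp
  also have "\<dots> = (\<Sum>x\<in>X. \<integral>\<^sup>+l. ennreal (p * l powr (p - 1) * of_bool (0 < l \<and> l < s x)) \<partial>lborel)"
    using s p by (intro sum.cong) (auto simp: nn_integral_layer)
  also have "\<dots> = (\<integral>\<^sup>+l. (\<Sum>x\<in>X. ennreal (p * l powr (p - 1) * of_bool (0 < l \<and> l < s x))) \<partial>lborel)"
    by (rule nn_integral_sum[symmetric]) (auto simp: of_bool_def)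
  also have "\<dots> \<le> (\<integral>\<^sup>+l. ennreal K * (\<Sum>x\<in>X. ennreal (p * l powr (p - 1) * weak_bound l (g x) * of_bool (0 < l))) \<partial>lborel)"
  proof (rule nn_integral_mono)
    fix l :: real
    show "(\<Sum>x\<in>X. ennreal (p * l powr (p - 1) * of_bool (0 < l \<and> l < s x)))
      \<le> ennreal K * (\<Sum>x\<in>X. ennreal (p * l powr (p - 1) * weak_bound l (g x) * of_bool (0 < l)))"
    proof (cases "0 < l")
      case True
      have "(\<Sum>x\<in>X. p * l powr (p - 1) * of_bool (0 < l \<and> l < s x)) = p * l powr (p - 1) * real (card {x\<in>X. l < s x})"
        using True X by (simp add: sum_distrib_left[symmetric] Int_def)
      also have "\<dots> \<le> p * l powr (p - 1) * (K * (\<Sum>x\<in>X. weak_bound l (g x)))"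
        using weak[OF True] p by (intro mult_left_mono) auto
      also have "\<dots> = K * (\<Sum>x\<in>X. p * l powr (p - 1) * weak_bound l (g x) * of_bool (0 < l))"
        using True by (simp add: sum_distrib_left algebra_simps)
      finally have "ennreal (\<Sum>x\<in>X. p * l powr (p - 1) * of_bool (0 < l \<and> l < s x))
        \<le> ennreal (K * (\<Sum>x\<in>X. p * l powr (p - 1) * weak_bound l (g x) * of_bool (0 < l)))"
        by (rule ennreal_leI)
      moreover have "(\<Sum>x\<in>X. ennreal (p * l powr (p - 1) * of_bool (0 < l \<and> l < s x)))
          = ennreal (\<Sum>x\<in>X. p * l powr (p - 1) * of_bool (0 < l \<and> l < s x))"
        using p by (intro sum_ennreal) auto
      moreover have "(\<Sum>x\<in>X. ennreal (p * l powr (p - 1) * weak_bound l (g x) * of_bool (0 < l)))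
          = ennreal (\<Sum>x\<in>X. p * l powr (p - 1) * weak_bound l (g x) * of_bool (0 < l))"
        using p wb0[OF True] g by (intro sum_ennreal) auto
      ultimately show ?thesis
        using K p wb0[OF True] g by (simp only:) (subst ennreal_mult[symmetric], auto intro!: sum_nonneg)
    qed simp
  qed
  also have "\<dots> = ennreal K * (\<Sum>x\<in>X. \<integral>\<^sup>+l. ennreal (p * l powr (p - 1) * weak_bound l (g x) * of_bool (0 < l)) \<partial>lborel)"
    using meas by (subst nn_integral_cmult, (measurable; simp add: of_bool_def), subst nn_integral_sum) (auto simp: of_bool_def)
  also have "\<dots> = ennreal K * (\<Sum>x\<in>X. ennreal (layer_const p * g x powr p))"
    using g p by (intro arg_cong[where f = "(*) _"] sum.cong) (auto simp: nn_integral_weak_bound)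
  also have "\<dots> = ennreal (K * layer_const p * (\<Sum>x\<in>X. g x powr p))"
    using K layer_const_pos[OF p] by (simp add: ennreal_mult[symmetric] sum_nonneg sum_distrib_left mult.assoc)
  finally show ?thesis
    using K layer_const_pos[OF p] by (subst (asm) ennreal_le_iff) (auto intro!: mult_nonneg_nonneg sum_nonneg)
qed

section \<open>Vilenkin characters on a grid\<close>

context finite_product
begin

definition rot :: "'s \<Rightarrow> ('s \<Rightarrow> nat) \<Rightarrow> 's \<Rightarrow> nat" where
  "rot s x = x(s := (x s + 1) mod b s)"

lemma rot_in: "x \<in> X \<Longrightarrow> s \<in> S \<Longrightarrow> rot s x \<in> X"
  unfolding rot_def using b_pos by (intro upd_in) auto

lemma rot_image:
  assumes s: "s \<in> S"
  shows "inj_on (rot s) X" "rot s ` X = X"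
proof -
  show inj: "inj_on (rot s) X"
  proof (rule inj_onI, rule ext)
    fix x y t assume *: "x \<in> X" "y \<in> X" "rot s x = rot s y"
    have "(x s + 1) mod b s = (y s + 1) mod b s" using fun_cong[OF *(3), of s] by (simp add: rot_def)
    moreover have "x s < b s" "y s < b s" using * in_X_less s by auto
    ultimately have "x s = y s" by (auto simp: mod_Suc split: if_splits)
    then show "x t = y t" using fun_cong[OF *(3), of t] by (cases "t = s") (auto simp: rot_def)
  qed
  show "rot s ` X = X" using rot_in[OF _ s] by (intro endo_inj_surj[OF finite_X _ inj]) auto
qed

lemma dep_rot: "dep A h \<Longrightarrow> s \<notin> A \<Longrightarrow> s \<in> S \<Longrightarrow> x \<in> X \<Longrightarrow> h (rot s x) = h x"
proof -
  assume *: "dep A h" "s \<notin> A" "s \<in> S" "x \<in> X"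
  have "mix A x (rot s x) = rot s x" using *(2) by (auto simp: mix_def rot_def fun_eq_iff)
  then show ?thesis using depD[OF *(1,4) rot_in[OF *(4,3)]] by simp
qed

text \<open>Rotating a released coordinate does not change an average, so an average of an
  eigenfunction of that rotation vanishes unless the eigenvalue is 1.\<close>

lemma avg_eigenfunction:
  fixes w :: "_ \<Rightarrow> complex"
  assumes s: "s \<in> S" "s \<notin> A" and w: "\<And>y. y \<in> X \<Longrightarrow> w (rot s y) = \<omega> * w y" and \<omega>: "\<omega> \<noteq> 1" and x: "x \<in> X"
  shows "avg A w x = 0"
proof -
  have mr: "mix A x (rot s y) = rot s (mix A x y)" for y using s(2) by (auto simp: mix_def rot_def fun_eq_iff)
  have "(\<Sum>y\<in>X. w (mix A x y)) = (\<Sum>y\<in>rot s ` X. w (mix A x y))" using rot_image[OF s(1)] by simp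
  also have "\<dots> = (\<Sum>y\<in>X. w (mix A x (rot s y)))"
    by (subst sum.reindex[OF rot_image(1)[OF s(1)]]) (simp only: o_def)
  also have "\<dots> = \<omega> * (\<Sum>y\<in>X. w (mix A x y))"
    unfolding mr sum_distrib_left using x by (intro sum.cong) (auto simp: w)
  finally have "(1 - \<omega>) * (\<Sum>y\<in>X. w (mix A x y)) = 0" by (simp add: algebra_simps)
  then show ?thesis using \<omega> by (simp add: avg_def)
qed

lemma sum_eigenfunction:
  fixes w :: "_ \<Rightarrow> complex"
  assumes s: "s \<in> S" and w: "\<And>y. y \<in> X \<Longrightarrow> w (rot s y) = \<omega> * w y" and \<omega>: "\<omega> \<noteq> 1"
  shows "(\<Sum>y\<in>X. w y) = 0"
proof -
  obtain x where "x \<in> X" using X_ne by blast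
  with avg_eigenfunction[OF s, of "{}" w \<omega> x] w \<omega> show ?thesis by (simp add: avg_def mix_def)
qed

lemma dep_mult: "dep A f \<Longrightarrow> dep A g \<Longrightarrow> dep A (\<lambda>x. f x * g x)"
  by (simp add: dep_def)

lemma dep_prod: "(\<And>i. i \<in> I \<Longrightarrow> dep A (f i)) \<Longrightarrow> dep A (\<lambda>x. \<Prod>i\<in>I. f i x)"
  by (simp add: dep_def)

lemma dep_sum: "(\<And>i. i \<in> I \<Longrightarrow> dep A (f i)) \<Longrightarrow> dep A (\<lambda>x. \<Sum>i\<in>I. f i x)"
  by (simp add: dep_def)

lemma dep_comp: "dep A f \<Longrightarrow> dep A (\<lambda>x. k (f x))"
  by (simp add: dep_def)

end

text \<open>Adding 1 to a digit modulo \<open>b\<close> multiplies a character of the cyclic group by its value at 1.\<close>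

lemma cis_mod:
  assumes "x < (b::nat)"
  shows "cis (2 * pi * real (n * ((x + 1) mod b)) / real b) = cis (2 * pi * real n / real b) * cis (2 * pi * real (n * x) / real b)"
proof (cases "x + 1 = b")
  case True
  then have "cis (2 * pi * real n / real b) * cis (2 * pi * real (n * x) / real b) = cis (2 * pi * (real n * (1 + real x)) / real b)"
    by (simp add: cis_mult add_divide_distrib algebra_simps)
  also have "real n * (1 + real x) = real n * real b" using True by simp
  also have "cis (2 * pi * (real n * real b) / real b) = 1"
    using assms cis_multiple_2pi[of "real n"] by (simp add: mult.assoc)
  finally show ?thesis using True by simp
next
  case False
  then have "(x + 1) mod b = x + 1" using assms by simp
  then show ?thesis by (simp add: cis_mult add_divide_distrib algebra_simps)
qed

lemma cis_frac_neq_1: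
  assumes "m < b" "n < b" "m \<noteq> (n::nat)"
  shows "cnj (cis (2 * pi * real m / real b)) * cis (2 * pi * real n / real b) \<noteq> 1"
proof
  let ?t = "2 * pi * real n / real b - 2 * pi * real m / real b"
  assume "cnj (cis (2 * pi * real m / real b)) * cis (2 * pi * real n / real b) = 1"
  then have "cis ?t = 1" by (simp add: cis_cnj cis_mult)
  then have "cos ?t = 1" by (simp add: complex_eq_iff)
  then obtain k :: int where k: "?t = real_of_int k * 2 * pi" using cos_one_2pi_int by blast
  have "?t = (real n - real m) / real b * 2 * pi" by (simp add: diff_divide_distrib algebra_simps)
  then have "(real n - real m) / real b * (2 * pi) = of_int k * (2 * pi)" using k by (simp only: mult.assoc)
  then have "(real n - real m) / real b = of_int k" by (subst (asm) mult_right_cancel) auto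
  then have e: "real n - real m = of_int k * real b" using assms by (simp add: field_simps)
  have "k = 0"
  proof (rule ccontr)
    assume "k \<noteq> 0"
    then have "1 \<le> \<bar>real_of_int k\<bar>" by linarith
    then have "1 * real b \<le> \<bar>real_of_int k\<bar> * real b" by (intro mult_right_mono) auto
    also have "\<dots> = \<bar>real n - real m\<bar>" using e by (simp add: abs_mult)
    finally show False using assms by linarith
  qed
  with e assms show False by simp
qed

locale vilenkin_grid =
  fixes D N :: nat and b :: "nat \<Rightarrow> nat \<Rightarrow> nat" and B :: nat
  assumes b_ge_2: "\<And>d k. d \<in> {1..D} \<Longrightarrow> 1 \<le> k \<Longrightarrow> 2 \<le> b d k"
    and b_le_B: "\<And>d k. d \<in> {1..D} \<Longrightarrow> 1 \<le> k \<Longrightarrow> b d k \<le> B"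
begin

definition coords :: "(nat \<times> nat) set" where
  "coords = {1..D} \<times> {1..N}"

lemma coordsI: "d \<in> {1..D} \<Longrightarrow> k \<in> {1..N} \<Longrightarrow> (d, k) \<in> coords"
  by (simp add: coords_def)

sublocale finite_product coords "\<lambda>s. b (fst s) (snd s)"
proof (rule finite_product.intro)
  show "finite coords" by (simp add: coords_def)
  fix s assume s: "s \<in> coords"
  have "fst s \<in> {1..D}" "1 \<le> snd s" using s unfolding coords_def mem_Times_iff by simp_all
  then have "2 \<le> b (fst s) (snd s)" by (rule b_ge_2)
  then show "0 < b (fst s) (snd s)" by simp
qed

abbreviation P :: "nat \<Rightarrow> nat \<Rightarrow> nat" where
  "P d m \<equiv> base_prod (b d) m"

text \<open>The coordinate \<open>(d, k)\<close> of a grid point stands for the \<open>k\<close>-th digit in direction \<open>d\<close>. Places are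
  counted from 1, as for the digits of numbers.\<close>

definition digit :: "nat \<Rightarrow> nat \<Rightarrow> nat \<Rightarrow> nat" where
  "digit d t k = t div P d (k - 1) mod b d k"

definition chr :: "nat \<Rightarrow> nat \<Rightarrow> (nat \<times> nat \<Rightarrow> nat) \<Rightarrow> complex" where
  "chr d t x = (\<Prod>k=1..N. cis (2 * pi * real (digit d t k * x (d, k)) / real (b d k)))"

definition chi :: "(nat \<Rightarrow> nat) \<Rightarrow> (nat \<times> nat \<Rightarrow> nat) \<Rightarrow> complex" where
  "chi n x = (\<Prod>d=1..D. chr d (n d) x)"

text \<open>The stages of the martingale in direction \<open>d\<close>: the other directions are completely known.\<close>

definition dir :: "nat \<Rightarrow> nat \<Rightarrow> (nat \<times> nat) set" where
  "dir d m = {(d', k). d' = d \<longrightarrow> k \<le> m}"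

definition box :: "(nat \<Rightarrow> nat) set" where
  "box = (\<Pi>\<^sub>E d\<in>{1..D}. {..<P d N})"

definition spec :: "((nat \<Rightarrow> nat) \<Rightarrow> complex) \<Rightarrow> (nat \<Rightarrow> nat) set \<Rightarrow> (nat \<times> nat \<Rightarrow> nat) \<Rightarrow> complex" where
  "spec c R x = (\<Sum>n\<in>R. c n * chi n x)"

lemma P_pos: "d \<in> {1..D} \<Longrightarrow> 0 < P d m"
  unfolding base_prod_def
proof (intro prod_pos)
  fix k assume "d \<in> {1..D}" "k \<in> {1..m}"
  then show "0 < b d k" using b_ge_2[of d k] by simp
qed

lemma P_0 [simp]: "P d 0 = 1"
  by (simp add: base_prod_def)

lemma div_P_Suc: "t div P d (Suc m) = t div P d m div b d (Suc m)"
  by (simp add: base_prod_Suc div_mult2_eq)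

lemma div_P_eq: "t div P d m = t div P d (Suc m) * b d (Suc m) + digit d t (Suc m)"
  unfolding div_P_Suc digit_def diff_Suc_1 by (rule div_mult_mod_eq[symmetric])

lemma div_P_mono_eq:
  assumes "t div P d m = q div P d m" "m \<le> m'"
  shows "t div P d m' = q div P d m'"
  using assms(2,1) by (induction rule: dec_induct) (auto simp: div_P_Suc)

lemma digit_eq:
  assumes "t div P d m = q div P d m" "m < k"
  shows "digit d t k = digit d q k"
  using div_P_mono_eq[OF assms(1), of "k - 1"] assms(2) by (simp add: digit_def)

text \<open>The bounds by \<open>P d N\<close> exclude that two numbers differ only in digits that the grid does not have.\<close>

lemma digit_neq:
  assumes "t < P d N" "q < P d N" "t div P d m \<noteq> q div P d m" "m \<le> N"
  shows "\<exists>k\<in>{Suc m..N}. digit d t k \<noteq> digit d q k"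
  using assms(4,3)
proof (induction rule: inc_induct)
  case base
  then show ?case using assms(1,2) by simp
next
  case (step n)
  show ?case
  proof (cases "digit d t (Suc n) = digit d q (Suc n)")
    case True
    then have "t div P d (Suc n) \<noteq> q div P d (Suc n)" using step.prems div_P_eq[of t d n] div_P_eq[of q d n] by auto
    then obtain k where "k \<in> {Suc (Suc n)..N}" "digit d t k \<noteq> digit d q k" using step.IH by blast
    then show ?thesis by (intro bexI[of _ k]) auto
  next
    case False
    then show ?thesis using step.hyps by (intro bexI[of _ "Suc n"]) auto
  qed
qed

lemma digit_less: "d \<in> {1..D} \<Longrightarrow> 1 \<le> k \<Longrightarrow> digit d t k < b d k"
  using b_ge_2[of d k] by (simp add: digit_def)

lemma norm_chr [simp]: "norm (chr d t x) = 1"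
  by (simp add: chr_def prod_norm[symmetric])

lemma norm_chi [simp]: "norm (chi n x) = 1"
  by (simp add: chi_def prod_norm[symmetric])

lemma chr_rot:
  assumes "d \<in> {1..D}" "k \<in> {1..N}" "x \<in> X"
  shows "chr d t (rot (d, k) x) = cis (2 * pi * real (digit d t k) / real (b d k)) * chr d t x"
proof -
  have x: "x (d, k) < b d k" using in_X_less[OF assms(3) coordsI[OF assms(1,2)]] by simp
  let ?f = "\<lambda>x k. cis (2 * pi * real (digit d t k * x (d, k)) / real (b d k))"
  have "chr d t (rot (d, k) x) = ?f (rot (d, k) x) k * (\<Prod>j\<in>{1..N} - {k}. ?f (rot (d, k) x) j)"
    unfolding chr_def using assms by (intro prod.remove) auto
  also have "?f (rot (d, k) x) k = cis (2 * pi * real (digit d t k) / real (b d k)) * ?f x k"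
    using cis_mod[OF x] by (simp add: rot_def)
  also have "(\<Prod>j\<in>{1..N} - {k}. ?f (rot (d, k) x) j) = (\<Prod>j\<in>{1..N} - {k}. ?f x j)"
    by (intro prod.cong) (auto simp: rot_def)
  also have "cis (2 * pi * real (digit d t k) / real (b d k)) * ?f x k * (\<Prod>j\<in>{1..N} - {k}. ?f x j)
      = cis (2 * pi * real (digit d t k) / real (b d k)) * chr d t x"
    unfolding chr_def mult.assoc using assms by (subst prod.remove[of "{1..N}" k]) auto
  finally show ?thesis .
qed

lemma chr_rot_other: "d' \<noteq> d \<Longrightarrow> chr d' t (rot (d, k) x) = chr d' t x"
  by (simp add: chr_def rot_def)

lemma chi_rot:
  assumes "d \<in> {1..D}" "k \<in> {1..N}" "x \<in> X"
  shows "chi n (rot (d, k) x) = cis (2 * pi * real (digit d (n d) k) / real (b d k)) * chi n x"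
proof -
  have "chi n (rot (d, k) x) = chr d (n d) (rot (d, k) x) * (\<Prod>j\<in>{1..D} - {d}. chr j (n j) (rot (d, k) x))"
    unfolding chi_def using assms by (intro prod.remove) auto
  also have "(\<Prod>j\<in>{1..D} - {d}. chr j (n j) (rot (d, k) x)) = (\<Prod>j\<in>{1..D} - {d}. chr j (n j) x)"
    by (intro prod.cong) (auto simp: chr_rot_other)
  also have "chr d (n d) (rot (d, k) x) * \<dots> = cis (2 * pi * real (digit d (n d) k) / real (b d k)) * chi n x"
    unfolding chr_rot[OF assms] chi_def mult.assoc using assms by (subst prod.remove[of "{1..D}" d]) auto
  finally show ?thesis .
qed

lemma dep_chr_other: "d' \<noteq> d \<Longrightarrow> dep (dir d m) (chr d' t)"
  by (simp add: dep_def chr_def mix_def dir_def)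

text \<open>Characters of one block of size \<open>P d m\<close> have the same digits beyond the \<open>m\<close>-th one, so
  these cancel in a quotient.\<close>

lemma dep_chr_quotient:
  assumes "t div P d m = q div P d m"
  shows "dep ({d} \<times> {..m}) (\<lambda>x. cnj (chr d q x) * chr d t x)"
proof -
  let ?f = "\<lambda>t k x. cis (2 * pi * real (digit d t k * x (d, k)) / real (b d k))"
  have eq: "(\<lambda>x. cnj (chr d q x) * chr d t x) = (\<lambda>x. \<Prod>k=1..N. cnj (?f q k x) * ?f t k x)"
    by (simp add: chr_def prod.distrib fun_eq_iff)
  show ?thesis unfolding eq
  proof (rule dep_prod)
    fix k assume "k \<in> {1..N}"
    show "dep ({d} \<times> {..m}) (\<lambda>x. cnj (?f q k x) * ?f t k x)"
    proof (cases "k \<le> m")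
      case True then show ?thesis by (simp add: dep_def mix_def)
    next
      case False
      then have "digit d t k = digit d q k" by (intro digit_eq[OF assms]) auto
      then show ?thesis by (simp add: dep_def cis_cnj cis_mult)
    qed
  qed
qed

lemma box_less: "n \<in> box \<Longrightarrow> d \<in> {1..D} \<Longrightarrow> n d < P d N"
  by (auto simp: box_def)

lemma finite_box [simp, intro]: "finite box"
  unfolding box_def by (intro finite_PiE) auto

text \<open>If \<open>n d\<close> and \<open>q\<close> lie in one block, the quotient of their characters is fixed by the average. Otherwise
  it is an eigenfunction of the rotation of a released digit, and its average vanishes.\<close>

lemma avg_modulated_spec:
  assumes d: "d \<in> {1..D}" and q: "q < P d N" and R: "R \<subseteq> box" and m: "m \<le> N" and x: "x \<in> X"
  shows "avg (dir d m) (\<lambda>y. cnj (chr d q y) * spec c R y) x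
    = cnj (chr d q x) * spec c {n\<in>R. n d div P d m = q div P d m} x"
proof -
  have fin: "finite R" using R finite_subset by blast
  have one: "avg (dir d m) (\<lambda>y. cnj (chr d q y) * chi n y) x
      = (if n d div P d m = q div P d m then cnj (chr d q x) * chi n x else 0)" if n: "n \<in> R" for n
  proof (cases "n d div P d m = q div P d m")
    case True
    have eq: "(\<lambda>y. cnj (chr d q y) * chi n y)
        = (\<lambda>y. (cnj (chr d q y) * chr d (n d) y) * (\<Prod>j\<in>{1..D} - {d}. chr j (n j) y))"
      unfolding chi_def using d by (subst prod.remove[of _ d]) (auto simp: mult.assoc)
    have "dep (dir d m) (\<lambda>y. cnj (chr d q y) * chr d (n d) y)"
      by (rule dep_mono[OF dep_chr_quotient[OF True]]) (auto simp: dir_def)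
    then have "dep (dir d m) (\<lambda>y. cnj (chr d q y) * chi n y)"
      unfolding eq by (rule dep_mult) (intro dep_prod dep_chr_other, auto)
    from avg_dep[OF this x] True show ?thesis by simp
  next
    case False
    obtain k where k: "k \<in> {Suc m..N}" "digit d (n d) k \<noteq> digit d q k"
      using digit_neq[OF box_less[OF subsetD[OF R n] d] q False m] by blast
    have "avg (dir d m) (\<lambda>y. cnj (chr d q y) * chi n y) x = 0"
    proof (rule avg_eigenfunction[where s = "(d, k)"])
      let ?w = "\<lambda>t. cis (2 * pi * real (digit d t k) / real (b d k))"
      show "(d, k) \<in> coords" "(d, k) \<notin> dir d m" using d k by (auto simp: dir_def intro!: coordsI)
      show "cnj (chr d q (rot (d, k) y)) * chi n (rot (d, k) y)
          = (cnj (?w q) * ?w (n d)) * (cnj (chr d q y) * chi n y)" if "y \<in> X" for y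
        using that d k by (simp add: chr_rot chi_rot)
      show "cnj (?w q) * ?w (n d) \<noteq> 1"
        using k d by (intro cis_frac_neq_1 digit_less) auto
    qed fact
    with False show ?thesis by simp
  qed
  have "avg (dir d m) (\<lambda>y. cnj (chr d q y) * spec c R y) x
      = avg (dir d m) (\<lambda>y. \<Sum>n\<in>R. c n * (cnj (chr d q y) * chi n y)) x"
    by (simp add: spec_def sum_distrib_left mult.left_commute)
  also have "\<dots> = (\<Sum>n\<in>R. c n * avg (dir d m) (\<lambda>y. cnj (chr d q y) * chi n y) x)"
    by (simp only: avg_sum avg_cmult)
  also have "\<dots> = (\<Sum>n\<in>{n\<in>R. n d div P d m = q div P d m}. c n * (cnj (chr d q x) * chi n x))"
    using fin by (intro sum.mono_neutral_cong_right) (auto simp: one)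
  finally show ?thesis by (simp add: spec_def sum_distrib_left mult.left_commute)
qed

lemma orthogonal_chi:
  assumes d: "d \<in> {1..D}" and k: "k \<in> {1..N}" and neq: "digit d (n d) k \<noteq> digit d (n' d) k"
    and u: "\<And>x. x \<in> X \<Longrightarrow> u (rot (d, k) x) = u x"
  shows "(\<Sum>x\<in>X. u x * chi n x * cnj (chi n' x)) = 0"
proof (rule sum_eigenfunction[where s = "(d, k)"])
  let ?w = "\<lambda>t. cis (2 * pi * real (digit d t k) / real (b d k))"
  show "(d, k) \<in> coords" using d k by (rule coordsI)
  show "u (rot (d, k) y) * chi n (rot (d, k) y) * cnj (chi n' (rot (d, k) y))
      = (cnj (?w (n' d)) * ?w (n d)) * (u y * chi n y * cnj (chi n' y))" if "y \<in> X" for y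
    using that d k by (simp add: chi_rot u)
  show "cnj (?w (n' d)) * ?w (n d) \<noteq> 1"
    using k d neq by (intro cis_frac_neq_1 digit_less) auto
qed

text \<open>The coordinates not in direction \<open>d\<close> are part of every stage of the filtration: they are
  parameters of a one-dimensional martingale.\<close>

lemma coordinate_filtration_dir:
  assumes d: "d \<in> {1..D}"
  shows "coordinate_filtration coords (\<lambda>s. b (fst s) (snd s)) (dir d) N B"
proof (intro coordinate_filtration.intro coordinate_filtration_axioms.intro finite_product_axioms)
  show "dir d i \<subseteq> dir d j" if "i \<le> j" for i j using that by (auto simp: dir_def)
  show "coords \<subseteq> dir d N" by (auto simp: dir_def coords_def)
  fix m assume m: "m < N"
  have "dir d (Suc m) = insert (d, Suc m) (dir d m)" by (auto simp: dir_def)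
  moreover have "b d (Suc m) \<le> B" using d by (intro b_le_B) auto
  ultimately show "\<exists>s\<in>coords. dir d (Suc m) = insert s (dir d m) \<and> b (fst s) (snd s) \<le> B"
    using d m by (intro bexI[of _ "(d, Suc m)"]) (auto intro!: coordsI)
qed

end

section \<open>Cutting rectangles into blocks\<close>

context vilenkin_grid
begin

text \<open>\<open>cell d l u t\<close> is the maximal block that contains \<open>t\<close> and is contained in \<open>{l..<u}\<close>.\<close>

definition level :: "nat \<Rightarrow> nat \<Rightarrow> nat \<Rightarrow> nat \<Rightarrow> nat" where
  "level d l u t = Max {m. m \<le> N \<and> {t'. t' div P d m = t div P d m} \<subseteq> {l..<u}}"

definition cell :: "nat \<Rightarrow> nat \<Rightarrow> nat \<Rightarrow> nat \<Rightarrow> nat set" where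
  "cell d l u t = {t'. t' div P d (level d l u t) = t div P d (level d l u t)}"

text \<open>Rectangles whose sides in the first \<open>e\<close> directions are blocks. The strict bound \<open>u < P d N\<close> gives the
  neighbour \<open>u\<close> of the interval a character on the grid.\<close>

definition rect_blocks :: "nat \<Rightarrow> (nat \<Rightarrow> nat) set \<Rightarrow> bool" where
  "rect_blocks e R \<longleftrightarrow> (\<exists>J. R = (\<Pi>\<^sub>E d\<in>{1..D}. J d)
     \<and> (\<forall>d\<in>{1..D}. \<exists>l u. l < u \<and> u < P d N \<and> J d = {l..<u})
     \<and> (\<forall>d\<in>{1..e}. \<exists>m\<le>N. \<exists>q. J d = {t. t div P d m = q}))"

lemma t_in_cell [simp]: "t \<in> cell d l u t"
  by (simp add: cell_def)

lemma level_max: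
  assumes "t \<in> {l..<u}"
  shows "level d l u t \<le> N" "cell d l u t \<subseteq> {l..<u}"
    "m \<le> N \<Longrightarrow> {t'. t' div P d m = t div P d m} \<subseteq> {l..<u} \<Longrightarrow> m \<le> level d l u t"
proof -
  let ?M = "{m. m \<le> N \<and> {t'. t' div P d m = t div P d m} \<subseteq> {l..<u}}"
  have fin: "finite ?M" by simp
  have ne: "0 \<in> ?M" using assms by auto
  have "Max ?M \<in> ?M" using fin ne by (intro Max_in) auto
  then show "level d l u t \<le> N" "cell d l u t \<subseteq> {l..<u}" unfolding level_def cell_def by auto
  show "m \<le> level d l u t" if "m \<le> N" "{t'. t' div P d m = t div P d m} \<subseteq> {l..<u}"
    unfolding level_def using that fin by (intro Max_ge) auto
qed

text \<open>A block that meets \<open>{l..<u}\<close> and reaches beyond it contains one of the neighbours \<open>l - 1\<close> and \<open>u\<close>, so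
  only two modulations serve all maximal blocks of the interval.\<close>

lemma parent_of_cell:
  assumes t: "t \<in> {l..<u}" and u: "u < P d N"
  shows "level d l u t < N"
    "\<exists>w\<in>{l - 1, u}. w div P d (Suc (level d l u t)) = t div P d (Suc (level d l u t))
       \<and> w div P d (level d l u t) \<noteq> t div P d (level d l u t)"
proof -
  let ?m = "level d l u t"
  show lN: "?m < N"
  proof (rule ccontr)
    assume "\<not> ?m < N"
    then have "?m = N" using level_max(1)[OF t, of d] by simp
    then have "u \<in> cell d l u t" using u t by (simp add: cell_def)
    with level_max(2)[OF t, of d] show False by auto
  qed
  have "\<not> {t'. t' div P d (Suc ?m) = t div P d (Suc ?m)} \<subseteq> {l..<u}"
    using level_max(3)[OF t, of "Suc ?m" d] lN by auto
  then obtain s where s: "s div P d (Suc ?m) = t div P d (Suc ?m)" "s \<notin> {l..<u}" unfolding subset_iff by blast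
  define w where "w = (if s < l then l - 1 else u)"
  have "w div P d (Suc ?m) = t div P d (Suc ?m)"
  proof (cases "s < l")
    case True
    then have "s \<le> w" "w \<le> t" using t by (auto simp: w_def)
    then show ?thesis using s(1) div_le_mono[of s w "P d (Suc ?m)"] div_le_mono[of w t "P d (Suc ?m)"] by simp
  next
    case False
    then have "w \<le> s" "t \<le> w" using t s(2) by (auto simp: w_def)
    then show ?thesis using s(1) div_le_mono[of w s "P d (Suc ?m)"] div_le_mono[of t w "P d (Suc ?m)"] by simp
  qed
  moreover have "w \<notin> {l..<u}" using t by (auto simp: w_def)
  then have "w \<notin> cell d l u t" using level_max(2)[OF t, of d] by blast
  ultimately show "\<exists>w\<in>{l - 1, u}. w div P d (Suc ?m) = t div P d (Suc ?m) \<and> w div P d ?m \<noteq> t div P d ?m"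
    by (intro bexI[of _ w]) (auto simp: w_def cell_def)
qed

lemma cell_eq:
  assumes t: "t \<in> {l..<u}" and t': "t' \<in> cell d l u t"
  shows "cell d l u t' = cell d l u t"
proof -
  have t'lu: "t' \<in> {l..<u}" using level_max(2)[OF t, of d] t' by blast
  let ?m = "level d l u t" and ?m' = "level d l u t'"
  have e: "t' div P d ?m = t div P d ?m" using t' by (simp add: cell_def)
  have le: "?m \<le> ?m'" using level_max(1,2)[OF t, of d] e by (intro level_max(3)[OF t'lu]) (auto simp: cell_def)
  then have e': "t' div P d ?m' = t div P d ?m'" using div_P_mono_eq[OF e] by simp
  have "?m' \<le> ?m" using level_max(1,2)[OF t'lu, of d] e' by (intro level_max(3)[OF t]) (auto simp: cell_def)
  with le e show ?thesis by (simp add: cell_def)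
qed

lemma block_interval:
  assumes "d \<in> {1..D}"
  shows "{t. t div P d m = q} = {q * P d m..<Suc q * P d m}"
proof -
  have p: "0 < P d m" using assms by (rule P_pos)
  show ?thesis
  proof (intro set_eqI iffI)
    fix t assume "t \<in> {t. t div P d m = q}"
    then show "t \<in> {q * P d m..<Suc q * P d m}"
      using div_times_less_eq_dividend[of t "P d m"] dividend_less_div_times[OF p, of t] by auto
  next
    fix t assume "t \<in> {q * P d m..<Suc q * P d m}"
    then show "t \<in> {t. t div P d m = q}"
      by (auto intro!: div_nat_eqI simp: mult.commute)
  qed
qed

lemma rect_blocks_subset: "rect_blocks e R \<Longrightarrow> R \<subseteq> box"
proof -
  assume "rect_blocks e R"
  then obtain J where J: "R = (\<Pi>\<^sub>E d\<in>{1..D}. J d)" "\<forall>d\<in>{1..D}. \<exists>l u. l < u \<and> u < P d N \<and> J d = {l..<u}"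
    unfolding rect_blocks_def by blast
  have "J d \<subseteq> {..<P d N}" if d: "d \<in> {1..D}" for d
  proof -
    obtain l u where "u < P d N" "J d = {l..<u}" using J(2) d by blast
    then show ?thesis by auto
  qed
  then show ?thesis unfolding J(1) box_def by (rule PiE_mono)
qed

lemma rect_blocks_finite: "rect_blocks e R \<Longrightarrow> finite R"
  using rect_blocks_subset finite_subset by blast

definition refine :: "nat \<Rightarrow> nat \<Rightarrow> nat \<Rightarrow> (nat \<Rightarrow> nat) set \<Rightarrow> (nat \<Rightarrow> nat) set set" where
  "refine d l u R = (\<lambda>n. {n'\<in>R. n' d \<in> cell d l u (n d)}) ` R"

lemma refine_partition:
  assumes R: "\<And>n. n \<in> R \<Longrightarrow> n d \<in> {l..<u}"
  shows "\<Union>(refine d l u R) = R" "R' \<in> refine d l u R \<Longrightarrow> R' \<noteq> {}" "R' \<in> refine d l u R \<Longrightarrow> R' \<subseteq> R"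
    "R' \<in> refine d l u R \<Longrightarrow> R'' \<in> refine d l u R \<Longrightarrow> R' \<noteq> R'' \<Longrightarrow> R' \<inter> R'' = {}"
proof -
  show "\<Union>(refine d l u R) = R" unfolding refine_def by auto
  show "R' \<in> refine d l u R \<Longrightarrow> R' \<noteq> {}" "R' \<in> refine d l u R \<Longrightarrow> R' \<subseteq> R"
    unfolding refine_def using t_in_cell by blast+
  assume a: "R' \<in> refine d l u R" "R'' \<in> refine d l u R" "R' \<noteq> R''"
  then obtain n n' where n: "n \<in> R" "R' = {k\<in>R. k d \<in> cell d l u (n d)}" "n' \<in> R" "R'' = {k\<in>R. k d \<in> cell d l u (n' d)}"
    unfolding refine_def by auto
  show "R' \<inter> R'' = {}"
  proof (rule ccontr)
    assume "R' \<inter> R'' \<noteq> {}"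
    then obtain k where "k d \<in> cell d l u (n d)" "k d \<in> cell d l u (n' d)" unfolding n by auto
    then have "cell d l u (n d) = cell d l u (n' d)" using cell_eq[OF R] n by metis
    with a n show False by simp
  qed
qed

lemma refine_rect_blocks:
  assumes RJ: "R = (\<Pi>\<^sub>E d\<in>{1..D}. J d)"
    and J: "\<And>d. d \<in> {1..D} \<Longrightarrow> \<exists>l u. l < u \<and> u < P d N \<and> J d = {l..<u}"
    and blk: "\<And>d. d \<in> {1..e} \<Longrightarrow> \<exists>m\<le>N. \<exists>q. J d = {t. t div P d m = q}"
    and d: "d = Suc e" "d \<le> D" and Jd: "J d = {l..<u}" "u < P d N"
    and R': "R' \<in> refine d l u R"
  shows "rect_blocks d R'"
proof -
  have dD: "d \<in> {1..D}" using d by simp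
  obtain n where n: "n \<in> R" "R' = {k\<in>R. k d \<in> cell d l u (n d)}" using R' unfolding refine_def by auto
  have "n d \<in> J d" using n(1) unfolding RJ by (rule PiE_mem[OF _ dD])
  then have nd: "n d \<in> {l..<u}" using Jd by simp
  let ?J = "J(d := cell d l u (n d))" and ?m = "level d l u (n d)"
  have sub: "cell d l u (n d) \<subseteq> {l..<u}" by (rule level_max[OF nd])
  have "R' = (\<Pi>\<^sub>E d\<in>{1..D}. ?J d)"
  proof (intro set_eqI iffI)
    fix k assume "k \<in> R'"
    then show "k \<in> (\<Pi>\<^sub>E d\<in>{1..D}. ?J d)" unfolding n(2) RJ PiE_iff by simp
  next
    fix k assume k: "k \<in> (\<Pi>\<^sub>E d\<in>{1..D}. ?J d)"
    have "k i \<in> J i" if "i \<in> {1..D}" for i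
      using PiE_mem[OF k that] sub Jd by (cases "i = d") auto
    moreover have "k d \<in> cell d l u (n d)" using PiE_mem[OF k dD] by simp
    ultimately show "k \<in> R'" using k unfolding n(2) RJ PiE_iff by simp
  qed
  moreover have "\<exists>l u. l < u \<and> u < P d' N \<and> ?J d' = {l..<u}" if d': "d' \<in> {1..D}" for d'
  proof (cases "d' = d")
    case True
    define q where "q = n d div P d ?m"
    have c: "cell d l u (n d) = {q * P d ?m..<Suc q * P d ?m}"
      unfolding cell_def q_def by (rule block_interval[OF dD])
    have p: "0 < P d ?m" by (rule P_pos[OF dD])
    have "Suc q * P d ?m - 1 \<in> cell d l u (n d)" unfolding c using p by simp
    then have "Suc q * P d ?m - 1 < u" using sub by auto
    then have "Suc q * P d ?m < P d N" using Jd(2) by linarith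
    with c p True show ?thesis by (intro exI[of _ "q * P d ?m"] exI[of _ "Suc q * P d ?m"]) auto
  next
    case False
    with J[OF d'] show ?thesis by simp
  qed
  moreover have "\<exists>m\<le>N. \<exists>q. ?J d' = {t. t div P d' m = q}" if d': "d' \<in> {1..d}" for d'
  proof (cases "d' = d")
    case True
    then show ?thesis using level_max(1)[OF nd, of d] by (intro exI[of _ ?m]) (auto simp: cell_def)
  next
    case False
    with d' d have "d' \<in> {1..e}" by auto
    from blk[OF this] False show ?thesis by simp
  qed
  ultimately show ?thesis unfolding rect_blocks_def by blast
qed

definition increment :: "nat \<Rightarrow> nat \<Rightarrow> (_ \<Rightarrow> complex) \<Rightarrow> (nat \<times> nat \<Rightarrow> nat) \<Rightarrow> real" where
  "increment d m h x = avg (dir d m) (\<lambda>y. (norm (avg (dir d (Suc m)) h y - avg (dir d m) h y))\<^sup>2) x"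

lemma increment_nonneg: "x \<in> X \<Longrightarrow> 0 \<le> increment d m h x"
  unfolding increment_def by (intro avg_nonneg) auto

text \<open>The martingale increment of the modulated function collects exactly the siblings of the
  block of \<open>w\<close>, and each sibling is recovered from their sum by one more modulation and average.\<close>

lemma sibling_le_increment:
  assumes d: "d \<in> {1..D}" and m: "m < N" and w: "w < P d N" and t: "t < P d N" and R: "R \<subseteq> box"
    and parent: "w div P d (Suc m) = t div P d (Suc m)" and neq: "w div P d m \<noteq> t div P d m" and x: "x \<in> X"
  shows "(norm (spec c {n\<in>R. n d div P d m = t div P d m} x))\<^sup>2
    \<le> increment d m (\<lambda>y. cnj (chr d w y) * spec c R y) x"
proof -
  let ?h = "\<lambda>y. cnj (chr d w y) * spec c R y"
  let ?P = "{n\<in>R. n d div P d (Suc m) = w div P d (Suc m)}"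
  let ?Q = "{n\<in>R. n d div P d m = w div P d m}"
  let ?R = "?P - ?Q"
  have fin: "finite R" using R finite_subset by blast
  have QP: "?Q \<subseteq> ?P" by (auto simp: div_P_Suc)
  have \<Delta>: "avg (dir d (Suc m)) ?h y - avg (dir d m) ?h y = cnj (chr d w y) * spec c ?R y" if "y \<in> X" for y
  proof -
    have "spec c ?P y - spec c ?Q y = spec c ?R y"
      unfolding spec_def using fin QP by (simp add: sum_diff)
    then show ?thesis
      using avg_modulated_spec[OF d w R _ that, of "Suc m"] avg_modulated_spec[OF d w R _ that, of m] m
      by (simp add: right_diff_distrib[symmetric])
  qed
  have RB: "?R \<subseteq> box" using R by auto
  have eq: "{n\<in>R. n d div P d m = t div P d m} = {n\<in>?R. n d div P d m = t div P d m}"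
    using parent neq by (auto simp: div_P_Suc)
  have "avg (dir d m) (\<lambda>y. cnj (chr d t y) * spec c ?R y) x
      = cnj (chr d t x) * spec c {n\<in>R. n d div P d m = t div P d m} x"
    unfolding eq using m x by (intro avg_modulated_spec[OF d t RB]) auto
  then have "norm (spec c {n\<in>R. n d div P d m = t div P d m} x)
      = norm (avg (dir d m) (\<lambda>y. cnj (chr d t y) * spec c ?R y) x)" by (simp add: norm_mult)
  also have "\<dots> \<le> avg (dir d m) (\<lambda>y. norm (cnj (chr d t y) * spec c ?R y)) x" by (rule norm_avg)
  also have "\<dots> = avg (dir d m) (\<lambda>y. norm (avg (dir d (Suc m)) ?h y - avg (dir d m) ?h y)) x"
    using x by (intro avg_cong) (auto simp: \<Delta> norm_mult)
  finally have "(norm (spec c {n\<in>R. n d div P d m = t div P d m} x))\<^sup>2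
      \<le> (avg (dir d m) (\<lambda>y. norm (avg (dir d (Suc m)) ?h y - avg (dir d m) ?h y)) x)\<^sup>2"
    by (intro power_mono) auto
  also have "\<dots> \<le> increment d m ?h x" unfolding increment_def by (rule avg_square)
  finally show ?thesis .
qed

end

text \<open>An injective choice of parameters turns termwise domination into domination of the sums.\<close>

lemma sum_le_sum_param:
  fixes f :: "'a \<Rightarrow> real"
  assumes Z: "finite Z" and T: "\<And>z. z \<in> Z \<Longrightarrow> 0 \<le> T z"
    and ex: "\<And>r. r \<in> Q \<Longrightarrow> \<exists>z\<in>Z. r = \<Phi> z \<and> f r \<le> T z"
  shows "sum f Q \<le> sum T Z"
proof -
  obtain z where z: "\<And>r. r \<in> Q \<Longrightarrow> z r \<in> Z \<and> r = \<Phi> (z r) \<and> f r \<le> T (z r)" using ex by metis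
  have inj: "inj_on z Q" using z by (metis inj_onI)
  have "sum f Q \<le> (\<Sum>r\<in>Q. T (z r))" using z by (intro sum_mono) auto
  also have "\<dots> = sum T (z ` Q)" using inj by (simp add: sum.reindex)
  also have "\<dots> \<le> sum T Z" using z T Z by (intro sum_mono2) auto
  finally show ?thesis .
qed

context vilenkin_grid
begin

text \<open>A maximal block is determined by the neighbour \<open>w\<close> in its parent, its level and its position among
  at most \<open>B\<close> siblings, so every increment is used at most \<open>B\<close> times for each of the two neighbours.\<close>

lemma refine_energy:
  fixes c
  assumes d: "d \<in> {1..D}" and u: "u < P d N" and R: "R \<subseteq> box" and lu: "\<And>n. n \<in> R \<Longrightarrow> n d \<in> {l..<u}"
    and "l < u" and x: "x \<in> X"
  defines "h \<equiv> \<lambda>w y. cnj (chr d w y) * spec c R y"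
  shows "(\<Sum>R'\<in>refine d l u R. (norm (spec c R' x))\<^sup>2)
    \<le> real B * ((\<Sum>m<N. increment d m (h (l - 1)) x) + (\<Sum>m<N. increment d m (h u) x))"
proof -
  let ?Z = "{l - 1, u} \<times> {..<N} \<times> {..<B}"
  let ?\<Phi> = "\<lambda>(w, m, j). {n\<in>R. n d div P d m = w div P d (Suc m) * b d (Suc m) + j}"
  have "(\<Sum>R'\<in>refine d l u R. (norm (spec c R' x))\<^sup>2) \<le> (\<Sum>(w, m, j)\<in>?Z. increment d m (h w) x)"
  proof (rule sum_le_sum_param[where \<Phi> = ?\<Phi>])
    show "finite ?Z" by simp
    show "0 \<le> (case z of (w, m, j) \<Rightarrow> increment d m (h w) x)" for z
      using x increment_nonneg by (auto split: prod.splits)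
    fix R' assume "R' \<in> refine d l u R"
    then obtain n where n: "n \<in> R" "R' = {k\<in>R. k d \<in> cell d l u (n d)}" unfolding refine_def by auto
    let ?m = "level d l u (n d)"
    obtain w where w: "w \<in> {l - 1, u}" "w div P d (Suc ?m) = n d div P d (Suc ?m)" "w div P d ?m \<noteq> n d div P d ?m"
      using parent_of_cell[OF lu[OF n(1)] u] by blast
    have m: "?m < N" by (rule parent_of_cell[OF lu[OF n(1)] u])
    have R'eq: "R' = {k\<in>R. k d div P d ?m = n d div P d ?m}" unfolding n(2) cell_def by simp
    have eq: "R' = ?\<Phi> (w, ?m, digit d (n d) (Suc ?m))"
      unfolding R'eq prod.case w(2) using div_P_eq[of "n d" d ?m] by simp
    have "digit d (n d) (Suc ?m) < B"
      using digit_less[OF d, of "Suc ?m" "n d"] b_le_B[OF d, of "Suc ?m"] by simp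
    then have Z: "(w, ?m, digit d (n d) (Suc ?m)) \<in> ?Z" using w(1) m by auto
    have "(norm (spec c R' x))\<^sup>2 \<le> increment d ?m (h w) x"
      unfolding R'eq h_def using w \<open>l < u\<close> u lu[OF n(1)]
      by (intro sibling_le_increment[OF d m _ _ R _ _ x]) auto
    then show "\<exists>z\<in>?Z. R' = ?\<Phi> z \<and> (norm (spec c R' x))\<^sup>2 \<le> (case z of (w, m, j) \<Rightarrow> increment d m (h w) x)"
      using eq by (intro bexI[OF _ Z]) simp
  qed
  also have "\<dots> = (\<Sum>w\<in>{l - 1, u}. \<Sum>m<N. real B * increment d m (h w) x)"
    by (simp add: sum.cartesian_product[symmetric])
  also have "\<dots> = real B * ((\<Sum>m<N. increment d m (h (l - 1)) x) + (\<Sum>m<N. increment d m (h u) x))"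
    using \<open>l < u\<close> by (simp add: sum_distrib_left distrib_left)
  finally show ?thesis .
qed

end

definition refine_const :: "nat \<Rightarrow> real \<Rightarrow> real" where
  "refine_const B p = (2 * sqrt (real B)) powr p * (4 * (1 + (real B)\<^sup>2) * layer_const p)"

lemma powr_add_le:
  assumes "0 \<le> a" "0 \<le> b" "0 \<le> (p::real)"
  shows "(a + b) powr p \<le> 2 powr p * (a powr p + b powr p)"
proof -
  have "(a + b) powr p \<le> (2 * max a b) powr p" using assms by (intro powr_mono2) auto
  also have "\<dots> = 2 powr p * max a b powr p" using assms by (simp add: powr_mult)
  also have "\<dots> \<le> 2 powr p * (a powr p + b powr p)" by (intro mult_left_mono) (auto simp: max_def)
  finally show ?thesis .
qed

context vilenkin_grid
begin

definition square_fn :: "((nat \<Rightarrow> nat) \<Rightarrow> complex) \<Rightarrow> (nat \<Rightarrow> nat) set set \<Rightarrow> (nat \<times> nat \<Rightarrow> nat) \<Rightarrow> real" where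
  "square_fn c \<R> x = L2_set (\<lambda>R. norm (spec c R x)) \<R>"

lemma square_fn_nonneg: "0 \<le> square_fn c \<R> x"
  by (simp add: square_fn_def L2_set_nonneg)

lemma square_fn_power2: "(square_fn c \<R> x)\<^sup>2 = (\<Sum>R\<in>\<R>. (norm (spec c R x))\<^sup>2)"
  by (simp add: square_fn_def L2_set_def sum_nonneg)

text \<open>Modulations do not change moduli. Hence both modulated families have the square function of \<open>\<R>\<close> as
  their vector norm, and the martingale inequality applies to each of them.\<close>

lemma refine_step:
  assumes p: "1 < p" "p < 2" and e: "Suc e \<le> D"
    and fin: "finite \<R>" and rb: "\<And>R. R \<in> \<R> \<Longrightarrow> rect_blocks e R" and dis: "disjoint \<R>"
  shows "\<exists>\<R>'. finite \<R>' \<and> (\<forall>R\<in>\<R>'. rect_blocks (Suc e) R) \<and> disjoint \<R>' \<and> \<Union>\<R>' = \<Union>\<R>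
    \<and> (\<Sum>x\<in>X. square_fn c \<R>' x powr p) \<le> refine_const B p * (\<Sum>x\<in>X. square_fn c \<R> x powr p)"
proof -
  define d where "d = Suc e"
  have d: "d \<in> {1..D}" using e by (simp add: d_def)
  interpret F: coordinate_filtration coords "\<lambda>s. b (fst s) (snd s)" "dir d" N B
    by (rule coordinate_filtration_dir[OF d])
  obtain J where J: "\<And>R. R \<in> \<R> \<Longrightarrow> R = (\<Pi>\<^sub>E d\<in>{1..D}. J R d)
     \<and> (\<forall>d\<in>{1..D}. \<exists>l u. l < u \<and> u < P d N \<and> J R d = {l..<u})
     \<and> (\<forall>d\<in>{1..e}. \<exists>m\<le>N. \<exists>q. J R d = {t. t div P d m = q})"
    using rb unfolding rect_blocks_def by metis
  have "\<forall>R\<in>\<R>. \<exists>lu. fst lu < snd lu \<and> snd lu < P d N \<and> J R d = {fst lu..<snd lu}"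
  proof
    fix R assume "R \<in> \<R>"
    from bspec[OF conjunct1[OF conjunct2[OF J[OF this]]] d]
    show "\<exists>lu. fst lu < snd lu \<and> snd lu < P d N \<and> J R d = {fst lu..<snd lu}"
      unfolding split_paired_Ex fst_conv snd_conv .
  qed
  from bchoice[OF this] obtain lu where lu':
    "\<forall>R\<in>\<R>. fst (lu R) < snd (lu R) \<and> snd (lu R) < P d N \<and> J R d = {fst (lu R)..<snd (lu R)}" ..
  define l u where "l R = fst (lu R)" and "u R = snd (lu R)" for R
  have lu: "l R < u R \<and> u R < P d N \<and> J R d = {l R..<u R}" if "R \<in> \<R>" for R
    using bspec[OF lu' that] unfolding l_def u_def .
  have inlu: "n d \<in> {l R..<u R}" if "R \<in> \<R>" "n \<in> R" for n R
    using J[OF that(1)] lu[OF that(1)] d that(2) by (metis PiE_mem)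
  have box: "R \<subseteq> box" if "R \<in> \<R>" for R using rb[OF that] by (rule rect_blocks_subset)
  let ?ref = "\<lambda>R. refine d (l R) (u R) R"
  define \<R>' where "\<R>' = (\<Union>R\<in>\<R>. ?ref R)"
  have part1: "\<Union>(?ref R) = R" if "R \<in> \<R>" for R
    by (rule refine_partition) (rule inlu[OF that])
  have part2: "R' \<noteq> {}" "R' \<subseteq> R" if "R \<in> \<R>" "R' \<in> ?ref R" for R R'
    using refine_partition(2,3)[where d = d and l = "l R" and u = "u R" and R = R and R' = R'] inlu[OF that(1)] that(2)
    by blast+
  have part3: "R' \<inter> R'' = {}" if "R \<in> \<R>" "R' \<in> ?ref R" "R'' \<in> ?ref R" "R' \<noteq> R''" for R R' R''
    by (rule refine_partition(4)[OF _ that(2-4)]) (rule inlu[OF that(1)])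
  have finref: "finite (?ref R)" if "R \<in> \<R>" for R
    unfolding refine_def using rect_blocks_finite[OF rb[OF that]] by simp
  have disref: "?ref R1 \<inter> ?ref R2 = {}" if "R1 \<in> \<R>" "R2 \<in> \<R>" "R1 \<noteq> R2" for R1 R2
  proof (rule ccontr)
    assume "?ref R1 \<inter> ?ref R2 \<noteq> {}"
    then obtain R' where "R' \<in> ?ref R1" "R' \<in> ?ref R2" by blast
    then have "R' \<subseteq> R1" "R' \<subseteq> R2" "R' \<noteq> {}" using part2 that by metis+
    then show False using disjointD[OF dis that] by blast
  qed
  have dis': "disjoint \<R>'"
  proof (rule disjointI)
    fix R1 R2 assume "R1 \<in> \<R>'" "R2 \<in> \<R>'" "R1 \<noteq> R2"
    then obtain S1 S2 where S: "S1 \<in> \<R>" "R1 \<in> ?ref S1" "S2 \<in> \<R>" "R2 \<in> ?ref S2" "R1 \<noteq> R2"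
      unfolding \<R>'_def by blast
    show "R1 \<inter> R2 = {}"
    proof (cases "S1 = S2")
      case True
      then show ?thesis using part3[OF S(1)] S by metis
    next
      case False
      have "R1 \<subseteq> S1" "R2 \<subseteq> S2" using part2 S by metis+
      then show ?thesis using disjointD[OF dis S(1,3) False] by blast
    qed
  qed
  have rb': "rect_blocks (Suc e) R'" if R': "R' \<in> \<R>'" for R'
  proof -
    obtain R where R: "R \<in> \<R>" "R' \<in> ?ref R" using R' unfolding \<R>'_def by blast
    show ?thesis unfolding d_def[symmetric]
      using J[OF R(1)] lu[OF R(1)] R(2) d d_def
      by (intro refine_rect_blocks[of R "J R" e d "l R" "u R" R']) auto
  qed
  define h where "h w R y = cnj (chr d (w R) y) * spec c R y" for w :: "(nat \<Rightarrow> nat) set \<Rightarrow> nat" and R y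
  let ?Q = "\<lambda>w x. sqrt (F.cond_square (h w) \<R> x)"
  let ?l = "\<lambda>R. l R - 1"
  have cs: "F.cond_square (h w) \<R> x = (\<Sum>R\<in>\<R>. \<Sum>m<N. increment d m (h w R) x)" for w x
    by (simp add: F.cond_square_def increment_def)
  have cs0: "0 \<le> F.cond_square (h w) \<R> x" if "x \<in> X" for w x
    unfolding cs using that by (intro sum_nonneg increment_nonneg)
  have pt: "square_fn c \<R>' x \<le> sqrt (real B) * (?Q ?l x + ?Q u x)" if x: "x \<in> X" for x
  proof -
    have "(square_fn c \<R>' x)\<^sup>2 = (\<Sum>R\<in>\<R>. \<Sum>R'\<in>?ref R. (norm (spec c R' x))\<^sup>2)"
      unfolding square_fn_power2 \<R>'_def using fin finref disref by (intro sum.UNION_disjoint) auto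
    also have "\<dots> \<le> (\<Sum>R\<in>\<R>. real B * ((\<Sum>m<N. increment d m (h ?l R) x) + (\<Sum>m<N. increment d m (h u R) x)))"
      unfolding h_def using lu inlu box d x by (intro sum_mono refine_energy) auto
    also have "\<dots> = real B * (F.cond_square (h ?l) \<R> x + F.cond_square (h u) \<R> x)"
      unfolding cs by (simp add: sum_distrib_left[symmetric] sum.distrib)
    finally have "square_fn c \<R>' x \<le> sqrt (real B * (F.cond_square (h ?l) \<R> x + F.cond_square (h u) \<R> x))"
      by (rule real_le_rsqrt)
    also have "\<dots> \<le> sqrt (real B) * (?Q ?l x + ?Q u x)"
      unfolding real_sqrt_mult using cs0[OF x]
      by (intro mult_left_mono sqrt_add_le_add_sqrt) auto
    finally show ?thesis .
  qed
  have weak: "(\<Sum>x\<in>X. ?Q w x powr p) \<le> 2 * (1 + (real B)\<^sup>2) * layer_const p * (\<Sum>x\<in>X. square_fn c \<R> x powr p)" for w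
  proof (rule sum_powr_le_of_weak)
    show "real (card {x\<in>X. t < ?Q w x}) \<le> 2 * (1 + (real B)\<^sup>2) * (\<Sum>x\<in>X. weak_bound t (square_fn c \<R> x))" if "0 < t" for t
      using F.weak_cond_square[OF fin that, of "h w"] by (simp add: h_def norm_mult square_fn_def)
  qed (use p cs0 square_fn_nonneg in auto)
  have "(\<Sum>x\<in>X. square_fn c \<R>' x powr p)
      \<le> (\<Sum>x\<in>X. (2 * sqrt (real B)) powr p * (?Q ?l x powr p + ?Q u x powr p))"
  proof (rule sum_mono)
    fix x assume x: "x \<in> X"
    have "square_fn c \<R>' x powr p \<le> (sqrt (real B) * (?Q ?l x + ?Q u x)) powr p"
      using pt[OF x] p square_fn_nonneg by (intro powr_mono2) auto
    also have "\<dots> = sqrt (real B) powr p * (?Q ?l x + ?Q u x) powr p"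
      by (rule powr_mult)
    also have "\<dots> \<le> sqrt (real B) powr p * (2 powr p * (?Q ?l x powr p + ?Q u x powr p))"
      using cs0[OF x] p by (intro mult_left_mono powr_add_le) auto
    also have "\<dots> = (2 * sqrt (real B)) powr p * (?Q ?l x powr p + ?Q u x powr p)"
      by (simp add: powr_mult)
    finally show "square_fn c \<R>' x powr p \<le> (2 * sqrt (real B)) powr p * (?Q ?l x powr p + ?Q u x powr p)" .
  qed
  also have "\<dots> = (2 * sqrt (real B)) powr p * ((\<Sum>x\<in>X. ?Q ?l x powr p) + (\<Sum>x\<in>X. ?Q u x powr p))"
    by (simp only: sum_distrib_left[symmetric] sum.distrib)
  also have "\<dots> \<le> (2 * sqrt (real B)) powr p *
      (2 * (1 + (real B)\<^sup>2) * layer_const p * (\<Sum>x\<in>X. square_fn c \<R> x powr p)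
       + 2 * (1 + (real B)\<^sup>2) * layer_const p * (\<Sum>x\<in>X. square_fn c \<R> x powr p))"
    by (intro mult_left_mono add_mono weak) auto
  also have "\<dots> = refine_const B p * (\<Sum>x\<in>X. square_fn c \<R> x powr p)"
    by (simp add: refine_const_def algebra_simps)
  finally have ineq: "(\<Sum>x\<in>X. square_fn c \<R>' x powr p) \<le> refine_const B p * (\<Sum>x\<in>X. square_fn c \<R> x powr p)" .
  have "finite \<R>'" unfolding \<R>'_def using fin finref by blast
  moreover have "\<Union>\<R>' = \<Union>\<R>" unfolding \<R>'_def using part1 by blast
  ultimately show ?thesis using rb' dis' ineq by (intro exI[of _ "\<R>'"] conjI ballI)
qed

lemma refine_all:
  assumes p: "1 < p" "p < 2" and e: "e \<le> D"
    and fin: "finite \<R>" and rb: "\<And>R. R \<in> \<R> \<Longrightarrow> rect_blocks 0 R" and dis: "disjoint \<R>"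
  shows "\<exists>\<R>'. finite \<R>' \<and> (\<forall>R\<in>\<R>'. rect_blocks e R) \<and> disjoint \<R>' \<and> \<Union>\<R>' = \<Union>\<R>
    \<and> (\<Sum>x\<in>X. square_fn c \<R>' x powr p) \<le> refine_const B p ^ e * (\<Sum>x\<in>X. square_fn c \<R> x powr p)"
  using e
proof (induction e)
  case 0
  then show ?case using fin rb dis by (intro exI[of _ \<R>]) auto
next
  case (Suc e)
  have c0: "0 \<le> refine_const B p" using layer_const_pos[OF p] by (simp add: refine_const_def)
  obtain \<R>1 where 1: "finite \<R>1" "\<forall>R\<in>\<R>1. rect_blocks e R" "disjoint \<R>1" "\<Union>\<R>1 = \<Union>\<R>"
    "(\<Sum>x\<in>X. square_fn c \<R>1 x powr p) \<le> refine_const B p ^ e * (\<Sum>x\<in>X. square_fn c \<R> x powr p)"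
    using Suc by auto
  have ex: "\<exists>\<R>2. finite \<R>2 \<and> (\<forall>R\<in>\<R>2. rect_blocks (Suc e) R) \<and> disjoint \<R>2 \<and> \<Union>\<R>2 = \<Union>\<R>1
    \<and> (\<Sum>x\<in>X. square_fn c \<R>2 x powr p) \<le> refine_const B p * (\<Sum>x\<in>X. square_fn c \<R>1 x powr p)"
    by (rule refine_step[OF p Suc.prems 1(1) _ 1(3)]) (rule bspec[OF 1(2)])
  then obtain \<R>2 where 2: "finite \<R>2" "\<forall>R\<in>\<R>2. rect_blocks (Suc e) R" "disjoint \<R>2" "\<Union>\<R>2 = \<Union>\<R>1"
    "(\<Sum>x\<in>X. square_fn c \<R>2 x powr p) \<le> refine_const B p * (\<Sum>x\<in>X. square_fn c \<R>1 x powr p)"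
    by (elim exE conjE) (rule that)
  have "(\<Sum>x\<in>X. square_fn c \<R>2 x powr p) \<le> refine_const B p * (refine_const B p ^ e * (\<Sum>x\<in>X. square_fn c \<R> x powr p))"
    by (rule order_trans[OF 2(5) mult_left_mono[OF 1(5) c0]])
  with 1 2 show ?case by (intro exI[of _ \<R>2]) (auto simp: mult.assoc)
qed

end

section \<open>Disjoint blocks\<close>

text \<open>Each direction costs the constant of the weak maximal inequality and halves the level.\<close>

primrec maximal_const :: "nat \<Rightarrow> real \<Rightarrow> real" where
  "maximal_const 0 \<gamma> = 1"
| "maximal_const (Suc e) \<gamma> = 2 / \<gamma> * maximal_const e (\<gamma> / 2)"

lemma maximal_const_nonneg: "0 < \<gamma> \<Longrightarrow> 0 \<le> maximal_const e \<gamma>"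
  by (induction e arbitrary: \<gamma>) auto

definition block_const :: "nat \<Rightarrow> real" where
  "block_const D = maximal_const D (1 / 2) + 2"

lemma orthogonal_sum_norm:
  fixes g :: "'i \<Rightarrow> 'a \<Rightarrow> complex"
  assumes I: "finite I"
    and orth: "\<And>i j. i \<in> I \<Longrightarrow> j \<in> I \<Longrightarrow> i \<noteq> j \<Longrightarrow> (\<Sum>x\<in>Y. g i x * cnj (g j x)) = 0"
  shows "(\<Sum>x\<in>Y. (norm (\<Sum>i\<in>I. g i x))\<^sup>2) = (\<Sum>i\<in>I. \<Sum>x\<in>Y. (norm (g i x))\<^sup>2)"
proof -
  have "complex_of_real (\<Sum>x\<in>Y. (norm (\<Sum>i\<in>I. g i x))\<^sup>2) = (\<Sum>x\<in>Y. \<Sum>i\<in>I. \<Sum>j\<in>I. g i x * cnj (g j x))"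
    by (simp only: of_real_sum complex_norm_square cnj_sum sum_product)
  also have "\<dots> = (\<Sum>i\<in>I. \<Sum>j\<in>I. \<Sum>x\<in>Y. g i x * cnj (g j x))"
    by (simp only: sum.swap[of _ _ Y])
  also have "\<dots> = (\<Sum>i\<in>I. \<Sum>j\<in>I. if j = i then \<Sum>x\<in>Y. g i x * cnj (g i x) else 0)"
    by (intro sum.cong refl) (auto simp: orth)
  also have "\<dots> = (\<Sum>i\<in>I. \<Sum>x\<in>Y. g i x * cnj (g i x))"
    using I by (simp add: sum.delta)
  also have "\<dots> = complex_of_real (\<Sum>i\<in>I. \<Sum>x\<in>Y. (norm (g i x))\<^sup>2)"
    by (simp only: of_real_sum complex_norm_square)
  finally show ?thesis by (simp only: of_real_eq_iff)
qed

context vilenkin_grid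
begin

text \<open>The coordinates that determine the cell dual to a block with sides \<open>P d (lv d)\<close>, where directions
  beyond the first \<open>e\<close> are not averaged.\<close>

definition coarse :: "nat \<Rightarrow> (nat \<Rightarrow> nat) \<Rightarrow> (nat \<times> nat) set" where
  "coarse e lv = {(d, k). d \<in> {1..e} \<longrightarrow> k \<le> lv d}"

text \<open>This contains all cells that \<open>\<Omega>\<close> fills to a proportion above \<open>\<gamma>\<close>, and is defined by one
  one-dimensional maximal function after the other.\<close>

primrec enlarge :: "(nat \<times> nat \<Rightarrow> nat) set \<Rightarrow> nat \<Rightarrow> real \<Rightarrow> (nat \<times> nat \<Rightarrow> nat) set" where
  "enlarge \<Omega> 0 \<gamma> = \<Omega>"
| "enlarge \<Omega> (Suc e) \<gamma> = {x\<in>X. \<exists>m\<le>N. \<gamma> / 2 < avg (dir (Suc e) m) (indicat_real (enlarge \<Omega> e (\<gamma> / 2))) x}"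

lemma enlarge_subset: "\<Omega> \<subseteq> X \<Longrightarrow> enlarge \<Omega> e \<gamma> \<subseteq> X"
  by (cases e) auto

lemma card_enlarge:
  assumes "\<Omega> \<subseteq> X" "e \<le> D" "0 < \<gamma>"
  shows "real (card (enlarge \<Omega> e \<gamma>)) \<le> maximal_const e \<gamma> * real (card \<Omega>)"
  using assms(2,3)
proof (induction e arbitrary: \<gamma>)
  case (Suc e)
  let ?O = "enlarge \<Omega> e (\<gamma> / 2)"
  have OX: "?O \<subseteq> X" by (rule enlarge_subset[OF assms(1)])
  interpret F: coordinate_filtration coords "\<lambda>s. b (fst s) (snd s)" "dir (Suc e)" N B
    using Suc.prems by (intro coordinate_filtration_dir) auto
  have "\<gamma> / 2 * real (card (enlarge \<Omega> (Suc e) \<gamma>)) \<le> (\<Sum>x\<in>X. indicat_real ?O x)"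
    unfolding enlarge.simps by (intro F.weak_maximal) auto
  also have "\<dots> = real (card ?O)" 
  proof -
    have "(\<Sum>x\<in>X. indicat_real ?O x) = (\<Sum>x\<in>?O. 1)"
      using OX by (intro sum.mono_neutral_cong_right) auto
    then show ?thesis by simp
  qed
  also have "\<dots> \<le> maximal_const e (\<gamma> / 2) * real (card \<Omega>)" using Suc by auto
  finally show ?case using Suc.prems by (simp add: field_simps)
qed simp

text \<open>If an average over the last direction of a function with values in \<open>{0..1}\<close> exceeds \<open>\<gamma>\<close>, then this
  function exceeds \<open>\<gamma> / 2\<close> on a proportion of more than \<open>\<gamma> / 2\<close>. So one direction can be treated at a
  time.\<close>

lemma in_enlarge:
  assumes \<Omega>: "\<Omega> \<subseteq> X" and lv: "\<And>d. d \<in> {1..D} \<Longrightarrow> lv d \<le> N"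
    and "e \<le> D" "0 < \<gamma>" "x \<in> X" "\<gamma> < avg (coarse e lv) (indicat_real \<Omega>) x"
  shows "x \<in> enlarge \<Omega> e \<gamma>"
  using assms(3-)
proof (induction e arbitrary: \<gamma> x)
  case 0
  have "coarse 0 lv = UNIV" by (simp add: coarse_def)
  then have "avg (coarse 0 lv) (indicat_real \<Omega>) x = indicat_real \<Omega> x" using 0 by (intro avg_all) auto
  with 0(4) have "\<gamma> < indicat_real \<Omega> x" by simp
  with 0(2) show ?case by (cases "x \<in> \<Omega>") auto
next
  case (Suc e)
  let ?m = "lv (Suc e)" and ?u = "avg (coarse e lv) (indicat_real \<Omega>)" and ?O = "enlarge \<Omega> e (\<gamma> / 2)"
  have "dir (Suc e) ?m \<inter> coarse e lv = coarse (Suc e) lv"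
    by (auto simp: dir_def coarse_def le_Suc_eq)
  then have "avg (coarse (Suc e) lv) (indicat_real \<Omega>) x = avg (dir (Suc e) ?m) ?u x"
    by (simp only: avg_avg)
  also have "\<dots> \<le> avg (dir (Suc e) ?m) (\<lambda>y. indicat_real ?O y + \<gamma> / 2) x"
  proof (rule avg_mono[OF Suc.prems(3)])
    fix y assume y: "y \<in> X"
    show "?u y \<le> indicat_real ?O y + \<gamma> / 2"
    proof (cases "\<gamma> / 2 < ?u y")
      case True
      then have "y \<in> ?O" using Suc y by auto
      moreover have "?u y \<le> avg (coarse e lv) (\<lambda>_. 1) y" using y by (intro avg_mono) auto
      ultimately show ?thesis using Suc.prems by (simp add: avg_const)
    next
      case False
      then show ?thesis by (simp add: indicator_def)
    qed
  qed
  also have "\<dots> = avg (dir (Suc e) ?m) (indicat_real ?O) x + \<gamma> / 2" by (simp only: avg_add avg_const)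
  finally have "\<gamma> / 2 < avg (dir (Suc e) ?m) (indicat_real ?O) x" using Suc.prems by simp
  moreover have "?m \<le> N" using Suc.prems by (intro lv) auto
  ultimately show ?case using Suc.prems(3) by auto
qed

text \<open>The weight \<open>u\<close> will be a product of indicators of unions of cells. The sum over a digit that \<open>u\<close> does
  not see and that separates two frequencies vanishes.\<close>

lemma orthogonal_spec:
  assumes R: "R \<subseteq> box" "R' \<subseteq> box"
    and ex: "\<And>n n'. n \<in> R \<Longrightarrow> n' \<in> R' \<Longrightarrow> \<exists>d\<in>{1..D}. \<exists>k\<in>{1..N}. digit d (n d) k \<noteq> digit d (n' d) k
      \<and> (\<forall>x\<in>X. u (rot (d, k) x) = u x)"
  shows "(\<Sum>x\<in>X. u x * spec c R x * cnj (spec c R' x)) = 0"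
proof -
  have "(\<Sum>x\<in>X. u x * spec c R x * cnj (spec c R' x))
      = (\<Sum>x\<in>X. \<Sum>n\<in>R. \<Sum>n'\<in>R'. c n * cnj (c n') * (u x * chi n x * cnj (chi n' x)))"
    by (simp add: spec_def cnj_sum sum_distrib_left sum_distrib_right mult_ac)
  also have "\<dots> = (\<Sum>n\<in>R. \<Sum>n'\<in>R'. \<Sum>x\<in>X. c n * cnj (c n') * (u x * chi n x * cnj (chi n' x)))"
    by (simp only: sum.swap[of _ _ X])
  also have "\<dots> = (\<Sum>n\<in>R. \<Sum>n'\<in>R'. c n * cnj (c n') * (\<Sum>x\<in>X. u x * chi n x * cnj (chi n' x)))"
    by (simp only: sum_distrib_left)
  also have "\<dots> = 0"
  proof (intro sum.neutral ballI)
    fix n n' assume "n \<in> R" "n' \<in> R'"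
    from ex[OF this] obtain d k where dk: "d \<in> {1..D}" "k \<in> {1..N}" "digit d (n d) k \<noteq> digit d (n' d) k"
      "\<forall>x\<in>X. u (rot (d, k) x) = u x" by auto
    have "(\<Sum>x\<in>X. u x * chi n x * cnj (chi n' x)) = 0"
      by (rule orthogonal_chi[where n = n and n' = n' and d = d and k = k]) (use dk in auto)
    then show "c n * cnj (c n') * (\<Sum>x\<in>X. u x * chi n x * cnj (chi n' x)) = 0" by simp
  qed
  finally show ?thesis .
qed

text \<open>On a block, all characters agree up to factors that depend on the digits of coarse
  scales only, so the modulus does not see the finer digits.\<close>

lemma dep_norm_block:
  assumes R: "R = (\<Pi>\<^sub>E d\<in>{1..D}. J d)" and J: "\<And>d. d \<in> {1..D} \<Longrightarrow> J d = {t. t div P d (lv d) = q d}"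
  shows "dep (coarse D lv) (\<lambda>x. norm (spec c R x))"
proof (cases "R = {}")
  case True
  then show ?thesis by (simp add: spec_def dep_def)
next
  case False
  then obtain n0 where n0: "n0 \<in> R" by blast
  have "dep (coarse D lv) (\<lambda>x. \<Sum>n\<in>R. c n * (cnj (chi n0 x) * chi n x))"
  proof (rule dep_sum)
    fix n assume n: "n \<in> R"
    have eq: "(\<lambda>x. cnj (chi n0 x) * chi n x) = (\<lambda>x. \<Prod>d=1..D. cnj (chr d (n0 d) x) * chr d (n d) x)"
      by (simp add: chi_def prod.distrib fun_eq_iff)
    have "dep (coarse D lv) (\<lambda>x. cnj (chi n0 x) * chi n x)"
      unfolding eq
    proof (rule dep_prod)
      fix d assume d: "d \<in> {1..D}"
      have "n d \<in> J d" "n0 d \<in> J d" using PiE_mem[OF n[unfolded R] d] PiE_mem[OF n0[unfolded R] d] .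
      then have "n d div P d (lv d) = n0 d div P d (lv d)" using J[OF d] by simp
      then show "dep (coarse D lv) (\<lambda>x. cnj (chr d (n0 d) x) * chr d (n d) x)"
        by (rule dep_mono[OF dep_chr_quotient]) (use d in \<open>auto simp: coarse_def\<close>)
    qed
    then show "dep (coarse D lv) (\<lambda>x. c n * (cnj (chi n0 x) * chi n x))" by (rule dep_comp)
  qed
  then have "dep (coarse D lv) (\<lambda>x. norm (\<Sum>n\<in>R. c n * (cnj (chi n0 x) * chi n x)))" by (rule dep_comp)
  moreover have "norm (\<Sum>n\<in>R. c n * (cnj (chi n0 x) * chi n x)) = norm (spec c R x)" for x
  proof -
    have "(\<Sum>n\<in>R. c n * (cnj (chi n0 x) * chi n x)) = cnj (chi n0 x) * spec c R x"
      by (simp add: spec_def sum_distrib_left mult.left_commute)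
    then show ?thesis by (simp add: norm_mult)
  qed
  ultimately show ?thesis by simp
qed

text \<open>Disjoint blocks are already separated by a digit beyond both of their levels, hence by a digit on
  which neither of the two systems of dual cells depends.\<close>

lemma separating_digit:
  assumes d: "d \<in> {1..D}" and n: "n < P d N" "n' < P d N" and m: "m \<le> N" "m' \<le> N"
    and J: "n div P d m = q" "n' div P d m' = q'"
    and dis: "{t. t div P d m = q} \<inter> {t. t div P d m' = q'} = {}"
  shows "\<exists>k\<in>{1..N}. m < k \<and> m' < k \<and> digit d n k \<noteq> digit d n' k"
proof -
  have neq: "n div P d (max m m') \<noteq> n' div P d (max m m')"
  proof
    assume e: "n div P d (max m m') = n' div P d (max m m')"
    show False
    proof (cases "m \<le> m'")
      case True
      then have "n div P d m' = q'" using e J by (simp add: max_def)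
      with J dis show False by blast
    next
      case False
      then have "n' div P d m = q" using e J by (simp add: max_def)
      with J dis show False by blast
    qed
  qed
  obtain k where "k \<in> {Suc (max m m')..N}" "digit d n k \<noteq> digit d n' k"
    using digit_neq[OF n neq] m by auto
  then show ?thesis by (intro bexI[of _ k]) auto
qed

text \<open>Here \<open>g R\<close> is the indicator of the cells of \<open>R\<close> that are kept, those filled by \<open>\<Omega>\<close> to at most one half.
  Outside \<open>enlarge \<Omega> D (1 / 2)\<close> nothing is discarded.\<close>

lemma blocks_weak:
  assumes fin: "finite \<R>" and rb: "\<And>R. R \<in> \<R> \<Longrightarrow> rect_blocks D R" and dis: "disjoint \<R>" and l: "0 < l"
  shows "real (card {x\<in>X. l < norm (spec c (\<Union>\<R>) x)}) \<le> block_const D * (\<Sum>x\<in>X. weak_bound l (square_fn c \<R> x))"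
proof -
  have "\<forall>R\<in>\<R>. \<exists>T. R = (\<Pi>\<^sub>E d\<in>{1..D}. fst T d)
      \<and> (\<forall>d\<in>{1..D}. fst (snd T d) \<le> N \<and> fst T d = {t. t div P d (fst (snd T d)) = snd (snd T d)})"
  proof
    fix R assume "R \<in> \<R>"
    from rb[OF this] obtain J where J: "R = (\<Pi>\<^sub>E d\<in>{1..D}. J d)"
      "\<forall>d\<in>{1..D}. \<exists>m\<le>N. \<exists>q. J d = {t. t div P d m = q}"
      unfolding rect_blocks_def by blast
    have "\<forall>d\<in>{1..D}. \<exists>mq. fst mq \<le> N \<and> J d = {t. t div P d (fst mq) = snd mq}"
      using J(2) by fastforce
    from bchoice[OF this] obtain mq where "\<forall>d\<in>{1..D}. fst (mq d) \<le> N \<and> J d = {t. t div P d (fst (mq d)) = snd (mq d)}" ..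
    with J(1) show "\<exists>T. R = (\<Pi>\<^sub>E d\<in>{1..D}. fst T d)
      \<and> (\<forall>d\<in>{1..D}. fst (snd T d) \<le> N \<and> fst T d = {t. t div P d (fst (snd T d)) = snd (snd T d)})"
      by (intro exI[of _ "(J, mq)"]) (simp only: fst_conv snd_conv)
  qed
  from bchoice[OF this] obtain T where T: "\<forall>R\<in>\<R>. R = (\<Pi>\<^sub>E d\<in>{1..D}. fst (T R) d)
      \<and> (\<forall>d\<in>{1..D}. fst (snd (T R) d) \<le> N \<and> fst (T R) d = {t. t div P d (fst (snd (T R) d)) = snd (snd (T R) d)})" ..
  define J lv q where "J R = fst (T R)" and "lv R d = fst (snd (T R) d)" and "q R d = snd (snd (T R) d)" for R d
  have RJ: "R = (\<Pi>\<^sub>E d\<in>{1..D}. J R d)" if "R \<in> \<R>" for R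
    using bspec[OF T that] unfolding J_def by (rule conjunct1)
  have lv: "lv R d \<le> N" and J: "J R d = {t. t div P d (lv R d) = q R d}" if "R \<in> \<R>" "d \<in> {1..D}" for R d
    using bspec[OF conjunct2[OF bspec[OF T that(1)]] that(2)] unfolding J_def lv_def q_def by (rule conjunct1, rule conjunct2)
  have box: "R \<subseteq> box" if "R \<in> \<R>" for R using rb[OF that] by (rule rect_blocks_subset)
  have finR: "finite R" if "R \<in> \<R>" for R using rb[OF that] by (rule rect_blocks_finite)
  let ?f = "\<lambda>R. spec c R" and ?F = "square_fn c \<R>"
  define \<Omega> where "\<Omega> = {x\<in>X. l < ?F x}"
  define g where "g R x = (of_bool (avg (coarse D (lv R)) (indicat_real \<Omega>) x \<le> 1 / 2) :: real)" for R x
  define good where "good x = (\<Sum>R\<in>\<R>. complex_of_real (g R x) * ?f R x)" for x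
  let ?O = "enlarge \<Omega> D (1 / 2)"
  have \<Omega>X: "\<Omega> \<subseteq> X" by (auto simp: \<Omega>_def)
  have dep_g: "dep (coarse D (lv R)) (g R)" for R
    unfolding g_def by (rule dep_comp[OF dep_avg])
  have g01: "0 \<le> g R x" "g R x \<le> 1" "(g R x)\<^sup>2 = g R x" for R x by (auto simp: g_def)
  have F0: "0 \<le> ?F x" for x by (rule square_fn_nonneg)
  have split: "spec c (\<Union>\<R>) x = (\<Sum>R\<in>\<R>. ?f R x)" for x
    unfolding spec_def using finR dis by (subst sum.Union_disjoint_sets) (auto simp: o_def)
  have good_eq: "good x = spec c (\<Union>\<R>) x" if x: "x \<in> X" "x \<notin> ?O" for x
  proof -
    have "g R x = 1" if R: "R \<in> \<R>" for R
    proof -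
      have "\<not> 1 / 2 < avg (coarse D (lv R)) (indicat_real \<Omega>) x"
        using in_enlarge[OF \<Omega>X lv[OF R], where e = D and \<gamma> = "1 / 2" and x = x] x by auto
      then show ?thesis by (simp add: g_def)
    qed
    then show ?thesis by (simp add: good_def split)
  qed
  have orth: "(\<Sum>x\<in>X. (complex_of_real (g R x) * ?f R x) * cnj (complex_of_real (g R' x) * ?f R' x)) = 0"
    if R: "R \<in> \<R>" "R' \<in> \<R>" "R \<noteq> R'" for R R'
  proof -
    have "R \<inter> R' = {}" using disjointD[OF dis R] .
    then have "(\<Pi>\<^sub>E d\<in>{1..D}. J R d \<inter> J R' d) = {}"
      using RJ[OF R(1)] RJ[OF R(2)] PiE_Int[of "{1..D}" "J R" "J R'"] by simp
    then obtain d where d: "d \<in> {1..D}" "J R d \<inter> J R' d = {}" unfolding PiE_eq_empty_iff by blast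
    have "(\<Sum>x\<in>X. (complex_of_real (g R x) * complex_of_real (g R' x)) * ?f R x * cnj (?f R' x)) = 0"
    proof (rule orthogonal_spec[OF box[OF R(1)] box[OF R(2)]])
      fix n n' assume n: "n \<in> R" "n' \<in> R'"
      have "n d \<in> J R d" "n' d \<in> J R' d" using n RJ R d(1) PiE_mem by metis+
      then have nd: "n d div P d (lv R d) = q R d" "n' d div P d (lv R' d) = q R' d"
        using J[OF R(1) d(1)] J[OF R(2) d(1)] by auto
      have lt: "n d < P d N" "n' d < P d N"
        using box_less[OF subsetD[OF box[OF R(1)] n(1)] d(1)] box_less[OF subsetD[OF box[OF R(2)] n(2)] d(1)] .
      have "{t. t div P d (lv R d) = q R d} \<inter> {t. t div P d (lv R' d) = q R' d} = {}"
        using d(2) J[OF R(1) d(1)] J[OF R(2) d(1)] by simp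
      from separating_digit[OF d(1) lt lv[OF R(1) d(1)] lv[OF R(2) d(1)] nd this]
      obtain k where k: "k \<in> {1..N}" "lv R d < k" "lv R' d < k" "digit d (n d) k \<noteq> digit d (n' d) k" by blast
      have out: "(d, k) \<notin> coarse D (lv R)" "(d, k) \<notin> coarse D (lv R')" using d(1) k by (auto simp: coarse_def)
      have "g R (rot (d, k) x) = g R x" "g R' (rot (d, k) x) = g R' x" if "x \<in> X" for x
        using dep_rot[OF dep_g out(1) coordsI[OF d(1) k(1)] that] dep_rot[OF dep_g out(2) coordsI[OF d(1) k(1)] that] .
      with d(1) k show "\<exists>d\<in>{1..D}. \<exists>k\<in>{1..N}. digit d (n d) k \<noteq> digit d (n' d) k
        \<and> (\<forall>x\<in>X. complex_of_real (g R (rot (d, k) x)) * complex_of_real (g R' (rot (d, k) x))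
             = complex_of_real (g R x) * complex_of_real (g R' x))"
        by (intro bexI[of _ d] bexI[of _ k]) auto
    qed
    then show ?thesis by (simp add: mult_ac)
  qed
  have half: "(\<Sum>x\<in>X. g R x * (norm (?f R x))\<^sup>2) \<le> 2 * (\<Sum>x\<in>X. (norm (?f R x))\<^sup>2 * of_bool (?F x \<le> l))"
    if R: "R \<in> \<R>" for R
  proof -
    \<comment> \<open>\<open>?h\<close> is constant on cells, and on a kept cell the average of \<open>?k\<close> is at least one half.\<close>
    let ?h = "\<lambda>x. g R x * (norm (?f R x))\<^sup>2" and ?k = "\<lambda>x. 1 - indicat_real \<Omega> x"
    have "dep (coarse D (lv R)) (\<lambda>x. norm (?f R x))"
      by (rule dep_norm_block[OF RJ[OF R]]) (rule J[OF R])
    then have dh: "dep (coarse D (lv R)) ?h" by (intro dep_mult dep_g dep_comp[where k = "\<lambda>t. t\<^sup>2"])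
    have "(\<Sum>x\<in>X. ?h x) \<le> (\<Sum>x\<in>X. 2 * (?h x * avg (coarse D (lv R)) ?k x))"
    proof (rule sum_mono)
      fix x assume "x \<in> X"
      show "?h x \<le> 2 * (?h x * avg (coarse D (lv R)) ?k x)"
      proof (cases "g R x = 0")
        case False
        then have "avg (coarse D (lv R)) (indicat_real \<Omega>) x \<le> 1 / 2" by (simp add: g_def)
        then have "1 \<le> 2 * avg (coarse D (lv R)) ?k x" by (simp add: avg_diff avg_const)
        then have "?h x * 1 \<le> ?h x * (2 * avg (coarse D (lv R)) ?k x)"
          using g01 by (intro mult_left_mono) auto
        then show ?thesis by (simp only: mult_1_right mult.left_commute)
      qed simp
    qed
    also have "\<dots> = 2 * (\<Sum>x\<in>X. ?h x * ?k x)"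
      by (simp only: sum_distrib_left[symmetric] sum_dep_avg[OF dh])
    also have "\<dots> \<le> 2 * (\<Sum>x\<in>X. (norm (?f R x))\<^sup>2 * of_bool (?F x \<le> l))"
    proof (intro mult_left_mono sum_mono)
      fix x assume x: "x \<in> X"
      have "?k x = of_bool (?F x \<le> l)" using x by (auto simp: \<Omega>_def indicator_def)
      moreover have "?h x \<le> 1 * (norm (?f R x))\<^sup>2" using g01 by (intro mult_right_mono) auto
      ultimately show "?h x * ?k x \<le> (norm (?f R x))\<^sup>2 * of_bool (?F x \<le> l)" by simp
    qed simp
    finally show ?thesis .
  qed
  have energy: "(\<Sum>x\<in>X. (norm (good x))\<^sup>2) \<le> 2 * (\<Sum>x\<in>X. (?F x)\<^sup>2 * of_bool (?F x \<le> l))"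
  proof -
    have "(\<Sum>x\<in>X. (norm (good x))\<^sup>2) = (\<Sum>R\<in>\<R>. \<Sum>x\<in>X. (norm (complex_of_real (g R x) * ?f R x))\<^sup>2)"
      unfolding good_def using orth by (intro orthogonal_sum_norm[OF fin]) auto
    also have "\<dots> = (\<Sum>R\<in>\<R>. \<Sum>x\<in>X. g R x * (norm (?f R x))\<^sup>2)"
      by (simp add: norm_mult power_mult_distrib g01)
    also have "\<dots> \<le> (\<Sum>R\<in>\<R>. 2 * (\<Sum>x\<in>X. (norm (?f R x))\<^sup>2 * of_bool (?F x \<le> l)))"
      by (intro sum_mono half)
    also have "\<dots> = 2 * (\<Sum>x\<in>X. (?F x)\<^sup>2 * of_bool (?F x \<le> l))"
      unfolding square_fn_power2 sum_distrib_left[symmetric] sum_distrib_right by (simp only: sum.swap[of _ X])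
    finally show ?thesis .
  qed
  have cheb: "real (card {x\<in>X. l < norm (good x)}) \<le> 2 * (\<Sum>x\<in>X. (?F x / l)\<^sup>2 * of_bool (?F x \<le> l))"
  proof -
    have "l\<^sup>2 * real (card {x\<in>X. l < norm (good x)}) = (\<Sum>x\<in>{x\<in>X. l < norm (good x)}. l\<^sup>2)" by simp
    also have "\<dots> \<le> (\<Sum>x\<in>{x\<in>X. l < norm (good x)}. (norm (good x))\<^sup>2)"
      using l by (intro sum_mono power_mono) auto
    also have "\<dots> \<le> (\<Sum>x\<in>X. (norm (good x))\<^sup>2)" by (intro sum_mono2) auto
    also have "\<dots> \<le> 2 * (\<Sum>x\<in>X. (?F x)\<^sup>2 * of_bool (?F x \<le> l))" by (rule energy)
    also have "\<dots> = l\<^sup>2 * (2 * (\<Sum>x\<in>X. (?F x / l)\<^sup>2 * of_bool (?F x \<le> l)))"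
      unfolding sum_distrib_left using l by (intro sum.cong) (auto simp: power_divide)
    finally show ?thesis using l by (simp only: mult_le_cancel_left_pos zero_less_power)
  qed
  have card\<Omega>: "real (card \<Omega>) \<le> (\<Sum>x\<in>X. ?F x / l * of_bool (l / 2 < ?F x))"
  proof -
    have "real (card \<Omega>) = (\<Sum>x\<in>\<Omega>. 1)" by simp
    also have "\<dots> \<le> (\<Sum>x\<in>\<Omega>. ?F x / l * of_bool (l / 2 < ?F x))"
      using l by (intro sum_mono) (auto simp: \<Omega>_def)
    also have "\<dots> \<le> (\<Sum>x\<in>X. ?F x / l * of_bool (l / 2 < ?F x))"
      using \<Omega>X F0 l by (intro sum_mono2) auto
    finally show ?thesis .
  qed
  have mc: "0 \<le> maximal_const D (1 / 2)" by (rule maximal_const_nonneg) simp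
  have OX: "?O \<subseteq> X" by (rule enlarge_subset[OF \<Omega>X])
  have "card {x\<in>X. l < norm (spec c (\<Union>\<R>) x)} \<le> card (?O \<union> {x\<in>X. l < norm (good x)})"
    using OX good_eq by (intro card_mono) (auto intro: finite_subset[OF _ finite_X])
  also have "\<dots> \<le> card ?O + card {x\<in>X. l < norm (good x)}" by (rule card_Un_le)
  finally have "real (card {x\<in>X. l < norm (spec c (\<Union>\<R>) x)}) \<le> real (card ?O) + real (card {x\<in>X. l < norm (good x)})"
    by (simp only: of_nat_add[symmetric] of_nat_le_iff)
  also have "\<dots> \<le> maximal_const D (1 / 2) * real (card \<Omega>) + 2 * (\<Sum>x\<in>X. (?F x / l)\<^sup>2 * of_bool (?F x \<le> l))"
    by (intro add_mono cheb card_enlarge \<Omega>X) auto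
  also have "\<dots> \<le> block_const D * (\<Sum>x\<in>X. ?F x / l * of_bool (l / 2 < ?F x))
      + block_const D * (\<Sum>x\<in>X. (?F x / l)\<^sup>2 * of_bool (?F x \<le> l))"
  proof (rule add_mono)
    show "maximal_const D (1 / 2) * real (card \<Omega>) \<le> block_const D * (\<Sum>x\<in>X. ?F x / l * of_bool (l / 2 < ?F x))"
      using card\<Omega> mc by (intro mult_mono) (auto simp: block_const_def)
    show "2 * (\<Sum>x\<in>X. (?F x / l)\<^sup>2 * of_bool (?F x \<le> l)) \<le> block_const D * (\<Sum>x\<in>X. (?F x / l)\<^sup>2 * of_bool (?F x \<le> l))"
      using mc by (intro mult_right_mono sum_nonneg) (auto simp: block_const_def)
  qed
  also have "\<dots> = block_const D * (\<Sum>x\<in>X. weak_bound l (?F x))"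
    by (simp only: weak_bound_def sum.distrib distrib_left)
  finally show ?thesis .
qed

end

definition grid_const :: "nat \<Rightarrow> nat \<Rightarrow> real \<Rightarrow> real" where
  "grid_const D B p = (if p = 2 then 1 else block_const D * layer_const p * refine_const B p ^ D)"

lemma grid_const_nonneg: "1 < p \<Longrightarrow> p \<le> 2 \<Longrightarrow> 0 \<le> grid_const D B p"
  using layer_const_pos[of p] maximal_const_nonneg[of "1/2" D]
  by (auto simp: grid_const_def refine_const_def block_const_def intro!: mult_nonneg_nonneg)

context vilenkin_grid
begin

theorem grid_inequality:
  assumes p: "1 < p" "p \<le> 2" and fin: "finite \<R>" and rb: "\<And>R. R \<in> \<R> \<Longrightarrow> rect_blocks 0 R" and dis: "disjoint \<R>"
  shows "(\<Sum>x\<in>X. norm (spec c (\<Union>\<R>) x) powr p) \<le> grid_const D B p * (\<Sum>x\<in>X. square_fn c \<R> x powr p)"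
proof (cases "p = 2")
  case True
  have box: "R \<subseteq> box" if "R \<in> \<R>" for R using rb[OF that] by (rule rect_blocks_subset)
  have finR: "finite R" if "R \<in> \<R>" for R using rb[OF that] by (rule rect_blocks_finite)
  have split: "spec c (\<Union>\<R>) x = (\<Sum>R\<in>\<R>. spec c R x)" for x
    unfolding spec_def using finR dis by (subst sum.Union_disjoint_sets) (auto simp: o_def)
  have orth: "(\<Sum>x\<in>X. spec c R x * cnj (spec c R' x)) = 0" if R: "R \<in> \<R>" "R' \<in> \<R>" "R \<noteq> R'" for R R'
  proof -
    have "(\<Sum>x\<in>X. 1 * spec c R x * cnj (spec c R' x)) = 0"
    proof (rule orthogonal_spec[OF box[OF R(1)] box[OF R(2)]])
      fix n n' assume n: "n \<in> R" "n' \<in> R'"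
      then have "n \<noteq> n'" using disjointD[OF dis R] by blast
      moreover have nb: "n \<in> box" "n' \<in> box" using box R n by auto
      ultimately obtain d where d: "d \<in> {1..D}" "n d \<noteq> n' d"
        unfolding box_def using PiE_ext by metis
      obtain k where "k \<in> {Suc 0..N}" "digit d (n d) k \<noteq> digit d (n' d) k"
        using digit_neq[OF box_less[OF nb(1) d(1)] box_less[OF nb(2) d(1)], of 0] d(2) by auto
      then show "\<exists>d\<in>{1..D}. \<exists>k\<in>{1..N}. digit d (n d) k \<noteq> digit d (n' d) k \<and> (\<forall>x\<in>X. 1 = (1::complex))"
        using d(1) by (intro bexI[of _ d] bexI[of _ k]) auto
    qed
    then show ?thesis by simp
  qed
  have "(\<Sum>x\<in>X. (norm (spec c (\<Union>\<R>) x))\<^sup>2) = (\<Sum>R\<in>\<R>. \<Sum>x\<in>X. (norm (spec c R x))\<^sup>2)"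
    unfolding split using orth by (intro orthogonal_sum_norm[OF fin]) auto
  also have "\<dots> = (\<Sum>x\<in>X. (square_fn c \<R> x)\<^sup>2)"
    unfolding square_fn_power2 by (rule sum.swap)
  finally have "(\<Sum>x\<in>X. (norm (spec c (\<Union>\<R>) x))\<^sup>2) = (\<Sum>x\<in>X. (square_fn c \<R> x)\<^sup>2)" .
  then show ?thesis using True by (simp add: grid_const_def square_fn_nonneg)
next
  case False
  then have p2: "p < 2" using p by simp
  have bc: "0 \<le> block_const D" using maximal_const_nonneg[of "1/2" D] by (simp add: block_const_def)
  obtain \<R>' where *: "finite \<R>'" "\<forall>R\<in>\<R>'. rect_blocks D R" "disjoint \<R>'" "\<Union>\<R>' = \<Union>\<R>"
    "(\<Sum>x\<in>X. square_fn c \<R>' x powr p) \<le> refine_const B p ^ D * (\<Sum>x\<in>X. square_fn c \<R> x powr p)"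
  proof -
    have "\<exists>\<R>'. finite \<R>' \<and> (\<forall>R\<in>\<R>'. rect_blocks D R) \<and> disjoint \<R>' \<and> \<Union>\<R>' = \<Union>\<R>
      \<and> (\<Sum>x\<in>X. square_fn c \<R>' x powr p) \<le> refine_const B p ^ D * (\<Sum>x\<in>X. square_fn c \<R> x powr p)"
      by (rule refine_all[OF p(1) p2 order_refl fin _ dis]) (rule rb)
    then show thesis by (elim exE conjE) (rule that)
  qed
  have "(\<Sum>x\<in>X. norm (spec c (\<Union>\<R>') x) powr p) \<le> block_const D * layer_const p * (\<Sum>x\<in>X. square_fn c \<R>' x powr p)"
    by (rule sum_powr_le_of_weak[OF finite_X _ _ p(1) p2 bc])
       (use blocks_weak[OF *(1) _ *(3)] *(2) square_fn_nonneg in auto)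
  also have "\<dots> \<le> block_const D * layer_const p * (refine_const B p ^ D * (\<Sum>x\<in>X. square_fn c \<R> x powr p))"
    using bc layer_const_pos[OF p(1) p2] by (intro mult_left_mono *(5)) auto
  finally show ?thesis using False unfolding *(4) by (simp add: grid_const_def mult.assoc)
qed

end

section \<open>Digits of numbers and of points\<close>

lemma base_prod_pos:
  assumes "\<forall>k\<ge>1. 2 \<le> \<beta> k"
  shows "0 < base_prod \<beta> n"
proof -
  have "1 \<le> (2::nat) ^ n" by simp
  then show ?thesis using base_prod_ge[OF assms, of n] by linarith
qed

lemma nat_digits_partial:
  "(\<Sum>k=1..m. (n div base_prod \<beta> (k - 1) mod \<beta> k) * base_prod \<beta> (k - 1)) = n mod base_prod \<beta> m"
proof (induction m)
  case 0
  then show ?case by (simp add: base_prod_def)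
next
  case (Suc m)
  then show ?case by (simp add: base_prod_Suc mod_mult2_eq mult.commute)
qed

lemma nat_digits_eq:
  assumes b: "\<forall>k\<ge>1. 2 \<le> \<beta> k"
  shows "nat_digits \<beta> n = (\<lambda>k. if k = 0 then 0 else n div base_prod \<beta> (k - 1) mod \<beta> k)" (is "_ = ?c")
  unfolding nat_digits_def
proof (rule the1_equality[OF ex1_nat_digits[OF b]], intro conjI)
  have big: "n < base_prod \<beta> k" if "n \<le> k" for k
  proof -
    have "n < 2 ^ n" by simp
    also have "(2::nat) ^ n \<le> 2 ^ k" using that by simp
    finally show ?thesis using base_prod_ge[OF b, of k] by linarith
  qed
  have z: "\<forall>k>n. ?c k = 0"
  proof (intro allI impI)
    fix k assume "n < k"
    then have "n < base_prod \<beta> (k - 1)" by (intro big) simp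
    then show "?c k = 0" by simp
  qed
  show "?c 0 = 0" by simp
  show "\<forall>k\<ge>1. ?c k < \<beta> k"
  proof (intro allI impI)
    fix k :: nat assume k: "1 \<le> k"
    then have "0 < \<beta> k" using b by (metis not_numeral_le_zero gr0I)
    then show "?c k < \<beta> k" using k by simp
  qed
  show fin: "finite {k. ?c k \<noteq> 0}"
  proof (rule finite_subset)
    show "{k. ?c k \<noteq> 0} \<subseteq> {..n}" using z by (intro subsetI) (metis (mono_tags, lifting) atMost_iff mem_Collect_eq not_le)
  qed simp
  have "(\<Sum>k | ?c k \<noteq> 0. ?c k * base_prod \<beta> (k - 1)) = (\<Sum>k=1..n. ?c k * base_prod \<beta> (k - 1))"
    by (rule nat_expansion_sum[OF fin _ z]) simp
  also have "\<dots> = (\<Sum>k=1..n. (n div base_prod \<beta> (k - 1) mod \<beta> k) * base_prod \<beta> (k - 1))"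
    by (intro sum.cong) auto
  also have "\<dots> = n" unfolding nat_digits_partial using big[of n] by simp
  finally show "n = (\<Sum>k | ?c k \<noteq> 0. ?c k * base_prod \<beta> (k - 1))" ..
qed

text \<open>Two expansions of one number differ only if it is a multiple of some \<open>1 / base_prod \<beta> k\<close>.
  Away from these points the digits are read off from integer parts, whichever of the
  expansions is selected as canonical.\<close>

lemma real_digits_floor:
  assumes b: "\<forall>k\<ge>1. 2 \<le> \<beta> k" and t: "0 \<le> t" "t < 1" and k: "1 \<le> k"
    and nonint: "\<And>j::nat. t * real (base_prod \<beta> k) \<noteq> real j"
  shows "real_digits \<beta> t k = nat \<lfloor>t * real (base_prod \<beta> k)\<rfloor> mod \<beta> k"
proof -
  define c where "c = real_digits \<beta> t"
  have c: "real_digit_expansion \<beta> t c"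
    using theI'[OF ex1_real_digits[OF b t]] unfolding c_def real_digits_def by blast
  have P: "0 < real (base_prod \<beta> n)" for n using base_prod_pos[OF b] by simp
  have bpos: "0 < \<beta> (Suc n)" for n using b by (metis One_nat_def le_add1 not_gr0 not_numeral_le_zero plus_1_eq_Suc)
  have cb: "c (Suc n) < \<beta> (Suc n)" for n using c unfolding real_digit_expansion_def by auto
  define V where "V = rec_nat 0 (\<lambda>i v. v * \<beta> (Suc i) + c (Suc i))"
  have V: "V 0 = 0" "V (Suc i) = V i * \<beta> (Suc i) + c (Suc i)" for i by (simp_all add: V_def)
  let ?u = "\<lambda>i. real (c (Suc i)) / real (base_prod \<beta> (Suc i))"
  have part: "(\<Sum>i<n. ?u i) = real (V n) / real (base_prod \<beta> n)" for n
  proof (induction n)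
    case (Suc n)
    then show ?case using P[of n] bpos[of n] by (simp add: V base_prod_Suc field_simps)
  qed (simp add: V)
  have us: "?u sums t" using c unfolding real_digit_expansion_def by blast
  have tail: "(\<lambda>i. ?u (i + k)) sums (t - real (V k) / real (base_prod \<beta> k))"
    using sums_split_initial_segment[OF us, of k] unfolding part .
  have lo: "0 \<le> t - real (V k) / real (base_prod \<beta> k)"
    by (rule sums_le[OF _ sums_zero tail]) simp
  have hi: "t - real (V k) / real (base_prod \<beta> k) \<le> 1 / real (base_prod \<beta> k)"
  proof (rule sums_le[OF _ tail tail_sums[OF b, of k]])
    fix i
    have "real (c (Suc (i + k))) \<le> real (\<beta> (Suc (i + k))) - 1" using cb[of "i + k"] by linarith
    then show "?u (i + k) \<le> (real (\<beta> (Suc (i + k))) - 1) / real (base_prod \<beta> (Suc (i + k)))"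
      using P by (intro divide_right_mono) auto
  qed
  have "real (V k) \<le> t * real (base_prod \<beta> k)" "t * real (base_prod \<beta> k) \<le> real (V k) + 1"
  proof -
    have "real (V k) / real (base_prod \<beta> k) \<le> t" using lo by simp
    then show "real (V k) \<le> t * real (base_prod \<beta> k)" using P[of k] by (simp add: pos_divide_le_eq)
    have "t \<le> (real (V k) + 1) / real (base_prod \<beta> k)" using hi by (simp add: add_divide_distrib)
    then show "t * real (base_prod \<beta> k) \<le> real (V k) + 1" using P[of k] by (simp add: pos_le_divide_eq)
  qed
  moreover have "t * real (base_prod \<beta> k) \<noteq> real (V k) + 1" using nonint[of "Suc (V k)"] by simp
  ultimately have "\<lfloor>t * real (base_prod \<beta> k)\<rfloor> = int (V k)" by (intro floor_unique) auto
  then have "nat \<lfloor>t * real (base_prod \<beta> k)\<rfloor> mod \<beta> k = V k mod \<beta> k" by simp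
  also have "\<dots> = c k"
  proof -
    obtain k' where "k = Suc k'" using k by (cases k) auto
    then show ?thesis using cb[of k'] by (simp add: V)
  qed
  finally show ?thesis by (simp add: c_def)
qed

definition floor_digit :: "(nat \<Rightarrow> nat) \<Rightarrow> real \<Rightarrow> nat \<Rightarrow> nat" where
  "floor_digit \<beta> t k = nat \<lfloor>t * real (base_prod \<beta> k)\<rfloor> mod \<beta> k"

lemma div_mod_unique:
  assumes "r < q" "r' < (q::nat)"
  shows "a * q + r = a' * q + r' \<longleftrightarrow> a = a' \<and> r = r'"
proof
  assume e: "a * q + r = a' * q + r'"
  have "a = a'" using arg_cong[OF e, of "\<lambda>z. z div q"] assms by simp
  with e show "a = a' \<and> r = r'" by simp
qed simp

text \<open>Consecutive integer parts are related by division by the base, so the first \<open>N\<close> digits and the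
  integer part of \<open>t * base_prod \<beta> N\<close> determine each other.\<close>

lemma floor_digit_cylinder:
  assumes b: "\<forall>k\<ge>1. 2 \<le> \<beta> k" and \<xi>: "\<And>k. k \<in> {1..N} \<Longrightarrow> \<xi> k < \<beta> k"
  shows "\<exists>V. {t\<in>{0..<1}. \<forall>k\<in>{1..N}. floor_digit \<beta> t k = \<xi> k}
    = {real V / real (base_prod \<beta> N)..<(real V + 1) / real (base_prod \<beta> N)}"
proof -
  have P: "0 < real (base_prod \<beta> n)" for n using base_prod_pos[OF b] by simp
  define V where "V = rec_nat 0 (\<lambda>i v. v * \<beta> (Suc i) + \<xi> (Suc i))"
  have V: "V 0 = 0" "V (Suc i) = V i * \<beta> (Suc i) + \<xi> (Suc i)" for i by (simp_all add: V_def)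
  define F where "F t k = nat \<lfloor>t * real (base_prod \<beta> k)\<rfloor>" for t k
  have Fdiv: "F t (Suc k) div \<beta> (Suc k) = F t k" if "0 \<le> t" for t k
  proof -
    have "0 < \<beta> (Suc k)" using b by (metis One_nat_def le_add1 not_gr0 not_numeral_le_zero plus_1_eq_Suc)
    then have "\<lfloor>t * real (base_prod \<beta> k)\<rfloor> = \<lfloor>(t * real (base_prod \<beta> (Suc k))) / real_of_int (int (\<beta> (Suc k)))\<rfloor>"
      by (simp add: base_prod_Suc)
    also have "\<dots> = \<lfloor>t * real (base_prod \<beta> (Suc k))\<rfloor> div int (\<beta> (Suc k))"
      by (rule floor_divide_real_eq_div) simp
    finally show ?thesis unfolding F_def by (simp add: nat_div_distrib that)
  qed
  have F0: "F t 0 = 0" if "0 \<le> t" "t < 1" for t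
    using that by (simp add: F_def base_prod_def floor_eq_iff)
  have dig: "(\<forall>k\<in>{1..n}. floor_digit \<beta> t k = \<xi> k) \<longleftrightarrow> F t n = V n" if t: "0 \<le> t" "t < 1" and "n \<le> N" for t n
    using \<open>n \<le> N\<close>
  proof (induction n)
    case 0
    then show ?case using t by (simp add: F0 V)
  next
    case (Suc n)
    have lt: "\<xi> (Suc n) < \<beta> (Suc n)" using Suc.prems by (intro \<xi>) auto
    have "F t (Suc n) = F t n * \<beta> (Suc n) + floor_digit \<beta> t (Suc n)"
      using div_mult_mod_eq[of "F t (Suc n)" "\<beta> (Suc n)"] unfolding Fdiv[OF t(1), of n]
      by (simp only: floor_digit_def F_def)
    moreover have "floor_digit \<beta> t (Suc n) < \<beta> (Suc n)" using lt by (simp add: floor_digit_def)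
    ultimately have "F t (Suc n) = V (Suc n) \<longleftrightarrow> F t n = V n \<and> floor_digit \<beta> t (Suc n) = \<xi> (Suc n)"
      unfolding V(2) using div_mod_unique[OF _ lt] by simp
    moreover have "{1..Suc n} = insert (Suc n) {1..n}" by auto
    ultimately show ?case using Suc by auto
  qed
  have VP: "V n < base_prod \<beta> n" if "n \<le> N" for n
    using that
  proof (induction n)
    case (Suc n)
    have "\<xi> (Suc n) < \<beta> (Suc n)" using Suc.prems by (intro \<xi>) auto
    then have "V (Suc n) < Suc (V n) * \<beta> (Suc n)" by (simp add: V)
    also have "\<dots> \<le> base_prod \<beta> n * \<beta> (Suc n)" using Suc by (intro mult_le_mono1) auto
    finally show ?case by (simp add: base_prod_Suc)
  qed (simp add: V base_prod_def)
  have "{t\<in>{0..<1}. \<forall>k\<in>{1..N}. floor_digit \<beta> t k = \<xi> k}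
    = {real (V N) / real (base_prod \<beta> N)..<(real (V N) + 1) / real (base_prod \<beta> N)}" (is "?L = ?R")
  proof (intro set_eqI iffI)
    fix t assume "t \<in> ?L"
    then have t: "0 \<le> t" "t < 1" and e: "F t N = V N" using dig[of t N] by auto
    have "\<lfloor>t * real (base_prod \<beta> N)\<rfloor> = int (V N)" 
    proof -
      have "0 \<le> \<lfloor>t * real (base_prod \<beta> N)\<rfloor>" using t P[of N] by simp
      then show ?thesis using e unfolding F_def by linarith
    qed
    then show "t \<in> ?R" using P[of N] by (simp add: floor_eq_iff field_simps)
  next
    fix t assume t: "t \<in> ?R"
    have t0: "0 \<le> t" using t P[of N] by (auto intro: order_trans[rotated])
    have "real (V N) + 1 \<le> real (base_prod \<beta> N)" using VP[of N] by linarith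
    then have "(real (V N) + 1) / real (base_prod \<beta> N) \<le> 1" using P[of N] by simp
    then have t1: "t < 1" using t by simp
    have "\<lfloor>t * real (base_prod \<beta> N)\<rfloor> = int (V N)" using t P[of N] by (simp add: floor_eq_iff field_simps)
    then show "t \<in> ?L" using dig[of t N] t0 t1 by (simp add: F_def)
  qed
  then show ?thesis by blast
qed

lemma vilenkin_eq:
  assumes b: "\<forall>k\<ge>1. 2 \<le> \<beta> k" and n: "n < base_prod \<beta> N"
  shows "vilenkin \<beta> n t = (\<Prod>k=1..N. cis (2 * pi * real ((n div base_prod \<beta> (k - 1) mod \<beta> k) * real_digits \<beta> t k) / real (\<beta> k)))"
proof -
  let ?d = "nat_digits \<beta> n"
  have z: "?d k = 0" if "k \<notin> {1..N}" for k
  proof (cases "k = 0")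
    case False
    with that have k: "N \<le> k - 1" by auto
    have "base_prod \<beta> N \<le> base_prod \<beta> (k - 1)"
      using k
    proof (induction rule: dec_induct)
      case (step m)
      have "base_prod \<beta> m * 1 \<le> base_prod \<beta> m * \<beta> (Suc m)"
        using b by (intro mult_le_mono2) (metis One_nat_def le_add1 le_trans one_le_numeral plus_1_eq_Suc)
      also have "\<dots> = base_prod \<beta> (Suc m)" by (simp add: base_prod_Suc)
      finally show ?case using step by simp
    qed simp
    then show ?thesis using n by (simp add: nat_digits_eq[OF b])
  qed (simp add: nat_digits_eq[OF b])
  have "vilenkin \<beta> n t = (\<Prod>k=1..N. rademacher \<beta> k t ^ ?d k)"
    unfolding vilenkin_def
  proof (rule prod.mono_neutral_left)
    show "{k. ?d k \<noteq> 0} \<subseteq> {1..N}"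
    proof
      fix k assume "k \<in> {k. ?d k \<noteq> 0}"
      then have "?d k \<noteq> 0" by (rule CollectD)
      then show "k \<in> {1..N}" using z[of k] by argo
    qed
    show "\<forall>k\<in>{1..N} - {k. ?d k \<noteq> 0}. rademacher \<beta> k t ^ ?d k = 1"
    proof
      fix k assume "k \<in> {1..N} - {k. ?d k \<noteq> 0}"
      then have "?d k = 0" by (simp only: Diff_iff mem_Collect_eq not_not)
      then show "rademacher \<beta> k t ^ ?d k = 1" by (simp only: power_0)
    qed
  qed (rule finite_atLeastAtMost)
  also have "\<dots> = (\<Prod>k=1..N. cis (2 * pi * real ((n div base_prod \<beta> (k - 1) mod \<beta> k) * real_digits \<beta> t k) / real (\<beta> k)))"
  proof (rule prod.cong)
    fix k assume k: "k \<in> {1..N}"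
    have "rademacher \<beta> k t = cis (2 * pi * real (real_digits \<beta> t k) / real (\<beta> k))"
      unfolding rademacher_def cis_conv_exp by (intro arg_cong[where f = exp]) simp
    then show "rademacher \<beta> k t ^ ?d k = cis (2 * pi * real ((n div base_prod \<beta> (k - 1) mod \<beta> k) * real_digits \<beta> t k) / real (\<beta> k))"
      unfolding nat_digits_eq[OF b] using k
      by (simp only: Complex.DeMoivre) (auto intro!: arg_cong[where f = cis])
  qed simp
  finally show ?thesis .
qed

section \<open>From the cube to a grid\<close>

abbreviation unit_interval :: "real measure" where
  "unit_interval \<equiv> restrict_space lborel {0..<1}"

lemma sets_unit_interval: "A \<in> sets unit_interval \<longleftrightarrow> A \<subseteq> {0..<1} \<and> A \<in> sets borel"
  by (subst sets_restrict_space_iff) auto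

lemma emeasure_unit_interval: "A \<subseteq> {0..<1} \<Longrightarrow> emeasure unit_interval A = emeasure lborel A"
  by (rule emeasure_restrict_space) auto

lemma product_sigma_finite_unit: "product_sigma_finite (\<lambda>_::nat. unit_interval)"
  by (intro product_sigma_finite.intro sigma_finite_measure_restrict_space sigma_finite_lborel) auto

lemma space_cube: "space (cube D) = (\<Pi>\<^sub>E d\<in>{1..D}. {0..<1})"
  by (simp add: cube_def space_PiM)

lemma emeasure_cube_box:
  assumes "\<And>d. d \<in> {1..D} \<Longrightarrow> A d \<in> sets unit_interval"
  shows "emeasure (cube D) (\<Pi>\<^sub>E d\<in>{1..D}. A d) = (\<Prod>d=1..D. emeasure unit_interval (A d))"
    "(\<Pi>\<^sub>E d\<in>{1..D}. A d) \<in> sets (cube D)"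
proof -
  interpret product_sigma_finite "\<lambda>_::nat. unit_interval" by (rule product_sigma_finite_unit)
  show "emeasure (cube D) (\<Pi>\<^sub>E d\<in>{1..D}. A d) = (\<Prod>d=1..D. emeasure unit_interval (A d))"
    unfolding cube_def using assms by (intro emeasure_PiM) auto
  show "(\<Pi>\<^sub>E d\<in>{1..D}. A d) \<in> sets (cube D)"
    unfolding cube_def using assms by (intro sets_PiM_I_finite) auto
qed

lemma emeasure_cube: "emeasure (cube D) (space (cube D)) = 1"
  unfolding space_cube by (subst emeasure_cube_box) (auto simp: sets_unit_interval emeasure_unit_interval)

lemma AE_cube_coordinate:
  assumes d: "d \<in> {1..D}" and Q: "finite Q"
  shows "AE x in cube D. x d \<notin> Q"
proof -
  let ?A = "\<lambda>i. if i = d then Q \<inter> {0..<1} else {0..<1::real}"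
  have A: "?A i \<in> sets unit_interval" for i
    using Q by (auto simp: sets_unit_interval finite_imp_closed borel_closed intro!: borel_closed finite_imp_closed)
  have "emeasure (cube D) (\<Pi>\<^sub>E i\<in>{1..D}. ?A i) = (\<Prod>i=1..D. emeasure unit_interval (?A i))"
    using A by (rule emeasure_cube_box)
  also have "emeasure unit_interval (?A d) = 0"
    using Q by (simp add: emeasure_unit_interval emeasure_lborel_countable countable_finite)
  then have "(\<Prod>i=1..D. emeasure unit_interval (?A i)) = 0" using d by (intro prod_zero) auto
  finally have "(\<Pi>\<^sub>E i\<in>{1..D}. ?A i) \<in> null_sets (cube D)"
    using emeasure_cube_box(2)[of D ?A] A by (intro null_setsI) auto
  then show ?thesis
  proof (rule AE_I')
    show "{x \<in> space (cube D). \<not> x d \<notin> Q} \<subseteq> (\<Pi>\<^sub>E i\<in>{1..D}. ?A i)"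
      using d by (intro subsetI) (simp add: space_cube PiE_iff)
  qed
qed

context vilenkin_grid
begin

text \<open>The digits are read off from integer parts: this is measurable everywhere and agrees with the
  canonical digits away from finitely many hyperplanes.\<close>

definition point_digits :: "(nat \<Rightarrow> real) \<Rightarrow> nat \<times> nat \<Rightarrow> nat" where
  "point_digits x = (\<lambda>s\<in>coords. floor_digit (b (fst s)) (x (fst s)) (snd s))"

lemma base_ge_2: "d \<in> {1..D} \<Longrightarrow> \<forall>k\<ge>1. 2 \<le> b d k"
  using b_ge_2 by simp

lemma point_digits_in: "point_digits x \<in> X"
  unfolding X_def point_digits_def
proof (rule restrict_PiE_iff[THEN iffD2], rule ballI)
  fix s assume "s \<in> coords"
  from b_pos[OF this] show "floor_digit (b (fst s)) (x (fst s)) (snd s) \<in> {..<b (fst s) (snd s)}"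
    by (simp add: floor_digit_def)
qed

lemma card_X: "card X = (\<Prod>d=1..D. P d N)"
proof -
  have "card X = (\<Prod>s\<in>coords. b (fst s) (snd s))" unfolding X_def by (simp add: card_PiE fin_S)
  also have "\<dots> = (\<Prod>d=1..D. \<Prod>k=1..N. b d k)"
    unfolding coords_def prod.cartesian_product by (simp add: case_prod_beta)
  finally show ?thesis by (simp add: base_prod_def)
qed

lemma emeasure_cylinder:
  assumes \<xi>: "\<xi> \<in> X"
  shows "{x\<in>space (cube D). point_digits x = \<xi>} \<in> sets (cube D)"
    "emeasure (cube D) {x\<in>space (cube D). point_digits x = \<xi>} = ennreal (1 / real (card X))"
proof -
  let ?A = "\<lambda>d. {t\<in>{0..<1}. \<forall>k\<in>{1..N}. floor_digit (b d) t k = \<xi> (d, k)}"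
  have eq: "{x\<in>space (cube D). point_digits x = \<xi>} = (\<Pi>\<^sub>E d\<in>{1..D}. ?A d)"
  proof (intro set_eqI iffI)
    fix x assume x: "x \<in> {x\<in>space (cube D). point_digits x = \<xi>}"
    have "floor_digit (b d) (x d) k = \<xi> (d, k)" if "d \<in> {1..D}" "k \<in> {1..N}" for d k
    proof -
      have "point_digits x (d, k) = \<xi> (d, k)" using x by simp
      then show ?thesis using coordsI[OF that] by (simp add: point_digits_def)
    qed
    then show "x \<in> (\<Pi>\<^sub>E d\<in>{1..D}. ?A d)" using x unfolding space_cube PiE_iff by simp
  next
    fix x assume x: "x \<in> (\<Pi>\<^sub>E d\<in>{1..D}. ?A d)"
    have "point_digits x s = \<xi> s" for s
    proof (cases "s \<in> coords")
      case True
      then have s: "fst s \<in> {1..D}" "snd s \<in> {1..N}" unfolding coords_def mem_Times_iff by blast+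
      have "x (fst s) \<in> ?A (fst s)" by (rule PiE_mem[OF x s(1)])
      then have "floor_digit (b (fst s)) (x (fst s)) (snd s) = \<xi> (fst s, snd s)" using s(2) by blast
      then show ?thesis using True by (simp add: point_digits_def)
    next
      case False
      then show ?thesis using PiE_arb[OF \<xi>[unfolded X_def] False] unfolding point_digits_def
        by (simp only: restrict_def if_False)
    qed
    then have "point_digits x = \<xi>" by (rule ext)
    moreover have "x \<in> space (cube D)" using x unfolding space_cube PiE_iff by simp
    ultimately show "x \<in> {x\<in>space (cube D). point_digits x = \<xi>}" by simp
  qed
  have one: "?A d \<in> sets unit_interval \<and> emeasure unit_interval (?A d) = ennreal (1 / real (P d N))" if d: "d \<in> {1..D}" for d
  proof -
    have lt: "\<xi> (d, k) < b d k" if "k \<in> {1..N}" for k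
      using in_X_less[OF \<xi> coordsI[OF d that]] by simp
    obtain V where V: "?A d = {real V / real (P d N)..<(real V + 1) / real (P d N)}"
      using floor_digit_cylinder[OF base_ge_2[OF d], of N "\<lambda>k. \<xi> (d, k)"] lt by blast
    have sub: "?A d \<subseteq> {0..<1}" by blast
    have p: "0 < real (P d N)" using P_pos[OF d] by simp
    have "?A d \<in> sets borel" unfolding V by simp
    moreover have "emeasure unit_interval (?A d) = emeasure lborel (?A d)" by (rule emeasure_unit_interval[OF sub])
    moreover have "emeasure lborel (?A d) = ennreal (1 / real (P d N))"
      unfolding V using p by (subst emeasure_lborel_Ico) (auto simp: divide_right_mono diff_divide_distrib[symmetric])
    ultimately show ?thesis using sub by (simp only: sets_unit_interval simp_thms)
  qed
  show "{x\<in>space (cube D). point_digits x = \<xi>} \<in> sets (cube D)"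
    unfolding eq using one by (intro emeasure_cube_box) blast
  have "emeasure (cube D) (\<Pi>\<^sub>E d\<in>{1..D}. ?A d) = (\<Prod>d=1..D. emeasure unit_interval (?A d))"
    using one by (intro emeasure_cube_box) blast
  also have "\<dots> = (\<Prod>d=1..D. ennreal (1 / real (P d N)))" using one by (intro prod.cong) auto
  also have "\<dots> = ennreal (1 / real (card X))"
    unfolding card_X of_nat_prod by (subst prod_ennreal) (auto simp: prod_dividef)
  finally show "emeasure (cube D) {x\<in>space (cube D). point_digits x = \<xi>} = ennreal (1 / real (card X))"
    unfolding eq .
qed

lemma nn_integral_point_digits:
  fixes \<phi> :: "(nat \<times> nat \<Rightarrow> nat) \<Rightarrow> ennreal"
  shows "(\<integral>\<^sup>+x. \<phi> (point_digits x) \<partial>cube D) = ennreal (1 / real (card X)) * (\<Sum>\<xi>\<in>X. \<phi> \<xi>)"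
proof -
  let ?E = "\<lambda>\<xi>. {x\<in>space (cube D). point_digits x = \<xi>}"
  have "(\<integral>\<^sup>+x. \<phi> (point_digits x) \<partial>cube D) = (\<integral>\<^sup>+x. (\<Sum>\<xi>\<in>X. \<phi> \<xi> * indicator (?E \<xi>) x) \<partial>cube D)"
  proof (rule nn_integral_cong)
    fix x assume x: "x \<in> space (cube D)"
    have "(\<Sum>\<xi>\<in>X. \<phi> \<xi> * indicator (?E \<xi>) x) = (\<Sum>\<xi>\<in>{point_digits x}. \<phi> \<xi> * indicator (?E \<xi>) x)"
      using point_digits_in by (intro sum.mono_neutral_right) (auto simp: indicator_def)
    then show "\<phi> (point_digits x) = (\<Sum>\<xi>\<in>X. \<phi> \<xi> * indicator (?E \<xi>) x)" using x by simp
  qed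
  also have "\<dots> = (\<Sum>\<xi>\<in>X. \<integral>\<^sup>+x. \<phi> \<xi> * indicator (?E \<xi>) x \<partial>cube D)"
    using emeasure_cylinder(1) by (intro nn_integral_sum) auto
  also have "\<dots> = (\<Sum>\<xi>\<in>X. \<phi> \<xi> * ennreal (1 / real (card X)))"
    using emeasure_cylinder by (intro sum.cong) (auto simp: nn_integral_cmult_indicator)
  finally show ?thesis by (simp add: sum_distrib_right[symmetric] mult.commute)
qed

text \<open>The exceptional points have a coordinate that is a multiple of \<open>1 / P d N\<close>, where two expansions may
  compete.\<close>

lemma AE_vilenkin_tensor: "AE x in cube D. \<forall>n\<in>box. vilenkin_tensor D b n x = chi n (point_digits x)"
proof -
  have "AE x in cube D. \<forall>d\<in>{1..D}. x d \<notin> (\<lambda>j. real j / real (P d N)) ` {..P d N}"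
    by (intro AE_finite_allI AE_cube_coordinate) auto
  then show ?thesis using AE_space
  proof eventually_elim
    case (elim x)
    have xd: "0 \<le> x d" "x d < 1" if "d \<in> {1..D}" for d
      using PiE_mem[OF elim(2)[unfolded space_cube] that] by auto
    have dig: "real_digits (b d) (x d) k = floor_digit (b d) (x d) k" if d: "d \<in> {1..D}" and k: "k \<in> {1..N}" for d k
      unfolding floor_digit_def
    proof (rule real_digits_floor[OF base_ge_2[OF d] xd[OF d]])
      show "1 \<le> k" using k by simp
      fix j :: nat
      show "x d * real (P d k) \<noteq> real j"
      proof
        assume e: "x d * real (P d k) = real j"
        define Q where "Q = (\<Prod>i=Suc k..N. b d i)"
        have PQ: "P d N = P d k * Q" unfolding base_prod_def Q_def using k prod.ub_add_nat[of 1 k "b d" "N - k"] by simp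
        have pos: "0 < real (P d N)" using P_pos[OF d] by simp
        have "x d * real (P d N) = real (j * Q)" using e by (simp add: PQ mult.assoc[symmetric])
        then have eq: "x d = real (j * Q) / real (P d N)" using pos by (simp add: field_simps)
        then have "real (j * Q) / real (P d N) < 1" using xd[OF d] by simp
        then have "real (j * Q) < real (P d N)" using pos by simp
        then have "j * Q \<le> P d N" by linarith
        with eq elim(1) d show False by blast
      qed
    qed
    show ?case
    proof
      fix n assume n: "n \<in> box"
      show "vilenkin_tensor D b n x = chi n (point_digits x)"
        unfolding vilenkin_tensor_def chi_def
      proof (rule prod.cong)
        fix d assume d: "d \<in> {1..D}"
        show "vilenkin (b d) (n d) (x d) = chr d (n d) (point_digits x)"
          unfolding vilenkin_eq[OF base_ge_2[OF d] box_less[OF n d]] chr_def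
          using coordsI[OF d] by (intro prod.cong) (auto simp: dig[OF d] digit_def point_digits_def)
      qed simp
    qed
  qed
qed

end

lemma is_rectangle_finite: "is_rectangle D R \<Longrightarrow> finite R"
  unfolding is_rectangle_def by (auto intro!: finite_PiE)

text \<open>Disjointness of the rectangles allows all coefficients to be collected in one function \<open>c\<close> on
  frequencies, so that the family is described by its set of rectangles alone.\<close>

lemma cube_inequality_finite:
  fixes b :: "nat \<Rightarrow> nat \<Rightarrow> nat"
  assumes p: "1 < p" "p \<le> 2"
    and b: "\<And>d k. d \<in> {1..D} \<Longrightarrow> 1 \<le> k \<Longrightarrow> 2 \<le> b d k" "\<And>d k. d \<in> {1..D} \<Longrightarrow> 1 \<le> k \<Longrightarrow> b d k \<le> B"
    and K: "finite K" and rect: "\<And>k. k \<in> K \<Longrightarrow> is_rectangle D (I k)" and dis: "disjoint_family_on I K"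
    and spectrum: "\<And>k. k \<in> K \<Longrightarrow> has_spectrum_in D b (f k) (I k)"
  shows "(\<integral>\<^sup>+x. ennreal (\<bar>\<Sum>k\<in>K. f k x\<bar> powr p) \<partial>cube D)
    \<le> ennreal (grid_const D B p) * (\<integral>\<^sup>+x. ennreal ((\<Sum>k\<in>K. (f k x)\<^sup>2) powr (p / 2)) \<partial>cube D)"
proof -
  define K' where "K' = {k\<in>K. I k \<noteq> {}}"
  have K'K: "K' \<subseteq> K" "finite K'" using K by (auto simp: K'_def)
  have "\<forall>k\<in>K'. \<exists>lu. I k = (\<Pi>\<^sub>E d\<in>{1..D}. {fst lu d..<snd lu d})"
  proof
    fix k assume "k \<in> K'"
    then have "is_rectangle D (I k)" using rect K'K by blast
    then obtain l u where "I k = (\<Pi>\<^sub>E d\<in>{1..D}. {l d..<u d})" unfolding is_rectangle_def by blast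
    then show "\<exists>lu. I k = (\<Pi>\<^sub>E d\<in>{1..D}. {fst lu d..<snd lu d})" by (intro exI[of _ "(l, u)"]) simp
  qed
  from bchoice[OF this] obtain lu where lu: "\<forall>k\<in>K'. I k = (\<Pi>\<^sub>E d\<in>{1..D}. {fst (lu k) d..<snd (lu k) d})" ..
  define l u where "l k = fst (lu k)" and "u k = snd (lu k)" for k
  have I: "I k = (\<Pi>\<^sub>E d\<in>{1..D}. {l k d..<u k d})" if "k \<in> K'" for k
    using bspec[OF lu that] by (simp only: l_def u_def)
  \<comment> \<open>With \<open>N\<close> digits the grid has room for all spectra and for the upper neighbours of their sides.\<close>
  define N where "N = (\<Sum>k\<in>K'. \<Sum>d=1..D. u k d)"
  interpret vilenkin_grid D N b B using b by (intro vilenkin_grid.intro) auto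
  have uN: "u k d < P d N" if "k \<in> K'" "d \<in> {1..D}" for k d
  proof -
    have "u k d \<le> (\<Sum>d=1..D. u k d)" using that by (intro member_le_sum) auto
    also have "\<dots> \<le> N" unfolding N_def using that K'K by (intro member_le_sum[of k K' "\<lambda>k. \<Sum>d=1..D. u k d"]) auto
    also have "N < 2 ^ N" by simp
    also have "\<dots> \<le> P d N" by (rule base_prod_ge[OF base_ge_2[OF that(2)]])
    finally show ?thesis .
  qed
  have blocks: "rect_blocks 0 (I k)" if k: "k \<in> K'" for k
  proof -
    have "I k \<noteq> {}" using k by (simp add: K'_def)
    then have "l k d < u k d" if "d \<in> {1..D}" for d
      using that unfolding I[OF k] PiE_eq_empty_iff by fastforce
    then show ?thesis unfolding rect_blocks_def using I[OF k] uN[OF k]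
      by (intro exI[of _ "\<lambda>d. {l k d..<u k d}"] conjI ballI exI[of _ "l k _"] exI[of _ "u k _"]) auto
  qed
  define coef where "coef k n = cube_inner D (\<lambda>y. complex_of_real (f k y)) (vilenkin_tensor D b n)" for k n
  define c where "c n = (\<Sum>k\<in>K'. if n \<in> I k then coef k n else 0)" for n
  have c: "c n = coef k n" if k: "k \<in> K'" "n \<in> I k" for k n
  proof -
    have "c n = (\<Sum>k'\<in>K'. if k' = k then coef k n else 0)"
      unfolding c_def
    proof (intro sum.cong refl)
      fix k' assume k': "k' \<in> K'"
      show "(if n \<in> I k' then coef k' n else 0) = (if k' = k then coef k n else 0)"
        using disjoint_family_onD[OF dis, of k' k] K'K k k' by (cases "k' = k") auto
    qed
    then show ?thesis using K'K k by simp
  qed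
  let ?\<R> = "I ` K'"
  have inj: "inj_on I K'"
  proof (rule inj_onI, rule ccontr)
    fix k k' assume *: "k \<in> K'" "k' \<in> K'" "I k = I k'" "k \<noteq> k'"
    then have "I k \<inter> I k' = {}" using disjoint_family_onD[OF dis] K'K by blast
    with * show False by (simp add: K'_def)
  qed
  have dis\<R>: "disjoint ?\<R>"
    using disjoint_family_on_disjoint_image[OF disjoint_family_on_mono[OF K'K(1) dis]] .
  have finI: "finite (I k)" if "k \<in> K" for k using rect[OF that] by (rule is_rectangle_finite)
  have "AE x in cube D. \<forall>k\<in>K. complex_of_real (f k x) = (\<Sum>n\<in>I k. coef k n * vilenkin_tensor D b n x)"
    using spectrum K unfolding has_spectrum_in_def coef_def by (intro AE_finite_allI) blast+
  then have ae: "AE x in cube D. norm (spec c (\<Union>?\<R>) (point_digits x)) = \<bar>\<Sum>k\<in>K. f k x\<bar>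
     \<and> square_fn c ?\<R> (point_digits x) = sqrt (\<Sum>k\<in>K. (f k x)\<^sup>2)"
    using AE_vilenkin_tensor
  proof eventually_elim
    case (elim x)
    have zero: "f k x = 0" if "k \<in> K - K'" for k
    proof -
      have "complex_of_real (f k x) = 0" using bspec[OF elim(1), of k] that by (simp add: K'_def)
      then show ?thesis by simp
    qed
    have fk: "complex_of_real (f k x) = spec c (I k) (point_digits x)" if k: "k \<in> K'" for k
    proof -
      have "complex_of_real (f k x) = (\<Sum>n\<in>I k. coef k n * vilenkin_tensor D b n x)"
        using elim(1) K'K k by blast
      also have "\<dots> = spec c (I k) (point_digits x)"
        unfolding spec_def
      proof (rule sum.cong)
        fix n assume n: "n \<in> I k"
        have "vilenkin_tensor D b n x = chi n (point_digits x)"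
          using elim(2) rect_blocks_subset[OF blocks[OF k]] n by blast
        then show "coef k n * vilenkin_tensor D b n x = c n * chi n (point_digits x)" using c[OF k n] by simp
      qed simp
      finally show ?thesis .
    qed
    have "spec c (\<Union>?\<R>) (point_digits x) = (\<Sum>R\<in>?\<R>. spec c R (point_digits x))"
      unfolding spec_def using finI K'K dis\<R> by (subst sum.Union_disjoint_sets) (auto simp: o_def)
    also have "\<dots> = (\<Sum>k\<in>K'. complex_of_real (f k x))"
      using inj fk by (simp add: sum.reindex)
    also have "\<dots> = complex_of_real (\<Sum>k\<in>K. f k x)"
      unfolding of_real_sum using K'K K zero by (intro sum.mono_neutral_left) auto
    finally have 1: "norm (spec c (\<Union>?\<R>) (point_digits x)) = \<bar>\<Sum>k\<in>K. f k x\<bar>"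
      by (simp only: norm_of_real real_norm_def)
    have "square_fn c ?\<R> (point_digits x) = sqrt (\<Sum>R\<in>?\<R>. (norm (spec c R (point_digits x)))\<^sup>2)"
      by (simp add: square_fn_def L2_set_def)
    also have "(\<Sum>R\<in>?\<R>. (norm (spec c R (point_digits x)))\<^sup>2) = (\<Sum>k\<in>K'. (norm (spec c (I k) (point_digits x)))\<^sup>2)"
      using inj by (simp add: sum.reindex)
    also have "\<dots> = (\<Sum>k\<in>K'. (f k x)\<^sup>2)"
      using fk[symmetric] by (intro sum.cong) auto
    also have "\<dots> = (\<Sum>k\<in>K. (f k x)\<^sup>2)"
      using K'K K zero by (intro sum.mono_neutral_left) auto
    finally show ?case using 1 by simp
  qed
  have "(\<integral>\<^sup>+x. ennreal (\<bar>\<Sum>k\<in>K. f k x\<bar> powr p) \<partial>cube D)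
      = (\<integral>\<^sup>+x. ennreal (norm (spec c (\<Union>?\<R>) (point_digits x)) powr p) \<partial>cube D)"
    using ae by (intro nn_integral_cong_AE) (auto elim!: eventually_mono)
  also have "\<dots> = ennreal (1 / real (card X)) * (\<Sum>\<xi>\<in>X. ennreal (norm (spec c (\<Union>?\<R>) \<xi>) powr p))"
    by (rule nn_integral_point_digits)
  also have "\<dots> = ennreal (1 / real (card X)) * ennreal (\<Sum>\<xi>\<in>X. norm (spec c (\<Union>?\<R>) \<xi>) powr p)"
    by simp
  also have "\<dots> \<le> ennreal (1 / real (card X)) * ennreal (grid_const D B p * (\<Sum>\<xi>\<in>X. square_fn c ?\<R> \<xi> powr p))"
    using K'K blocks dis\<R> by (intro mult_left_mono ennreal_leI grid_inequality p) auto
  also have "\<dots> = ennreal (grid_const D B p) * (ennreal (1 / real (card X)) * (\<Sum>\<xi>\<in>X. ennreal (square_fn c ?\<R> \<xi> powr p)))"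
    using grid_const_nonneg[OF p, of D B] by (simp add: ennreal_mult sum_nonneg mult.left_commute)
  also have "ennreal (1 / real (card X)) * (\<Sum>\<xi>\<in>X. ennreal (square_fn c ?\<R> \<xi> powr p))
      = (\<integral>\<^sup>+x. ennreal (square_fn c ?\<R> (point_digits x) powr p) \<partial>cube D)"
    by (rule nn_integral_point_digits[symmetric])
  also have "\<dots> = (\<integral>\<^sup>+x. ennreal ((\<Sum>k\<in>K. (f k x)\<^sup>2) powr (p / 2)) \<partial>cube D)"
  proof (rule nn_integral_cong_AE)
    have pw: "sqrt s powr p = s powr (p / 2)" if "0 \<le> s" for s
      using that by (simp add: powr_half_sqrt[symmetric] powr_powr)
    show "AE x in cube D. ennreal (square_fn c ?\<R> (point_digits x) powr p) = ennreal ((\<Sum>k\<in>K. (f k x)\<^sup>2) powr (p / 2))"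
      using ae by eventually_elim (simp add: pw sum_nonneg)
  qed
  finally show ?thesis .
qed

section \<open>Countable families\<close>

lemma ennpowr_ennreal: "0 \<le> s \<Longrightarrow> ennpowr (ennreal s) a = ennreal (s powr a)"
  by (simp add: ennpowr_def)

lemma ennpowr_top: "ennpowr \<infinity> a = \<infinity>"
  by (simp add: ennpowr_def)

lemma ennpowr_mono:
  assumes "s \<le> t" "0 \<le> a"
  shows "ennpowr s a \<le> ennpowr t a"
proof (cases "t = \<infinity>")
  case False
  then have "t < top" by (simp add: less_top)
  then have "enn2real s \<le> enn2real t" "s \<noteq> \<infinity>" using assms(1) by (auto simp: enn2real_mono)
  then show ?thesis using False assms(2) by (simp add: ennpowr_def powr_mono2)
next
  case True
  then show ?thesis by (simp only: ennpowr_top) simp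
qed

lemma ennpowr_ennpowr: "ennpowr (ennpowr t a) c = ennpowr t (a * c)"
  by (simp add: ennpowr_def powr_powr)

lemma ennpowr_less_top: "ennpowr t a < \<infinity> \<longleftrightarrow> t < \<infinity>"
  by (simp add: ennpowr_def less_top)

lemma ennpowr_mult:
  assumes "0 \<le> c" "t < \<infinity>"
  shows "ennpowr (ennreal c * t) a = ennreal (c powr a) * ennpowr t a"
proof -
  obtain s where s: "t = ennreal s" "0 \<le> s" using assms(2) by (cases t) auto
  show ?thesis using assms(1) s(2) unfolding s(1)
    by (simp add: ennreal_mult[symmetric] ennpowr_ennreal powr_mult)
qed

lemma ennpowr_tendsto_0:
  assumes v: "(v \<longlongrightarrow> 0) F" and a: "0 < a"
  shows "((\<lambda>i. ennpowr (v i) a) \<longlongrightarrow> 0) F"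
proof -
  have "((\<lambda>i. enn2real (v i)) \<longlongrightarrow> 0) F" using tendsto_enn2real[of v 0 F] v by simp
  then have "((\<lambda>i. enn2real (v i) powr a) \<longlongrightarrow> 0) F"
    using a by (intro tendsto_zero_powrI[where b = a]) auto
  then have "((\<lambda>i. ennreal (enn2real (v i) powr a)) \<longlongrightarrow> 0) F"
    using tendsto_ennrealI by fastforce
  moreover have "\<forall>\<^sub>F i in F. ennreal (enn2real (v i) powr a) = ennpowr (v i) a"
    using order_tendstoD(2)[OF v, of 1] by (auto elim!: eventually_mono simp: ennpowr_def)
  ultimately show ?thesis by (rule Lim_transform_eventually)
qed

lemma measurable_ennpowr [measurable]:
  assumes [measurable]: "h \<in> borel_measurable M"
  shows "(\<lambda>x. ennpowr (h x) a) \<in> borel_measurable M"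
  unfolding ennpowr_def by measurable

lemma suminf_tail_tendsto_0:
  fixes a :: "nat \<Rightarrow> ennreal"
  assumes "(\<Sum>k. a k) < \<infinity>"
  shows "(\<lambda>i. \<Sum>k. a (k + i)) \<longlonglongrightarrow> 0"
proof -
  define r where "r k = enn2real (a k)" for k
  have "a k \<le> (\<Sum>k. a k)" for k using sum_le_suminf[of a "{k}"] by simp
  then have "a k < \<infinity>" for k using assms by (rule le_less_trans)
  then have ar: "a k = ennreal (r k)" for k by (simp add: r_def)
  have r0: "0 \<le> r k" for k by (simp add: r_def)
  have sm: "summable r" using assms r0 unfolding ar by (intro summable_suminf_not_top) auto
  have "(\<lambda>i. suminf r - (\<Sum>k<i. r k)) \<longlonglongrightarrow> suminf r - suminf r"
    using summable_LIMSEQ[OF sm] by (intro tendsto_intros)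
  then have "(\<lambda>i. ennreal (\<Sum>k. r (k + i))) \<longlonglongrightarrow> ennreal 0"
    unfolding suminf_minus_initial_segment[OF sm] by (intro tendsto_ennrealI) simp
  moreover have "(\<Sum>k. a (k + i)) = ennreal (\<Sum>k. r (k + i))" for i
    unfolding ar using r0 sm by (intro suminf_ennreal2) (auto simp: summable_iff_shift)
  ultimately show ?thesis by simp
qed

lemma infsum_nat_eq_suminf:
  fixes a :: "nat \<Rightarrow> ennreal"
  shows "infsum a K = (\<Sum>k. if k \<in> K then a k else 0)"
proof -
  let ?a = "\<lambda>k. if k \<in> K then a k else 0"
  have "infsum a K = infsum ?a UNIV" by (rule infsum_cong_neutral) auto
  moreover have "(?a has_sum infsum ?a UNIV) UNIV"
    by (intro has_sum_infsum nonneg_summable_on_complete) auto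
  then have "?a sums infsum ?a UNIV" by (rule has_sum_imp_sums)
  ultimately show ?thesis by (simp add: sums_iff)
qed

text \<open>On a probability space this bounds the \<open>L\<^sup>1\<close> norm by a small constant plus a multiple of the \<open>p\<close>-th
  power integral, which turns Cauchy sequences in \<open>L\<^sup>p\<close> into Cauchy sequences in \<open>L\<^sup>1\<close>.\<close>

lemma abs_le_powr:
  fixes u e :: real
  assumes "0 < e" "1 \<le> p"
  shows "\<bar>u\<bar> \<le> e + e powr (1 - p) * \<bar>u\<bar> powr p"
proof (cases "\<bar>u\<bar> \<le> e")
  case False
  then have u: "0 < \<bar>u\<bar>" using assms by linarith
  have "\<bar>u\<bar> = \<bar>u\<bar> powr (1 - p) * \<bar>u\<bar> powr p" using u by (simp add: powr_add[symmetric])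
  also have "\<dots> \<le> e powr (1 - p) * \<bar>u\<bar> powr p"
    using False assms u by (intro mult_right_mono powr_mono2') auto
  finally show ?thesis using assms by linarith
qed (use assms in \<open>auto intro: order_trans[of _ e]\<close>)

text \<open>The inequality for finite families makes the partial sums Cauchy, since the square functions
  of the tails tend to 0 by dominated convergence. The sum \<open>g\<close> is an almost everywhere limit of a
  subsequence, and Fatou's lemma transfers the tail estimate to every finite index set that contains
  a long initial segment of \<open>K\<close>, as unordered convergence requires.\<close>

lemma Lp_sum_of_square_function:
  fixes M :: "'a measure" and f :: "nat \<Rightarrow> 'a \<Rightarrow> real"
  assumes p: "1 \<le> p" and M: "emeasure M (space M) = 1"
    and meas: "\<And>k. k \<in> K \<Longrightarrow> f k \<in> borel_measurable M"
    and C: "0 \<le> C"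
    and ineq: "\<And>G. finite G \<Longrightarrow> G \<subseteq> K \<Longrightarrow> (\<integral>\<^sup>+x. ennreal (\<bar>\<Sum>k\<in>G. f k x\<bar> powr p) \<partial>M)
        \<le> ennreal C * (\<integral>\<^sup>+x. ennreal ((\<Sum>k\<in>G. (f k x)\<^sup>2) powr (p / 2)) \<partial>M)"
    and fin: "Lp_norm M p (square_function f K) < \<infinity>"
  shows "\<exists>g. has_Lp_sum M p f K g \<and>
    Lp_norm M p (\<lambda>x. ennreal \<bar>g x\<bar>) \<le> ennreal (C powr (1 / p)) * Lp_norm M p (square_function f K)"
proof -
  define a where "a k x = (if k \<in> K then ennreal ((f k x)\<^sup>2) else 0)" for k x
  define T where "T j x = (\<Sum>k. a (k + j) x)" for j x
  define E where "E j = (\<integral>\<^sup>+x. ennpowr (T j x) (p / 2) \<partial>M)" for j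
  have a_meas [measurable]: "a k \<in> borel_measurable M" for k
    using meas[of k] unfolding a_def by (cases "k \<in> K") auto
  have T_meas [measurable]: "T j \<in> borel_measurable M" for j
    unfolding T_def by measurable
  have sum_meas: "(\<lambda>x. \<Sum>k\<in>G. f k x) \<in> borel_measurable M" if "G \<subseteq> K" for G
    using meas that by (intro borel_measurable_sum) auto
  have sqf: "square_function f K x = ennpowr (T 0 x) (1 / 2)" for x
    unfolding square_function_def infsum_nat_eq_suminf T_def a_def by (simp only: add_0_right power2_abs)
  have norm_sqf: "Lp_norm M p (square_function f K) = ennpowr (E 0) (1 / p)"
    unfolding Lp_norm_def sqf ennpowr_ennpowr E_def by simp
  have E0: "E 0 < \<infinity>" using fin unfolding norm_sqf ennpowr_less_top .
  have T_mono: "T j x \<le> T 0 x" for j x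
  proof -
    have "T 0 x = (\<Sum>k<j. a k x) + T j x"
      unfolding T_def using suminf_offset[of "\<lambda>k. a k x" j] by (simp add: summableI)
    then show ?thesis by simp
  qed
  have E_mono: "E j \<le> E 0" for j
    unfolding E_def using p T_mono by (intro nn_integral_mono ennpowr_mono) auto
  have tail: "(\<integral>\<^sup>+x. ennreal (\<bar>\<Sum>k\<in>G. f k x\<bar> powr p) \<partial>M) \<le> ennreal C * E j"
    if G: "finite G" "G \<subseteq> K - {..<j}" for G j
  proof -
    have "ennreal ((\<Sum>k\<in>G. (f k x)\<^sup>2) powr (p / 2)) \<le> ennpowr (T j x) (p / 2)" for x
    proof -
      have "ennreal (\<Sum>k\<in>G. (f k x)\<^sup>2) = (\<Sum>k\<in>G. ennreal ((f k x)\<^sup>2))" by simp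
      also have "\<dots> = (\<Sum>k\<in>G. a k x)" using G by (intro sum.cong) (auto simp: a_def)
      also have "\<dots> = (\<Sum>i\<in>(\<lambda>k. k - j) ` G. a (i + j) x)"
      proof -
        have ge: "j \<le> k" if "k \<in> G" for k using G(2) that by auto
        have "inj_on (\<lambda>k. k - j) G" using ge by (intro inj_onI) (metis eq_diff_iff)
        then show ?thesis using ge by (simp add: sum.reindex)
      qed
      also have "\<dots> \<le> T j x" unfolding T_def using G by (intro sum_le_suminf) (auto simp: summableI)
      finally have "ennpowr (ennreal (\<Sum>k\<in>G. (f k x)\<^sup>2)) (p / 2) \<le> ennpowr (T j x) (p / 2)"
        using p by (intro ennpowr_mono) auto
      then show ?thesis by (simp add: ennpowr_ennreal sum_nonneg)
    qed
    then have "(\<integral>\<^sup>+x. ennreal ((\<Sum>k\<in>G. (f k x)\<^sup>2) powr (p / 2)) \<partial>M) \<le> E j"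
      unfolding E_def by (intro nn_integral_mono)
    then show ?thesis using ineq[OF G(1)] G(2) by (meson Diff_subset mult_left_mono order_trans zero_le)
  qed
  have E_lim: "E \<longlonglongrightarrow> 0"
  proof -
    have "AE x in M. ennpowr (T 0 x) (p / 2) \<noteq> \<infinity>"
      using E0 unfolding E_def by (intro nn_integral_PInf_AE) auto
    then have "AE x in M. (\<lambda>j. ennpowr (T j x) (p / 2)) \<longlonglongrightarrow> 0"
    proof eventually_elim
      case (elim x)
      then have "T 0 x < \<infinity>" using ennpowr_less_top[of "T 0 x" "p / 2"] by (simp add: less_top)
      then have "(\<lambda>j. T j x) \<longlonglongrightarrow> 0" unfolding T_def by (intro suminf_tail_tendsto_0) simp
      then show ?case using p by (intro ennpowr_tendsto_0) auto
    qed
    then have "(\<lambda>j. \<integral>\<^sup>+x. ennpowr (T j x) (p / 2) \<partial>M) \<longlonglongrightarrow> (\<integral>\<^sup>+x. 0 \<partial>M)"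
      using E0 p T_mono unfolding E_def
      by (intro nn_integral_dominated_convergence[where w = "\<lambda>x. ennpowr (T 0 x) (p / 2)"])
         (auto intro!: ennpowr_mono)
    then show ?thesis by (simp add: E_def[abs_def])
  qed
  then have CE_lim: "(\<lambda>j. ennreal C * E j) \<longlonglongrightarrow> 0"
    using ennreal_tendsto_cmult[of "ennreal C" E 0] by simp
  have CE0: "ennreal C * E 0 < \<infinity>" using E0 by (simp add: ennreal_mult_less_top)
  define s where "s j x = (\<Sum>k\<in>K \<inter> {..<j}. f k x)" for j x
  have s_meas [measurable]: "s j \<in> borel_measurable M" for j
    unfolding s_def by (intro sum_meas) auto
  have L1: "(\<integral>\<^sup>+x. ennreal \<bar>\<Sum>k\<in>G. f k x\<bar> \<partial>M) \<le> ennreal e + ennreal (e powr (1 - p)) * (ennreal C * E j)"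
    if G: "finite G" "G \<subseteq> K - {..<j}" and e: "0 < e" for G j e
  proof -
    have GK: "G \<subseteq> K" using G by auto
    have "(\<integral>\<^sup>+x. ennreal \<bar>\<Sum>k\<in>G. f k x\<bar> \<partial>M)
        \<le> (\<integral>\<^sup>+x. ennreal e + ennreal (e powr (1 - p)) * ennreal (\<bar>\<Sum>k\<in>G. f k x\<bar> powr p) \<partial>M)"
    proof (rule nn_integral_mono)
      fix x
      have "ennreal \<bar>\<Sum>k\<in>G. f k x\<bar> \<le> ennreal (e + e powr (1 - p) * \<bar>\<Sum>k\<in>G. f k x\<bar> powr p)"
        using e p by (intro ennreal_leI abs_le_powr)
      then show "ennreal \<bar>\<Sum>k\<in>G. f k x\<bar> \<le> ennreal e + ennreal (e powr (1 - p)) * ennreal (\<bar>\<Sum>k\<in>G. f k x\<bar> powr p)"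
        using e by (simp add: ennreal_mult)
    qed
    also have "\<dots> = ennreal e + ennreal (e powr (1 - p)) * (\<integral>\<^sup>+x. ennreal (\<bar>\<Sum>k\<in>G. f k x\<bar> powr p) \<partial>M)"
      using sum_meas[OF GK] by (simp add: nn_integral_add nn_integral_cmult M)
    also have "\<dots> \<le> ennreal e + ennreal (e powr (1 - p)) * (ennreal C * E j)"
      using tail[OF G] by (intro add_left_mono mult_left_mono) auto
    finally show ?thesis .
  qed
  have int: "integrable M (\<lambda>x. \<Sum>k\<in>G. f k x)" if G: "finite G" "G \<subseteq> K" for G
  proof (rule integrableI_bounded)
    have "(\<integral>\<^sup>+x. ennreal \<bar>\<Sum>k\<in>G. f k x\<bar> \<partial>M) \<le> ennreal 1 + ennreal (1 powr (1 - p)) * (ennreal C * E 0)"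
      using G by (intro L1) auto
    also have "\<dots> < \<infinity>" using CE0 by simp
    finally show "(\<integral>\<^sup>+x. ennreal (norm (\<Sum>k\<in>G. f k x)) \<partial>M) < \<infinity>" by simp
  qed (rule sum_meas[OF G(2)])
  have diff: "\<exists>G. finite G \<and> G \<subseteq> K - {..<n} \<and> (\<forall>x. \<bar>s i x - s j x\<bar> = \<bar>\<Sum>k\<in>G. f k x\<bar>)"
    if n: "n \<le> i" "n \<le> j" for i j n
  proof -
    have *: "\<exists>G. finite G \<and> G \<subseteq> K - {..<n} \<and> (\<forall>x. \<bar>s i x - s j x\<bar> = \<bar>\<Sum>k\<in>G. f k x\<bar>)"
      if ij: "n \<le> i" "i \<le> j" for i j
    proof (intro exI[of _ "K \<inter> {i..<j}"] conjI allI)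
      fix x
      have "K \<inter> {..<j} = (K \<inter> {..<i}) \<union> (K \<inter> {i..<j})" using ij by auto
      moreover have "(\<Sum>k\<in>(K \<inter> {..<i}) \<union> (K \<inter> {i..<j}). f k x)
          = (\<Sum>k\<in>K \<inter> {..<i}. f k x) + (\<Sum>k\<in>K \<inter> {i..<j}. f k x)"
        by (rule sum.union_disjoint) auto
      ultimately have "s j x = s i x + (\<Sum>k\<in>K \<inter> {i..<j}. f k x)" unfolding s_def by (rule ssubst)
      then show "\<bar>s i x - s j x\<bar> = \<bar>\<Sum>k\<in>K \<inter> {i..<j}. f k x\<bar>" by simp
    qed (use ij in auto)
    show ?thesis
    proof (cases "i \<le> j")
      case True
      show ?thesis by (rule *[OF n(1) True])
    next
      case False
      then have "j \<le> i" by simp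
      from *[OF n(2) this] show ?thesis unfolding abs_minus_commute[of "s i _"] .
    qed
  qed
  obtain r where r: "strict_mono r" "AE x in M. Cauchy (\<lambda>i. s (r i) x)"
  proof (rule cauchy_L1_AE_cauchy_subseq[of M s])
    show "integrable M (s n)" for n unfolding s_def by (intro int) auto
    fix e :: real assume e: "0 < e"
    have "(\<lambda>j. ennreal (e / 2) + ennreal ((e / 2) powr (1 - p)) * (ennreal C * E j)) \<longlonglongrightarrow> ennreal (e / 2) + ennreal ((e / 2) powr (1 - p)) * 0"
      by (intro tendsto_add tendsto_const ennreal_tendsto_cmult CE_lim) auto
    then have "(\<lambda>j. ennreal (e / 2) + ennreal ((e / 2) powr (1 - p)) * (ennreal C * E j)) \<longlonglongrightarrow> ennreal (e / 2)" by simp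
    moreover have "ennreal (e / 2) < ennreal e" using e by (simp add: ennreal_less_iff)
    ultimately have "\<forall>\<^sub>F j in sequentially. ennreal (e / 2) + ennreal ((e / 2) powr (1 - p)) * (ennreal C * E j) < ennreal e"
      by (rule order_tendstoD(2))
    then obtain n where n: "ennreal (e / 2) + ennreal ((e / 2) powr (1 - p)) * (ennreal C * E n) < ennreal e"
      by (auto simp: eventually_sequentially)
    show "\<exists>n. \<forall>i\<ge>n. \<forall>j\<ge>n. (LINT x|M. norm (s i x - s j x)) < e"
    proof (intro exI[of _ n] allI impI)
      fix i j assume ij: "n \<le> i" "n \<le> j"
      obtain G where G: "finite G" "G \<subseteq> K - {..<n}" "\<And>x. \<bar>s i x - s j x\<bar> = \<bar>\<Sum>k\<in>G. f k x\<bar>"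
        using diff[OF ij] by blast
      have "ennreal (LINT x|M. norm (s i x - s j x)) = (\<integral>\<^sup>+x. ennreal \<bar>\<Sum>k\<in>G. f k x\<bar> \<partial>M)"
        unfolding real_norm_def G(3) using G by (intro nn_integral_eq_integral[symmetric] integrable_abs int) auto
      also have "\<dots> \<le> ennreal (e / 2) + ennreal ((e / 2) powr (1 - p)) * (ennreal C * E n)"
        using G e by (intro L1) auto
      also have "\<dots> < ennreal e" by (rule n)
      finally show "(LINT x|M. norm (s i x - s j x)) < e" using e by (simp add: ennreal_less_iff)
    qed
  qed
  define g where "g x = lim (\<lambda>i. s (r i) x)" for x
  have g_meas [measurable]: "g \<in> borel_measurable M" unfolding g_def by measurable
  have conv: "AE x in M. (\<lambda>i. s (r i) x) \<longlonglongrightarrow> g x"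
    using r(2) unfolding g_def by eventually_elim (simp add: Cauchy_convergent_iff convergent_LIMSEQ_iff)
  have dist: "(\<integral>\<^sup>+x. ennreal (\<bar>(\<Sum>k\<in>F. f k x) - g x\<bar> powr p) \<partial>M) \<le> ennreal C * E j"
    if F: "finite F" "F \<subseteq> K" "K \<inter> {..<j} \<subseteq> F" for F j
  proof -
    let ?u = "\<lambda>i x. ennreal (\<bar>(\<Sum>k\<in>F. f k x) - s (r i) x\<bar> powr p)"
    have [measurable]: "(\<lambda>x. \<Sum>k\<in>F. f k x) \<in> borel_measurable M" by (rule sum_meas[OF F(2)])
    have "(\<integral>\<^sup>+x. ennreal (\<bar>(\<Sum>k\<in>F. f k x) - g x\<bar> powr p) \<partial>M) = (\<integral>\<^sup>+x. liminf (\<lambda>i. ?u i x) \<partial>M)"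
    proof (rule nn_integral_cong_AE)
      show "AE x in M. ennreal (\<bar>(\<Sum>k\<in>F. f k x) - g x\<bar> powr p) = liminf (\<lambda>i. ?u i x)"
        using conv
      proof eventually_elim
        case (elim x)
        have "(\<lambda>i. ?u i x) \<longlonglongrightarrow> ennreal (\<bar>(\<Sum>k\<in>F. f k x) - g x\<bar> powr p)"
          using p elim by (intro tendsto_ennrealI tendsto_powr' tendsto_rabs tendsto_diff tendsto_const) auto
        then show ?case by (intro lim_imp_Liminf[symmetric]) auto
      qed
    qed
    also have "\<dots> \<le> liminf (\<lambda>i. \<integral>\<^sup>+x. ?u i x \<partial>M)" by (rule nn_integral_liminf) measurable
    also have "\<dots> \<le> ennreal C * E j"
    proof (rule Liminf_le)
      show "\<forall>\<^sub>F i in sequentially. (\<integral>\<^sup>+x. ?u i x \<partial>M) \<le> ennreal C * E j"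
        using eventually_ge_at_top[of "Suc (Max (insert 0 F))"]
      proof eventually_elim
        case (elim i)
        let ?G = "(K \<inter> {..<r i}) - F"
        have Fr: "F \<subseteq> K \<inter> {..<r i}"
        proof
          fix k assume k: "k \<in> F"
          have "k \<le> Max (insert 0 F)" using F k by (intro Max_ge) auto
          also have "\<dots> < i" using elim by simp
          also have "i \<le> r i" by (rule strict_mono_imp_increasing[OF r(1)])
          finally show "k \<in> K \<inter> {..<r i}" using k F by auto
        qed
        have "\<bar>(\<Sum>k\<in>F. f k x) - s (r i) x\<bar> = \<bar>\<Sum>k\<in>?G. f k x\<bar>" for x
        proof -
          have "(\<Sum>k\<in>?G. f k x) = s (r i) x - (\<Sum>k\<in>F. f k x)"
            unfolding s_def using Fr by (intro sum_diff) auto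
          then show ?thesis by simp
        qed
        then show ?case using tail[of ?G j] F by auto
      qed
    qed simp
    finally show ?thesis .
  qed
  have norm_eq: "Lp_norm M p (\<lambda>x. ennreal \<bar>h x\<bar>) = ennpowr (\<integral>\<^sup>+x. ennreal (\<bar>h x\<bar> powr p) \<partial>M) (1 / p)" for h :: "'a \<Rightarrow> real"
    by (simp add: Lp_norm_def ennpowr_ennreal)
  have "((\<lambda>F. Lp_norm M p (\<lambda>x. ennreal \<bar>(\<Sum>k\<in>F. f k x) - g x\<bar>)) \<longlongrightarrow> 0) (finite_subsets_at_top K)"
  proof (rule order_tendstoI)
    fix e :: ennreal assume e: "0 < e"
    have "(\<lambda>j. ennpowr (ennreal C * E j) (1 / p)) \<longlonglongrightarrow> 0"
      using p by (intro ennpowr_tendsto_0 CE_lim) auto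
    then have "\<forall>\<^sub>F j in sequentially. ennpowr (ennreal C * E j) (1 / p) < e"
      using e by (rule order_tendstoD(2))
    then obtain j where j: "ennpowr (ennreal C * E j) (1 / p) < e" by (auto simp: eventually_sequentially)
    show "\<forall>\<^sub>F F in finite_subsets_at_top K. Lp_norm M p (\<lambda>x. ennreal \<bar>(\<Sum>k\<in>F. f k x) - g x\<bar>) < e"
      unfolding eventually_finite_subsets_at_top
    proof (intro exI[of _ "K \<inter> {..<j}"] conjI allI impI)
      fix F assume F: "finite F \<and> K \<inter> {..<j} \<subseteq> F \<and> F \<subseteq> K"
      have "Lp_norm M p (\<lambda>x. ennreal \<bar>(\<Sum>k\<in>F. f k x) - g x\<bar>) \<le> ennpowr (ennreal C * E j) (1 / p)"
        unfolding norm_eq using F p by (intro ennpowr_mono dist) auto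
      then show "Lp_norm M p (\<lambda>x. ennreal \<bar>(\<Sum>k\<in>F. f k x) - g x\<bar>) < e" using j by (rule le_less_trans)
    qed auto
  qed simp
  moreover have "Lp_norm M p (\<lambda>x. ennreal \<bar>g x\<bar>) \<le> ennreal (C powr (1 / p)) * Lp_norm M p (square_function f K)"
  proof -
    have "Lp_norm M p (\<lambda>x. ennreal \<bar>g x\<bar>) \<le> ennpowr (ennreal C * E 0) (1 / p)"
      unfolding norm_eq using dist[of "{}" 0] p by (intro ennpowr_mono) auto
    also have "\<dots> = ennreal (C powr (1 / p)) * Lp_norm M p (square_function f K)"
      unfolding norm_sqf by (rule ennpowr_mult[OF C E0])
    finally show ?thesis .
  qed
  ultimately show ?thesis using g_meas unfolding has_Lp_sum_def by blast
qed

theorem theorem1: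
  fixes D :: nat and p :: real and b :: "nat \<Rightarrow> nat \<Rightarrow> nat"
  assumes "1 \<le> D" and "1 < p" and "p \<le> 2"
    and "\<And>d. d \<in> {1..D} \<Longrightarrow> bounded_base (b d)"
  shows "\<exists>C>0. \<forall>(K :: nat set) (I :: nat \<Rightarrow> (nat \<Rightarrow> nat) set) (f :: nat \<Rightarrow> (nat \<Rightarrow> real) \<Rightarrow> real).
    (\<forall>k\<in>K. is_rectangle D (I k)) \<longrightarrow>
    disjoint_family_on I K \<longrightarrow>
    (\<forall>k\<in>K. has_spectrum_in D b (f k) (I k)) \<longrightarrow>
    Lp_norm (cube D) p (square_function f K) < \<infinity> \<longrightarrow>
    (\<exists>g. has_Lp_sum (cube D) p f K g \<and>
         Lp_norm (cube D) p (\<lambda>x. ennreal \<bar>g x\<bar>)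
           \<le> ennreal C * Lp_norm (cube D) p (square_function f K))"
proof -
  have "\<forall>d\<in>{1..D}. \<exists>B. \<forall>k\<ge>1. b d k \<le> B" using assms(4) unfolding bounded_base_def by blast
  from bchoice[OF this] obtain Bd where Bd: "\<forall>d\<in>{1..D}. \<forall>k\<ge>1. b d k \<le> Bd d" ..
  define B where "B = (\<Sum>d=1..D. Bd d)"
  have b2: "2 \<le> b d k" if "d \<in> {1..D}" "1 \<le> k" for d k
    using assms(4)[OF that(1)] that(2) unfolding bounded_base_def by blast
  have bB: "b d k \<le> B" if d: "d \<in> {1..D}" and k: "1 \<le> k" for d k
  proof -
    have "b d k \<le> Bd d" using Bd d k by blast
    also have "\<dots> \<le> B" unfolding B_def using d by (intro member_le_sum) auto
    finally show ?thesis .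
  qed
  define C where "C = grid_const D B p"
  have C0: "0 \<le> C" unfolding C_def using assms by (intro grid_const_nonneg)
  show ?thesis
  proof (intro exI[of _ "C powr (1 / p) + 1"] conjI allI impI)
    show "0 < C powr (1 / p) + 1" by (intro add_nonneg_pos) auto
    fix K :: "nat set" and I :: "nat \<Rightarrow> (nat \<Rightarrow> nat) set" and f :: "nat \<Rightarrow> (nat \<Rightarrow> real) \<Rightarrow> real"
    assume rect: "\<forall>k\<in>K. is_rectangle D (I k)" and dis: "disjoint_family_on I K"
      and spectrum: "\<forall>k\<in>K. has_spectrum_in D b (f k) (I k)"
      and fin: "Lp_norm (cube D) p (square_function f K) < \<infinity>"
    have "\<exists>g. has_Lp_sum (cube D) p f K g \<and>
      Lp_norm (cube D) p (\<lambda>x. ennreal \<bar>g x\<bar>) \<le> ennreal (C powr (1 / p)) * Lp_norm (cube D) p (square_function f K)"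
    proof (rule Lp_sum_of_square_function[OF _ emeasure_cube _ C0 _ fin])
      show "1 \<le> p" using assms by simp
      show "f k \<in> borel_measurable (cube D)" if "k \<in> K" for k
        using spectrum that unfolding has_spectrum_in_def by blast
      fix G assume G: "finite G" "G \<subseteq> K"
      show "(\<integral>\<^sup>+x. ennreal (\<bar>\<Sum>k\<in>G. f k x\<bar> powr p) \<partial>cube D)
        \<le> ennreal C * (\<integral>\<^sup>+x. ennreal ((\<Sum>k\<in>G. (f k x)\<^sup>2) powr (p / 2)) \<partial>cube D)"
        unfolding C_def using G rect spectrum b2 bB
        by (intro cube_inequality_finite[where b = b and I = I] assms(2,3) disjoint_family_on_mono[OF G(2) dis]) auto
    qed
    then obtain g where g: "has_Lp_sum (cube D) p f K g"
      "Lp_norm (cube D) p (\<lambda>x. ennreal \<bar>g x\<bar>) \<le> ennreal (C powr (1 / p)) * Lp_norm (cube D) p (square_function f K)"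
      by blast
    have "ennreal (C powr (1 / p)) * Lp_norm (cube D) p (square_function f K)
        \<le> ennreal (C powr (1 / p) + 1) * Lp_norm (cube D) p (square_function f K)"
      by (intro mult_right_mono ennreal_leI) auto
    with g show "\<exists>g. has_Lp_sum (cube D) p f K g \<and>
      Lp_norm (cube D) p (\<lambda>x. ennreal \<bar>g x\<bar>) \<le> ennreal (C powr (1 / p) + 1) * Lp_norm (cube D) p (square_function f K)"
      by (meson order_trans)
  qed
qed

end
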